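(* Consider oriented homogeneous bond Bernoulli percolation on $\mathbb{Z}^d$, with critical point $\vec{p}^{\,b}_c(d)$. The three following statements hold. 1) If $d$ is even, then $\vec{p}^{\,b}_c(d)\leq 1-(1/3)^{2/d}$. 2) For $d \geq 4$, we have $$\vec{p}^{\,b}_c(d)\leq \frac{1}{d}+\frac{C_d}{d^2},\qquad\text{where}\qquad C_d=1+\frac{8}{d}+\frac{d^{5/2}}{(\sqrt{2\pi})^{d-1}}\left[\frac{d-1}{d-3}\right]e^{\frac{1}{12d}}.$$ 3) For any dimension $d\geq 2$, we have $\vec{p}^{\,b}_c(d+1)\leq \mathrm{Sol}\big(\vec{p}^{\,b}_c(d), (d+1)/d \big)$.
   Context: The graph $\mathbb{Z}^d$ ($d\ge 1$) has vertex set $\mathbb{Z}^d$ and edge set $E(\mathbb{Z}^d)$, the set of unordered pairs $\langle v,u\rangle$ with $v,u\in\mathbb{Z}^d$ and $|v-u|=1$. In bond Bernoulli percolation with parameter $p\in[0,1]$, the edges are independently open with probability $p$ and closed with probability $1-p$; $\mathbb{P}_p$ is the resulting product measure. Let $e_1,\dots,e_d$ be the positive unit vectors of $\mathbb{Z}^d$. Write $x\rightarrow y$ if there are $x_0=x,x_1,\dots,x_n=y$ such that for each $j=1,\dots,n$ we have $x_j-x_{j-1}\in\{e_1,\dots,e_d\}$ and $\langle x_{j-1},x_j\rangle$ is open. Let $\vec{\mathcal{C}}^{\,b}_0=\{x\in\mathbb{Z}^d: 0\rightarrow x\}$, $\vec{\theta}^{\,b}_d(p)=\mathbb{P}_p(|\vec{\mathcal{C}}^{\,b}_0|=\infty)$,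 and $\vec{p}^{\,b}_c(d)=\sup\{p\in[0,1]:\vec{\theta}^{\,b}_d(p)=0\}$. For real numbers $a\in(0,1)$ and $b>1$, $\mathrm{Sol}(a,b)$ denotes the unique solution of $x=a[x+(1-x)^b]$ in the interval $(0,1)$. *)

theory Defs
  imports "HOL-Probability.Probability"
begin

text \<open>
  Since the dimension varies inside the statement, a vertex of \<open>\<int>\<^sup>d\<close> is a function
  \<open>nat \<Rightarrow> int\<close> that vanishes outside the coordinates \<open>0, \<dots>, d - 1\<close>.
\<close>

type_synonym vertex = "nat \<Rightarrow> int"
type_synonym edge = "vertex set"

definition Zd :: "nat \<Rightarrow> vertex set" where
  "Zd d = {v. \<forall>i\<ge>d. v i = 0}"

definition origin :: vertex where
  "origin = (\<lambda>_. 0)"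

text \<open>
  Distances are taken in the \<open>\<ell>\<^sup>1\<close> norm; two integer points are at \<open>\<ell>\<^sup>1\<close> distance 1 iff
  they are at Euclidean distance 1.
\<close>

definition dist1 :: "nat \<Rightarrow> vertex \<Rightarrow> vertex \<Rightarrow> int" where
  "dist1 d v u = (\<Sum>i<d. \<bar>v i - u i\<bar>)"

definition edges :: "nat \<Rightarrow> edge set" where
  "edges d = {{v, u} | v u. v \<in> Zd d \<and> u \<in> Zd d \<and> dist1 d v u = 1}"

definition unit_vec :: "nat \<Rightarrow> vertex" where
  "unit_vec i = (\<lambda>k. if k = i then 1 else 0)"

text \<open>In a configuration, an edge is open iff it is mapped to \<open>True\<close>.\<close>

definition percolation :: "nat \<Rightarrow> real \<Rightarrow> (edge \<Rightarrow> bool) measure" where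
  "percolation d p = (\<Pi>\<^sub>M e\<in>edges d. measure_pmf (bernoulli_pmf p))"

definition oriented_connected ::
    "nat \<Rightarrow> (edge \<Rightarrow> bool) \<Rightarrow> vertex \<Rightarrow> vertex \<Rightarrow> bool" where
  "oriented_connected d \<omega> x y \<longleftrightarrow>
     (\<exists>(n::nat) (xs :: nat \<Rightarrow> vertex).
        xs 0 = x \<and> xs n = y \<and> (\<forall>j\<le>n. xs j \<in> Zd d) \<and>
        (\<forall>j\<in>{1..n}. (\<lambda>k. xs j k - xs (j - 1) k) \<in> unit_vec ` {..<d} \<and>
                    \<omega> {xs (j - 1), xs j}))"

definition oriented_cluster :: "nat \<Rightarrow> (edge \<Rightarrow> bool) \<Rightarrow> vertex set" where
  "oriented_cluster d \<omega> = {x \<in> Zd d. oriented_connected d \<omega> origin x}"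

definition oriented_theta :: "nat \<Rightarrow> real \<Rightarrow> real" where
  "oriented_theta d p =
     measure (percolation d p)
       {\<omega> \<in> space (percolation d p). infinite (oriented_cluster d \<omega>)}"

definition oriented_pc :: "nat \<Rightarrow> real" where
  "oriented_pc d = Sup {p \<in> {0..1}. oriented_theta d p = 0}"

text \<open>Intended for \<open>0 < a < 1\<close> and \<open>b > 1\<close>, where the solution exists and is unique.\<close>

definition Sol :: "real \<Rightarrow> real \<Rightarrow> real" where
  "Sol a b = (THE x. x \<in> {0<..<1} \<and> x = a * (x + (1 - x) powr b))"

definition C_const :: "nat \<Rightarrow> real" where
  "C_const d =
     1 + 8 / real d
       + real d powr (5 / 2) / (sqrt (2 * pi)) ^ (d - 1)
         * ((real d - 1) / (real d - 3)) * exp (1 / (12 * real d))"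

end

theory Submission
  imports Defs "HOL-Computational_Algebra.Formal_Power_Series"
begin

text \<open>
  Oriented percolation is a Markov chain on finite vertex sets, one level at a time. If every vertex
  that lies over \<open>v\<close> in a lattice \<open>\<int>\<^sup>D\<close> projecting to \<open>\<int>\<^sup>k\<close> explores edges of its own and finds a random
  set of neighbours of \<open>v\<close> dominating independent choices with probability \<open>s\<close>, then percolation on
  \<open>\<int>\<^sup>D\<close> survives at least as well as percolation on \<open>\<int>\<^sup>k\<close> with parameter \<open>s\<close>. Summing the two halves
  of the coordinates gives \<open>s = 1 - (1 - p)\<^bsup>d/2\<^esup>\<close> and reduces (1) to Liggett's bound 2/3 for \<open>\<int>\<^sup>2\<close>.
  Climbing in the last direction before leaving a column gives \<open>s = p / (p + (1 - p)\<^bsup>(d+1)/d\<^esup>)\<close>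
  and (3).

  For Liggett's bound, the probability that a suitable stationary renewal process avoids the current
  level set is a supermartingale. The sites of a level are updated one after the other. The hybrid
  processes met on the way, updated on one side only, are again renewal processes up to one
  special gap, and each update compares two of them; the two sides agree on intervals, which
  determines the gap law (Catalan numbers over powers of 4).

  For (2), the second moment of the number of open paths is controlled by the expected number of
  meetings of two independent directed walks, which is estimated through multinomial coefficients;
  the case \<open>d = 4\<close> follows from (1).
\<close>

section \<open>Finite Bernoulli expectations and the level process\<close>

text \<open>All comparisons are sums over finite edge sets; only the passage to
  \<open>oriented_theta\<close> touches the infinite product. Vertices over the same point may
  examine common edges, as two vertices of one column do, so one representative per fibre is kept at
  each level. Edges seen later are fresh because every generation raises the projected level by one.

  In Liggett's bound, 1/3 = 1 - 2/3 is the chance of missing a site through one arc. Adjacent sites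
  of the next level share a parent, so the weights cannot be treated site by site; requiring
  equality on intervals fixes the hybrid process, and what remains are hazard rate inequalities.

  In (3) the climbing edge serves d directions. Each gets a copy closed with probability (1 - p)
  powr (1/d), which together with the closed direct arc makes the exponent 1 + 1/d.

  In (2) the second moment of the number of paths over its squared mean is the mean of 1/p to the
  number of shared edges. The estimate for two walks to meet at time n decays with exponent (d -
  1)/2, which is at least 2 from d = 5 on.\<close>

definition bernoulli_exp :: "real \<Rightarrow> 'e set \<Rightarrow> ('e set \<Rightarrow> real) \<Rightarrow> real" where
  "bernoulli_exp p J f = (\<Sum>S\<in>Pow J. p ^ card S * (1 - p) ^ card (J - S) * f S)"

lemma bernoulli_exp_empty [simp]: "bernoulli_exp p {} f = f {}"
  by (simp add: bernoulli_exp_def)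

lemma bernoulli_exp_insert:
  assumes "finite J" "e \<notin> J"
  shows "bernoulli_exp p (insert e J) f = p * bernoulli_exp p J (\<lambda>S. f (insert e S)) + (1 - p) * bernoulli_exp p J f"
proof -
  have inj: "inj_on (insert e) (Pow J)" using assms by (auto simp: inj_on_def)
  have "bernoulli_exp p (insert e J) f =
     (\<Sum>S\<in>Pow J. p ^ card S * (1 - p) ^ card (insert e J - S) * f S) +
     (\<Sum>S\<in>insert e ` Pow J. p ^ card S * (1 - p) ^ card (insert e J - S) * f S)"
    unfolding bernoulli_exp_def Pow_insert using assms by (intro sum.union_disjoint) auto
  also have "(\<Sum>S\<in>insert e ` Pow J. p ^ card S * (1 - p) ^ card (insert e J - S) * f S)
     = (\<Sum>S\<in>Pow J. p * (p ^ card S * (1 - p) ^ card (J - S) * f (insert e S)))"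
    unfolding sum.reindex[OF inj] o_def
  proof (intro sum.cong refl)
    fix S assume S: "S \<in> Pow J"
    hence "card (insert e S) = Suc (card S)" "insert e J - insert e S = J - S"
      using assms by (auto intro!: card_insert_disjoint dest: finite_subset)
    thus "p ^ card (insert e S) * (1 - p) ^ card (insert e J - insert e S) * f (insert e S) =
      p * (p ^ card S * (1 - p) ^ card (J - S) * f (insert e S))" by simp
  qed
  also have "(\<Sum>S\<in>Pow J. p ^ card S * (1 - p) ^ card (insert e J - S) * f S)
     = (\<Sum>S\<in>Pow J. (1 - p) * (p ^ card S * (1 - p) ^ card (J - S) * f S))"
  proof (intro sum.cong refl)
    fix S assume S: "S \<in> Pow J"
    hence "insert e J - S = insert e (J - S)" using assms by auto
    hence "card (insert e J - S) = Suc (card (J - S))" using assms by simp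
    thus "p ^ card S * (1 - p) ^ card (insert e J - S) * f S =
      (1 - p) * (p ^ card S * (1 - p) ^ card (J - S) * f S)" by simp
  qed
  finally show ?thesis by (simp add: bernoulli_exp_def sum_distrib_left)
qed

lemma bernoulli_exp_cong: "(\<And>S. S \<subseteq> J \<Longrightarrow> f S = g S) \<Longrightarrow> bernoulli_exp p J f = bernoulli_exp p J g"
  unfolding bernoulli_exp_def by (intro sum.cong) auto

lemma bernoulli_exp_mono:
  assumes "0 \<le> p" "p \<le> 1" "\<And>S. S \<subseteq> J \<Longrightarrow> f S \<le> g S"
  shows "bernoulli_exp p J f \<le> bernoulli_exp p J g"
  unfolding bernoulli_exp_def using assms by (intro sum_mono mult_left_mono) auto

lemma bernoulli_exp_add: "bernoulli_exp p J (\<lambda>S. f S + g S) = bernoulli_exp p J f + bernoulli_exp p J g"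
  by (simp add: bernoulli_exp_def distrib_left sum.distrib)

lemma bernoulli_exp_cmult: "bernoulli_exp p J (\<lambda>S. c * f S) = c * bernoulli_exp p J f"
  by (simp add: bernoulli_exp_def sum_distrib_left mult_ac)

lemma bernoulli_exp_sum: "bernoulli_exp p J (\<lambda>S. \<Sum>x\<in>X. f x S) = (\<Sum>x\<in>X. bernoulli_exp p J (f x))"
  unfolding bernoulli_exp_def sum_distrib_left by (rule sum.swap)

lemma bernoulli_exp_const: "finite J \<Longrightarrow> bernoulli_exp p J (\<lambda>_. c) = c"
  by (induction J rule: finite_induct) (simp_all add: bernoulli_exp_insert algebra_simps)

lemma bernoulli_exp_Un:
  assumes "finite A" "finite B" "A \<inter> B = {}"
  shows "bernoulli_exp p (A \<union> B) f = bernoulli_exp p A (\<lambda>S. bernoulli_exp p B (\<lambda>T. f (S \<union> T)))"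
  using assms(1,3)
proof (induction A arbitrary: f rule: finite_induct)
  case (insert a A)
  hence "bernoulli_exp p (insert a A \<union> B) f = p * bernoulli_exp p (A \<union> B) (\<lambda>S. f (insert a S)) + (1 - p) * bernoulli_exp p (A \<union> B) f"
    using assms(2) by (simp add: bernoulli_exp_insert)
  thus ?case using insert by (simp add: bernoulli_exp_insert)
qed simp

lemma bernoulli_exp_restrict:
  assumes "finite J" "K \<subseteq> J"
  shows "bernoulli_exp p J (\<lambda>S. f (S \<inter> K)) = bernoulli_exp p K f"
proof -
  have fin: "finite K" "finite (J - K)" using assms finite_subset by auto
  have "bernoulli_exp p J (\<lambda>S. f (S \<inter> K)) = bernoulli_exp p (K \<union> (J - K)) (\<lambda>S. f (S \<inter> K))"
    using assms by (simp add: Un_absorb1)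
  also have "\<dots> = bernoulli_exp p K (\<lambda>S. bernoulli_exp p (J - K) (\<lambda>T. f ((S \<union> T) \<inter> K)))"
    using fin by (intro bernoulli_exp_Un) auto
  also have "\<dots> = bernoulli_exp p K (\<lambda>S. bernoulli_exp p (J - K) (\<lambda>T. f S))"
    by (intro bernoulli_exp_cong arg_cong[of _ _ f]) auto
  finally show ?thesis using fin by (simp add: bernoulli_exp_const)
qed

lemma bernoulli_exp_image:
  assumes "finite J" "inj_on h J"
  shows "bernoulli_exp p (h ` J) f = bernoulli_exp p J (\<lambda>S. f (h ` S))"
  using assms by (induction J arbitrary: f rule: finite_induct) (simp_all add: bernoulli_exp_insert)

lemma bernoulli_exp_all: "finite J \<Longrightarrow> F \<subseteq> J \<Longrightarrow> bernoulli_exp p J (\<lambda>S. of_bool (F \<subseteq> S)) = p ^ card F"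
proof -
  assume A: "finite J" "F \<subseteq> J"
  hence fin: "finite F" using finite_subset by blast
  have "bernoulli_exp p J (\<lambda>S. of_bool (F \<subseteq> S)) = bernoulli_exp p J (\<lambda>S. of_bool (F \<subseteq> S \<inter> F))"
    by (intro bernoulli_exp_cong) auto
  also have "\<dots> = bernoulli_exp p F (\<lambda>S. of_bool (F \<subseteq> S))" using A by (rule bernoulli_exp_restrict)
  also have "\<dots> = (\<Sum>S\<in>{F}. p ^ card S * (1 - p) ^ card (F - S) * of_bool (F \<subseteq> S))"
    unfolding bernoulli_exp_def using fin by (intro sum.mono_neutral_right) auto
  finally show ?thesis by simp
qed

text \<open>Cauchy-Schwarz applied to \<open>f S = f S * of_bool (f S \<noteq> 0)\<close> in the
  weighted sum. It bounds the probability that \<open>f\<close> is nonzero from below and will be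
  applied to the number of open paths.\<close>

lemma bernoulli_exp_Cauchy_Schwarz:
  assumes "0 \<le> p" "p \<le> 1"
  shows "(bernoulli_exp p J f)\<^sup>2 \<le> bernoulli_exp p J (\<lambda>S. (f S)\<^sup>2) * bernoulli_exp p J (\<lambda>S. of_bool (f S \<noteq> 0))"
proof -
  define w where "w S = p ^ card S * (1 - p) ^ card (J - S)" for S
  have w: "w S \<ge> 0" for S using assms by (simp add: w_def)
  have "(\<Sum>S\<in>Pow J. (sqrt (w S) * f S) * (sqrt (w S) * of_bool (f S \<noteq> 0)))\<^sup>2
    \<le> (\<Sum>S\<in>Pow J. (sqrt (w S) * f S)\<^sup>2) * (\<Sum>S\<in>Pow J. (sqrt (w S) * of_bool (f S \<noteq> 0))\<^sup>2)"
    by (rule Cauchy_Schwarz_ineq_sum)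
  moreover have "(sqrt (w S) * f S) * (sqrt (w S) * of_bool (f S \<noteq> 0)) = w S * f S" for S
    using w[of S] by (cases "f S = 0") (auto simp: mult_ac simp flip: mult.assoc)
  moreover have "(sqrt (w S) * g)\<^sup>2 = w S * g\<^sup>2" for S g using w[of S] by (simp add: power_mult_distrib)
  moreover have "(of_bool b)\<^sup>2 = (of_bool b :: real)" for b by simp
  ultimately have "(\<Sum>S\<in>Pow J. w S * f S)\<^sup>2
    \<le> (\<Sum>S\<in>Pow J. w S * (f S)\<^sup>2) * (\<Sum>S\<in>Pow J. w S * of_bool (f S \<noteq> 0))" by (simp only:)
  thus ?thesis by (simp add: bernoulli_exp_def w_def)
qed

section \<open>Events that depend on finitely many edges\<close>

lemma prob_space_percolation: "prob_space (percolation d p)"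
  unfolding percolation_def by (intro prob_space_PiM measure_pmf.prob_space_axioms)

lemma percolation_cylinder:
  assumes p: "0 \<le> p" "p \<le> 1" and J: "finite J" "J \<subseteq> edges d" and S: "S \<subseteq> J"
  shows "{\<omega> \<in> space (percolation d p). {e\<in>J. \<omega> e} = S} \<in> sets (percolation d p)"
    and "measure (percolation d p) {\<omega> \<in> space (percolation d p). {e\<in>J. \<omega> e} = S}
      = p ^ card S * (1 - p) ^ card (J - S)"
proof -
  interpret product_prob_space "\<lambda>_. measure_pmf (bernoulli_pmf p)" "edges d"
    by (intro product_prob_spaceI measure_pmf.prob_space_axioms)
  have sp: "space (percolation d p) = (\<Pi>\<^sub>E e\<in>edges d. UNIV)"
    by (simp add: percolation_def space_PiM)
  have eq: "{\<omega> \<in> space (percolation d p). {e\<in>J. \<omega> e} = S} =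
      prod_emb (edges d) (\<lambda>_. measure_pmf (bernoulli_pmf p)) J (\<Pi>\<^sub>E e\<in>J. {e \<in> S})"
    using J S unfolding sp prod_emb_def by (auto simp: PiE_iff extensional_def)
  show "{\<omega> \<in> space (percolation d p). {e\<in>J. \<omega> e} = S} \<in> sets (percolation d p)"
    unfolding eq unfolding percolation_def using J by (intro sets_PiM_I) auto
  have "measure (percolation d p) {\<omega> \<in> space (percolation d p). {e\<in>J. \<omega> e} = S}
    = (\<Prod>e\<in>J. measure (measure_pmf (bernoulli_pmf p)) {e \<in> S})"
    unfolding eq unfolding percolation_def using J by (intro measure_PiM_emb) auto
  also have "\<dots> = (\<Prod>e\<in>J. if e \<in> S then p else 1 - p)"
    using p by (intro prod.cong) (auto simp: measure_pmf_single)
  also have "\<dots> = (\<Prod>e\<in>S. p) * (\<Prod>e\<in>J - S. 1 - p)"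
    using J S by (subst prod.If_cases) (auto simp: Int_absorb1 Diff_eq)
  finally show "measure (percolation d p) {\<omega> \<in> space (percolation d p). {e\<in>J. \<omega> e} = S}
      = p ^ card S * (1 - p) ^ card (J - S)" by simp
qed

text \<open>The event is a disjoint union of the finitely many cylinders that fix the open part of
  \<open>J\<close>. This is the bridge from the product measure to finite sums.\<close>

lemma percolation_finite_event:
  assumes p: "0 \<le> p" "p \<le> 1" and J: "finite J" "J \<subseteq> edges d"
  shows "{\<omega> \<in> space (percolation d p). Q {e\<in>J. \<omega> e}} \<in> sets (percolation d p)" (is "?E \<in> _")
    and "measure (percolation d p) {\<omega> \<in> space (percolation d p). Q {e\<in>J. \<omega> e}}
      = bernoulli_exp p J (\<lambda>S. of_bool (Q S))"
proof -
  interpret prob_space "percolation d p" by (rule prob_space_percolation)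
  let ?C = "\<lambda>S. {\<omega> \<in> space (percolation d p). {e\<in>J. \<omega> e} = S}"
  have eq: "?E = (\<Union>S\<in>{S\<in>Pow J. Q S}. ?C S)" by auto
  have fin: "finite {S\<in>Pow J. Q S}" using J by simp
  show "?E \<in> sets (percolation d p)"
    unfolding eq using percolation_cylinder(1)[OF p J] by (intro sets.finite_UN fin) auto
  have "measure (percolation d p) ?E = (\<Sum>S\<in>{S\<in>Pow J. Q S}. measure (percolation d p) (?C S))"
    unfolding eq using percolation_cylinder(1)[OF p J]
    by (intro finite_measure_finite_Union fin) (auto simp: disjoint_family_on_def)
  also have "\<dots> = (\<Sum>S\<in>{S\<in>Pow J. Q S}. p ^ card S * (1 - p) ^ card (J - S) * of_bool (Q S))"
    using percolation_cylinder(2)[OF p J] by (intro sum.cong) auto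
  also have "\<dots> = bernoulli_exp p J (\<lambda>S. of_bool (Q S))"
    unfolding bernoulli_exp_def using J by (intro sum.mono_neutral_left) auto
  finally show "measure (percolation d p) ?E = bernoulli_exp p J (\<lambda>S. of_bool (Q S))" .
qed

section \<open>Arcs, levels and survival of the level process\<close>

definition tgt :: "vertex \<times> nat \<Rightarrow> vertex" where
  "tgt = (\<lambda>(v, i) k. v k + unit_vec i k)"

definition level :: "nat \<Rightarrow> vertex \<Rightarrow> int" where
  "level d v = (\<Sum>j<d. v j)"

lemma level_tgt: "i < d \<Longrightarrow> level d (tgt (v, i)) = level d v + 1"
  by (simp add: level_def tgt_def unit_vec_def sum.distrib)

lemma tgt_Zd: "v \<in> Zd d \<Longrightarrow> i < d \<Longrightarrow> tgt (v, i) \<in> Zd d"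
  by (auto simp: Zd_def tgt_def unit_vec_def)

lemma origin_Zd [simp]: "origin \<in> Zd d"
  by (simp add: Zd_def origin_def)

definition arc_edge :: "vertex \<times> nat \<Rightarrow> edge" where
  "arc_edge a = {fst a, tgt a}"

lemma arc_edge_in_edges: "v \<in> Zd d \<Longrightarrow> i < d \<Longrightarrow> arc_edge (v, i) \<in> edges d"
proof -
  assume A: "v \<in> Zd d" "i < d"
  have "dist1 d v (tgt (v, i)) = (\<Sum>k<d. if k = i then 1 else 0)"
    unfolding dist1_def by (intro sum.cong) (auto simp: tgt_def unit_vec_def)
  also have "\<dots> = 1" using A by simp
  finally have "dist1 d v (tgt (v, i)) = 1" .
  thus ?thesis using A tgt_Zd[OF A] unfolding edges_def arc_edge_def by auto
qed

lemma tgt_eq_iff: "tgt (v, i) = tgt (v, j) \<longleftrightarrow> i = j"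
proof
  assume "tgt (v, i) = tgt (v, j)"
  from fun_cong[OF this, of i] show "i = j" by (simp add: tgt_def unit_vec_def split: if_splits)
qed simp

text \<open>The endpoints of an arc cannot change roles, since coordinate \<open>i\<close> would
  have to grow in one direction without decreasing in the other. Hence independent unordered edges
  may be indexed by arcs.\<close>

lemma inj_arc_edge: "inj arc_edge"
proof (rule injI)
  fix a b :: "vertex \<times> nat" assume eq: "arc_edge a = arc_edge b"
  obtain v i w j where ab: "a = (v, i)" "b = (w, j)" by (cases a, cases b)
  have "\<not> (v = tgt (w, j) \<and> w = tgt (v, i))"
  proof
    assume A: "v = tgt (w, j) \<and> w = tgt (v, i)"
    have "v i = w i + unit_vec j i" "w i = v i + unit_vec i i"
      using fun_cong[OF conjunct1[OF A], of i] fun_cong[OF conjunct2[OF A], of i] by (simp_all add: tgt_def)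
    thus False by (simp add: unit_vec_def split: if_splits)
  qed
  hence "v = w \<and> tgt (v, i) = tgt (w, j)" using eq by (auto simp: ab arc_edge_def doubleton_eq_iff)
  thus "a = b" using tgt_eq_iff by (auto simp: ab)
qed

text \<open>Probability of an open path with \<open>n\<close> steps from \<open>A\<close> when each
  step samples its arcs anew. For \<open>A\<close> inside one level this is exact, because different
  steps then use different edges.\<close>

primrec surv :: "real \<Rightarrow> nat \<Rightarrow> nat \<Rightarrow> vertex set \<Rightarrow> real" where
  "surv p d 0 A = of_bool (A \<noteq> {})"
| "surv p d (Suc n) A = bernoulli_exp p (A \<times> {..<d}) (\<lambda>S. surv p d n (tgt ` S))"

lemma surv_mono:
  assumes "0 \<le> p" "p \<le> 1"
  shows "finite B \<Longrightarrow> A \<subseteq> B \<Longrightarrow> surv p d n A \<le> surv p d n B"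
proof (induction n arbitrary: A B)
  case (Suc n)
  have "surv p d (Suc n) A = bernoulli_exp p (B \<times> {..<d}) (\<lambda>S. surv p d n (tgt ` (S \<inter> A \<times> {..<d})))"
    using Suc.prems by (simp, subst bernoulli_exp_restrict) auto
  also have "\<dots> \<le> bernoulli_exp p (B \<times> {..<d}) (\<lambda>S. surv p d n (tgt ` S))"
    using Suc.prems assms by (intro bernoulli_exp_mono Suc.IH) (auto dest: finite_subset)
  finally show ?case by simp
qed auto

text \<open>First moment: one step leads to at most as many vertices as there are open arcs, on
  average \<open>d * p\<close> per vertex.\<close>

lemma surv_union_bound:
  assumes "0 \<le> p" "p \<le> 1"
  shows "finite A \<Longrightarrow> surv p d n A \<le> real (card A) * (real d * p) ^ n"
proof (induction n arbitrary: A)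
  case 0
  thus ?case by (cases "A = {}") (auto simp: Suc_le_eq card_gt_0_iff)
next
  case (Suc n)
  have fin: "finite (A \<times> {..<d})" using Suc.prems by simp
  have card: "bernoulli_exp p J (\<lambda>S. real (card S)) = p * real (card J)" if "finite J" for J :: "(vertex \<times> nat) set"
    using that
  proof (induction J rule: finite_induct)
    case (insert e J)
    have "bernoulli_exp p J (\<lambda>S. real (card (insert e S))) = bernoulli_exp p J (\<lambda>S. 1 + real (card S))"
    proof (intro bernoulli_exp_cong)
      fix S assume "S \<subseteq> J"
      hence "finite S" "e \<notin> S" using insert finite_subset by auto
      thus "real (card (insert e S)) = 1 + real (card S)" by simp
    qed
    thus ?case using insert by (simp add: bernoulli_exp_insert bernoulli_exp_add bernoulli_exp_const algebra_simps)
  qed simp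
  have "surv p d (Suc n) A \<le> bernoulli_exp p (A \<times> {..<d}) (\<lambda>S. (real d * p) ^ n * real (card S))"
    unfolding surv.simps
  proof (intro bernoulli_exp_mono assms)
    fix S assume S: "S \<subseteq> A \<times> {..<d}"
    hence fS: "finite S" using fin finite_subset by blast
    have "surv p d n (tgt ` S) \<le> real (card (tgt ` S)) * (real d * p) ^ n" using fS by (intro Suc.IH) auto
    also have "\<dots> \<le> real (card S) * (real d * p) ^ n"
      using card_image_le[OF fS] assms by (intro mult_right_mono) auto
    finally show "surv p d n (tgt ` S) \<le> (real d * p) ^ n * real (card S)" by (simp add: mult_ac)
  qed
  also have "\<dots> = real (card A) * (real d * p) ^ Suc n"
    unfolding bernoulli_exp_cmult card[OF fin] by (simp add: card_cartesian_product mult_ac)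
  finally show ?case .
qed

section \<open>Explorations and projections\<close>

text \<open>A vertex \<open>u\<close> examines the edges \<open>E u\<close> and moves on to
  \<open>Sc u S\<close> if \<open>S\<close> is the open part of them. Condition \<open>disj\<close>
  speaks of different fibres only: two vertices with the same projection may examine common
  edges.\<close>

locale exploration =
  fixes E :: "'v \<Rightarrow> 'e set" and Sc :: "'v \<Rightarrow> 'e set \<Rightarrow> 'v set" and \<pi> :: "'v \<Rightarrow> vertex" and V :: "'v set"
    and k :: nat
  assumes finite_E: "u \<in> V \<Longrightarrow> finite (E u)"
    and Sc_V: "u \<in> V \<Longrightarrow> S \<subseteq> E u \<Longrightarrow> Sc u S \<subseteq> V"
    and finite_Sc: "u \<in> V \<Longrightarrow> S \<subseteq> E u \<Longrightarrow> finite (Sc u S)"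
    and proj: "u \<in> V \<Longrightarrow> S \<subseteq> E u \<Longrightarrow> u' \<in> Sc u S \<Longrightarrow> \<exists>i<k. \<pi> u' = tgt (\<pi> u, i)"
    and disj: "u \<in> V \<Longrightarrow> v \<in> V \<Longrightarrow> \<pi> u \<noteq> \<pi> v \<Longrightarrow> E u \<inter> E v = {}"
begin

definition succs :: "'e set \<Rightarrow> 'v set \<Rightarrow> 'v set" where
  "succs S A = (\<Union>u\<in>A. Sc u (S \<inter> E u))"

definition run :: "nat \<Rightarrow> 'v set \<Rightarrow> 'e set \<Rightarrow> 'v set" where
  "run n A S = (succs S ^^ n) A"

text \<open>All edges that some configuration could cause to be examined within \<open>n\<close>
  generations. As this set does not depend on the configuration, survival for \<open>n\<close>
  generations becomes a function on a fixed finite edge set.\<close>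

primrec explored :: "nat \<Rightarrow> 'v set \<Rightarrow> 'e set" where
  "explored 0 A = {}"
| "explored (Suc n) A = (\<Union>u\<in>A. E u) \<union> explored n (\<Union>u\<in>A. \<Union>S\<in>Pow (E u). Sc u S)"

lemma run_0 [simp]: "run 0 A S = A"
  by (simp add: run_def)

lemma run_Suc: "run (Suc n) A S = run n (succs S A) S"
  by (simp add: run_def funpow_swap1)

lemma run_Suc': "run (Suc n) A S = succs S (run n A S)"
  by (simp add: run_def)

lemma succs_mono: "A \<subseteq> B \<Longrightarrow> succs S A \<subseteq> succs S B"
  by (auto simp: succs_def)

lemma run_mono: "A \<subseteq> B \<Longrightarrow> run n A S \<subseteq> run n B S"
  by (induction n arbitrary: A B) (simp_all add: run_Suc succs_mono)

lemma succs_V: "A \<subseteq> V \<Longrightarrow> succs S A \<subseteq> V"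
  unfolding succs_def by (intro UN_least Sc_V) auto

lemma run_V: "A \<subseteq> V \<Longrightarrow> run n A S \<subseteq> V"
  by (induction n) (simp_all add: run_Suc' succs_V)

lemma finite_succs: "finite A \<Longrightarrow> A \<subseteq> V \<Longrightarrow> finite (succs S A)"
  unfolding succs_def by (intro finite_UN_I finite_Sc) auto

lemma finite_run: "finite A \<Longrightarrow> A \<subseteq> V \<Longrightarrow> finite (run n A S)"
  by (induction n) (simp_all add: run_Suc' finite_succs run_V)

lemma run_decreasing: "m \<le> n \<Longrightarrow> run n A S \<noteq> {} \<Longrightarrow> run m A S \<noteq> {}"
proof (induction rule: dec_induct)
  case (step n)
  have "succs S {} = {}" by (simp add: succs_def)
  with step show ?case by (metis run_Suc')
qed

lemma succs_proj: "A \<subseteq> V \<Longrightarrow> u' \<in> succs S A \<Longrightarrow> \<exists>u\<in>A. \<exists>i<k. \<pi> u' = tgt (\<pi> u, i)"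
proof -
  assume A: "A \<subseteq> V" "u' \<in> succs S A"
  then obtain u where u: "u \<in> A" "u' \<in> Sc u (S \<inter> E u)" by (auto simp: succs_def)
  with proj[of u "S \<inter> E u" u'] A(1) show ?thesis by auto
qed

lemma run_level: "A \<subseteq> V \<Longrightarrow> (\<And>u. u \<in> A \<Longrightarrow> level k (\<pi> u) = m) \<Longrightarrow> u \<in> run n A S \<Longrightarrow> level k (\<pi> u) = m + int n"
proof (induction n arbitrary: u)
  case (Suc n)
  from succs_proj[OF run_V[OF Suc.prems(1)], of u S n S] Suc.prems
  obtain u0 i where "u0 \<in> run n A S" "i < k" "\<pi> u = tgt (\<pi> u0, i)" by (auto simp: run_Suc')
  with Suc show ?case by (simp add: level_tgt)
qed simp

lemma explored_mono: "A \<subseteq> B \<Longrightarrow> explored n A \<subseteq> explored n B"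
proof (induction n arbitrary: A B)
  case (Suc n)
  have "(\<Union>u\<in>A. \<Union>S\<in>Pow (E u). Sc u S) \<subseteq> (\<Union>u\<in>B. \<Union>S\<in>Pow (E u). Sc u S)" using Suc.prems by blast
  from Suc.IH[OF this] Suc.prems show ?case by auto
qed simp

lemma all_succs:
  assumes "A \<subseteq> V"
  shows "(\<Union>u\<in>A. \<Union>S\<in>Pow (E u). Sc u S) \<subseteq> V"
    and "finite A \<Longrightarrow> finite (\<Union>u\<in>A. \<Union>S\<in>Pow (E u). Sc u S)"
    and "succs S A \<subseteq> (\<Union>u\<in>A. \<Union>S\<in>Pow (E u). Sc u S)"
proof -
  show "(\<Union>u\<in>A. \<Union>S\<in>Pow (E u). Sc u S) \<subseteq> V" using assms by (intro UN_least Sc_V) auto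
  show "finite (\<Union>u\<in>A. \<Union>S\<in>Pow (E u). Sc u S)" if "finite A"
    using that assms finite_Sc finite_E by (intro finite_UN_I) auto
  show "succs S A \<subseteq> (\<Union>u\<in>A. \<Union>S\<in>Pow (E u). Sc u S)"
    unfolding succs_def by (rule UN_mono[OF order_refl], rule UN_upper) simp
qed

lemma finite_explored: "finite A \<Longrightarrow> A \<subseteq> V \<Longrightarrow> finite (explored n A)"
proof (induction n arbitrary: A)
  case (Suc n)
  from Suc.IH[OF all_succs(2)[OF Suc.prems(2,1)] all_succs(1)[OF Suc.prems(2)]] Suc.prems
  show ?case using finite_E by auto
qed simp

text \<open>Projected levels never decrease along the exploration, so every edge examined belongs to
  a vertex of level at least \<open>m\<close>. Combined with \<open>disj\<close>, this keeps the
  edges of later generations apart from those of earlier ones.\<close>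

lemma explored_level:
  "A \<subseteq> V \<Longrightarrow> (\<And>u. u \<in> A \<Longrightarrow> level k (\<pi> u) \<ge> m) \<Longrightarrow> e \<in> explored n A \<Longrightarrow>
    \<exists>u\<in>V. e \<in> E u \<and> level k (\<pi> u) \<ge> m"
proof (induction n arbitrary: A)
  case (Suc n)
  show ?case
  proof (cases "e \<in> (\<Union>u\<in>A. E u)")
    case False
    have "level k (\<pi> u') \<ge> m" if u': "u' \<in> (\<Union>u\<in>A. \<Union>S\<in>Pow (E u). Sc u S)" for u'
    proof -
      obtain u S where uS: "u \<in> A" "S \<subseteq> E u" "u' \<in> Sc u S" using u' by auto
      with proj[of u S u'] Suc.prems(1) obtain i where "i < k" "\<pi> u' = tgt (\<pi> u, i)" by auto
      thus ?thesis using Suc.prems(2)[OF uS(1)] by (simp add: level_tgt)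
    qed
    from Suc.IH[OF all_succs(1)[OF Suc.prems(1)] this] False Suc.prems(3) show ?thesis by auto
  qed (use Suc.prems in auto)
qed simp

lemma run_restrict: "A \<subseteq> V \<Longrightarrow> explored n A \<subseteq> K \<Longrightarrow> run n A (S \<inter> K) = run n A S"
proof (induction n arbitrary: A)
  case (Suc n)
  have "succs (S \<inter> K) A = succs S A"
    unfolding succs_def using Suc.prems by (intro SUP_cong refl arg_cong[of _ _ "Sc _"]) auto
  moreover have "explored n (succs S A) \<subseteq> K"
    using explored_mono[OF all_succs(3)[OF Suc.prems(1), of S], of n] Suc.prems(2) by auto
  ultimately show ?case using Suc.IH[OF succs_V[OF Suc.prems(1)]] by (simp add: run_Suc)
qed simp

text \<open>Markov property at the first generation: \<open>B\<close> lies in level \<open>m\<close>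
  and its successors in level \<open>m + 1\<close>, so that they examine edges outside
  \<open>J0\<close> only, and the two stages are independent.\<close>

lemma run_first_step:
  assumes B: "finite B" "B \<subseteq> V" "\<And>u. u \<in> B \<Longrightarrow> level k (\<pi> u) = m" and J: "finite J" "explored (Suc n) B \<subseteq> J"
  defines "J0 \<equiv> (\<Union>u\<in>B. E u)"
  shows "bernoulli_exp p J (\<lambda>S. of_bool (run (Suc n) B S \<noteq> {})) =
    bernoulli_exp p J0 (\<lambda>S. bernoulli_exp p (J - J0) (\<lambda>T. of_bool (run n (succs S B) T \<noteq> {})))"
    and "explored n (succs S B) \<subseteq> J - J0"
proof -
  have J0: "J0 \<subseteq> J" using J by (auto simp: J0_def)
  have lev: "level k (\<pi> u) = m + 1" if "u \<in> succs S B" for u S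
    using run_level[of B m u 1 S] B that by (simp add: run_Suc)
  have dis: "explored n (succs S B) \<inter> J0 = {}" for S
  proof (rule ccontr)
    assume "explored n (succs S B) \<inter> J0 \<noteq> {}"
    then obtain e u where e: "e \<in> explored n (succs S B)" "u \<in> B" "e \<in> E u" by (auto simp: J0_def)
    from explored_level[OF succs_V[OF B(2)] _ e(1), of "m + 1"] lev
    obtain v where v: "v \<in> V" "e \<in> E v" "level k (\<pi> v) \<ge> m + 1" by force
    hence "\<pi> u \<noteq> \<pi> v" using B(3)[OF e(2)] by auto
    thus False using disj[of u v] e v B(2) by auto
  qed
  have sub: "explored n (succs S B) \<subseteq> J - J0" for S
    using explored_mono[OF all_succs(3)[OF B(2), of S], of n] J(2) dis[of S] by auto
  thus "explored n (succs S B) \<subseteq> J - J0" .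
  have "bernoulli_exp p J (\<lambda>S. of_bool (run (Suc n) B S \<noteq> {})) = bernoulli_exp p (J0 \<union> (J - J0)) (\<lambda>S. of_bool (run (Suc n) B S \<noteq> {}))"
    using J0 by (simp add: Un_absorb1)
  also have "\<dots> = bernoulli_exp p J0 (\<lambda>S. bernoulli_exp p (J - J0) (\<lambda>T. of_bool (run (Suc n) B (S \<union> T) \<noteq> {})))"
    using J J0 by (intro bernoulli_exp_Un) (auto dest: finite_subset)
  also have "\<dots> = bernoulli_exp p J0 (\<lambda>S. bernoulli_exp p (J - J0) (\<lambda>T. of_bool (run n (succs S B) T \<noteq> {})))"
  proof (intro bernoulli_exp_cong)
    fix S T assume ST: "S \<subseteq> J0" "T \<subseteq> J - J0"
    have 1: "succs (S \<union> T) B = succs S B"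
      unfolding succs_def using ST by (intro SUP_cong refl arg_cong[of _ _ "Sc _"]) (auto simp: J0_def)
    have "run n (succs S B) (S \<union> T) = run n (succs S B) ((S \<union> T) \<inter> (J - J0))"
      using run_restrict[OF succs_V[OF B(2)] sub] by simp
    also have "\<dots> = run n (succs S B) (T \<inter> (J - J0))" using ST by (intro arg_cong[of _ _ "run n _"]) auto
    also have "\<dots> = run n (succs S B) T"
      using run_restrict[OF succs_V[OF B(2)] sub] by simp
    finally show "of_bool (run (Suc n) B (S \<union> T) \<noteq> {}) = of_bool (run n (succs S B) T \<noteq> {})"
      by (simp add: run_Suc 1)
  qed
  finally show "bernoulli_exp p J (\<lambda>S. of_bool (run (Suc n) B S \<noteq> {})) =
    bernoulli_exp p J0 (\<lambda>S. bernoulli_exp p (J - J0) (\<lambda>T. of_bool (run n (succs S B) T \<noteq> {})))" .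
qed

end

text \<open>One vertex \<open>u\<close> lying over \<open>v\<close> yields at least as many neighbours of \<open>v\<close>, in the sense of
  stochastic domination, as one step of oriented percolation with parameter \<open>s\<close>.\<close>

locale dominating_exploration = exploration +
  fixes p s :: real
  assumes p: "0 \<le> p" "p \<le> 1" and s: "0 \<le> s" "s \<le> 1"
    and dom: "u \<in> V \<Longrightarrow> (\<And>I I'. I \<subseteq> I' \<Longrightarrow> I' \<subseteq> {..<k} \<Longrightarrow> \<phi> I \<le> \<phi> I') \<Longrightarrow>
      bernoulli_exp s {..<k} \<phi> \<le> bernoulli_exp p (E u) (\<lambda>S. \<phi> {i. i < k \<and> tgt (\<pi> u, i) \<in> \<pi> ` Sc u S})"
begin

text \<open>The vertices of \<open>B\<close> are exchanged one at a time for independent arcs with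
  probability \<open>s\<close>; \<open>D\<close> collects what is already reached. Injectivity of
  \<open>\<pi>\<close> on \<open>B\<close> makes the sets \<open>E u\<close> disjoint, hence
  independent.\<close>

lemma step_domination:
  assumes \<Psi>: "\<And>A B. finite B \<Longrightarrow> A \<subseteq> B \<Longrightarrow> \<Psi> A \<le> \<Psi> B"
  shows "finite B \<Longrightarrow> B \<subseteq> V \<Longrightarrow> inj_on \<pi> B \<Longrightarrow> finite D \<Longrightarrow>
    bernoulli_exp s (\<pi> ` B \<times> {..<k}) (\<lambda>S. \<Psi> (D \<union> tgt ` S)) \<le> bernoulli_exp p (\<Union>u\<in>B. E u) (\<lambda>S. \<Psi> (D \<union> \<pi> ` succs S B))"
proof (induction B arbitrary: D rule: finite_induct)
  case empty
  thus ?case by (simp add: succs_def)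
next
  case (insert u B)
  define EB where "EB = (\<Union>u\<in>B. E u)"
  have B: "B \<subseteq> V" "u \<in> V" "inj_on \<pi> B" "\<pi> u \<notin> \<pi> ` B" using insert by auto
  have disE: "E u \<inter> EB = {}" unfolding EB_def using disj[OF B(2)] B by fastforce
  have finE: "finite (E u)" "finite EB" unfolding EB_def using finite_E B insert by auto
  \<comment> \<open>The outcome as a function of the directions \<open>I\<close> found from
    \<open>u\<close>, averaged over the exploration from the rest of \<open>B\<close>. It is
    increasing in \<open>I\<close>, which is what \<open>dom\<close> asks for.\<close>
  define \<phi> where "\<phi> I = bernoulli_exp p EB (\<lambda>T. \<Psi> (D \<union> tgt ` Pair (\<pi> u) ` I \<union> \<pi> ` succs T B))" for I
  have finS: "finite (succs T B)" for T using finite_succs insert B by blast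
  have "\<pi> ` insert u B \<times> {..<k} = Pair (\<pi> u) ` {..<k} \<union> \<pi> ` B \<times> {..<k}" by auto
  moreover have "Pair (\<pi> u) ` {..<k} \<inter> \<pi> ` B \<times> {..<k} = {}" using B(4) by blast
  ultimately have "bernoulli_exp s (\<pi> ` insert u B \<times> {..<k}) (\<lambda>S. \<Psi> (D \<union> tgt ` S)) =
    bernoulli_exp s (Pair (\<pi> u) ` {..<k}) (\<lambda>S. bernoulli_exp s (\<pi> ` B \<times> {..<k}) (\<lambda>T. \<Psi> (D \<union> tgt ` (S \<union> T))))"
    using insert.hyps(1) by (simp only:, intro bernoulli_exp_Un) auto
  also have "\<dots> \<le> bernoulli_exp s (Pair (\<pi> u) ` {..<k}) (\<lambda>S. bernoulli_exp p EB (\<lambda>T. \<Psi> (D \<union> tgt ` S \<union> \<pi> ` succs T B)))"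
  proof (rule bernoulli_exp_mono[OF s])
    fix S assume "S \<subseteq> Pair (\<pi> u) ` {..<k}"
    hence "finite S" by (rule finite_subset) simp
    with insert.IH[of "D \<union> tgt ` S"] insert.prems
    show "bernoulli_exp s (\<pi> ` B \<times> {..<k}) (\<lambda>T. \<Psi> (D \<union> tgt ` (S \<union> T)))
       \<le> bernoulli_exp p EB (\<lambda>T. \<Psi> (D \<union> tgt ` S \<union> \<pi> ` succs T B))"
      by (simp add: EB_def image_Un Un_assoc)
  qed
  also have "\<dots> = bernoulli_exp s {..<k} \<phi>"
    unfolding \<phi>_def by (intro bernoulli_exp_image) (auto simp: inj_on_def)
  also have "\<dots> \<le> bernoulli_exp p (E u) (\<lambda>S. \<phi> {i. i < k \<and> tgt (\<pi> u, i) \<in> \<pi> ` Sc u S})"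
  proof (rule dom[OF B(2)])
    fix I I' :: "nat set" assume "I \<subseteq> I'" "I' \<subseteq> {..<k}"
    moreover from this have "finite I'" using finite_subset by blast
    ultimately show "\<phi> I \<le> \<phi> I'"
      unfolding \<phi>_def using finS insert.prems by (intro bernoulli_exp_mono p \<Psi>) auto
  qed
  also have "\<dots> = bernoulli_exp p (E u) (\<lambda>S. bernoulli_exp p EB (\<lambda>T. \<Psi> (D \<union> \<pi> ` succs (S \<union> T) (insert u B))))"
    unfolding \<phi>_def
  proof (intro bernoulli_exp_cong arg_cong[of _ _ \<Psi>])
    fix S T assume ST: "S \<subseteq> E u" "T \<subseteq> EB"
    have 1: "tgt ` Pair (\<pi> u) ` {i. i < k \<and> tgt (\<pi> u, i) \<in> \<pi> ` Sc u S} = \<pi> ` Sc u S"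
    proof (intro equalityI subsetI)
      fix x assume "x \<in> \<pi> ` Sc u S"
      then obtain u' where u': "u' \<in> Sc u S" "x = \<pi> u'" by auto
      with proj[OF B(2) ST(1)] obtain i where i: "i < k" "x = tgt (\<pi> u, i)" by auto
      hence "tgt (\<pi> u, i) \<in> \<pi> ` Sc u S" using u' by blast
      thus "x \<in> tgt ` Pair (\<pi> u) ` {i. i < k \<and> tgt (\<pi> u, i) \<in> \<pi> ` Sc u S}"
        using i by (intro image_eqI[of x tgt "(\<pi> u, i)"] image_eqI[of _ "Pair (\<pi> u)" i]) auto
    qed auto
    have 2: "(S \<union> T) \<inter> E u = S" "(S \<union> T) \<inter> E v = T \<inter> E v" if "v \<in> B" for v
      using ST disE that by (auto simp: EB_def)
    have "(S \<union> T) \<inter> E u = S" using ST disE by auto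
    hence "succs (S \<union> T) (insert u B) = Sc u S \<union> succs T B"
      unfolding succs_def using 2 by auto
    thus "D \<union> tgt ` Pair (\<pi> u) ` {i. i < k \<and> tgt (\<pi> u, i) \<in> \<pi> ` Sc u S} \<union> \<pi> ` succs T B =
         D \<union> \<pi> ` succs (S \<union> T) (insert u B)" unfolding 1 by auto
  qed
  also have "\<dots> = bernoulli_exp p (E u \<union> EB) (\<lambda>S. \<Psi> (D \<union> \<pi> ` succs S (insert u B)))"
    using finE disE by (rule bernoulli_exp_Un[symmetric])
  finally show ?case by (simp add: EB_def)
qed

lemma surv_le_run:
  "A \<subseteq> V \<Longrightarrow> finite A \<Longrightarrow> (\<And>u. u \<in> A \<Longrightarrow> level k (\<pi> u) = m) \<Longrightarrow> finite J \<Longrightarrow> explored n A \<subseteq> J \<Longrightarrow>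
    surv s k n (\<pi> ` A) \<le> bernoulli_exp p J (\<lambda>S. of_bool (run n A S \<noteq> {}))"
proof (induction n arbitrary: A m J)
  case 0
  thus ?case by (simp add: bernoulli_exp_const)
next
  case (Suc n)
  \<comment> \<open>One representative per fibre, so that the edges examined in this generation are
    disjoint. Restoring the other vertices at the end can only enlarge the run.\<close>
  obtain B where B: "B \<subseteq> A" "inj_on \<pi> B" "\<pi> ` A = \<pi> ` B"
    using subset_image_inj[of "\<pi> ` A" \<pi> A] by auto
  have fB: "finite B" "B \<subseteq> V" using B Suc.prems finite_subset by auto
  have lev: "level k (\<pi> u) = m" if "u \<in> B" for u using B Suc.prems that by auto
  have expl: "explored (Suc n) B \<subseteq> J" using explored_mono[OF B(1), of "Suc n"] Suc.prems(5) by (rule subset_trans)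
  define J0 where "J0 = (\<Union>u\<in>B. E u)"
  have "surv s k (Suc n) (\<pi> ` A) = bernoulli_exp s (\<pi> ` B \<times> {..<k}) (\<lambda>S. surv s k n ({} \<union> tgt ` S))"
    by (simp add: B(3))
  also have "\<dots> \<le> bernoulli_exp p J0 (\<lambda>S. surv s k n ({} \<union> \<pi> ` succs S B))"
    unfolding J0_def by (intro step_domination surv_mono s fB B(2)) auto
  also have "\<dots> \<le> bernoulli_exp p J0 (\<lambda>S. bernoulli_exp p (J - J0) (\<lambda>T. of_bool (run n (succs S B) T \<noteq> {})))"
  proof (rule bernoulli_exp_mono[OF p])
    fix S
    have "level k (\<pi> u) = m + 1" if "u \<in> succs S B" for u
      using run_level[OF fB(2), of m u 1 S] lev that by (simp add: run_Suc)
    thus "surv s k n ({} \<union> \<pi> ` succs S B) \<le> bernoulli_exp p (J - J0) (\<lambda>T. of_bool (run n (succs S B) T \<noteq> {}))"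
      unfolding Un_empty_left using Suc.prems(4) run_first_step(2)[OF fB lev Suc.prems(4) expl]
      by (intro Suc.IH[of _ "m + 1"] succs_V finite_succs fB) (auto simp: J0_def)
  qed
  also have "\<dots> = bernoulli_exp p J (\<lambda>S. of_bool (run (Suc n) B S \<noteq> {}))"
    unfolding J0_def using run_first_step(1)[OF fB lev Suc.prems(4) expl] by simp
  also have "\<dots> \<le> bernoulli_exp p J (\<lambda>S. of_bool (run (Suc n) A S \<noteq> {}))"
    using run_mono[OF B(1), of "Suc n"] by (intro bernoulli_exp_mono p) auto
  finally show ?case .
qed

end

section \<open>Oriented percolation as an exploration, and the critical point\<close>

definition open_step :: "nat \<Rightarrow> edge set \<Rightarrow> vertex \<Rightarrow> vertex \<Rightarrow> bool" where
  "open_step d S x y \<longleftrightarrow> (\<exists>i<d. y = tgt (x, i) \<and> arc_edge (x, i) \<in> S)"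

lemma unit_diff_iff: "(\<lambda>k. y k - x k) = unit_vec i \<longleftrightarrow> y = tgt (x, i)"
  by (auto simp: tgt_def fun_eq_iff algebra_simps)

lemma oriented_connected_iff:
  "oriented_connected d \<omega> x y \<longleftrightarrow> x \<in> Zd d \<and> (open_step d {e. \<omega> e})\<^sup>*\<^sup>* x y"
proof
  assume "oriented_connected d \<omega> x y"
  then show "x \<in> Zd d \<and> (open_step d {e. \<omega> e})\<^sup>*\<^sup>* x y"
    unfolding oriented_connected_def
  proof (elim exE conjE)
    fix n :: nat and xs :: "nat \<Rightarrow> vertex"
    assume xs: "xs 0 = x" "xs n = y" "\<forall>j\<le>n. xs j \<in> Zd d"
      "\<forall>j\<in>{1..n}. (\<lambda>k. xs j k - xs (j - 1) k) \<in> unit_vec ` {..<d} \<and> \<omega> {xs (j - 1), xs j}"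
    have "(open_step d {e. \<omega> e})\<^sup>*\<^sup>* x (xs j)" if "j \<le> n" for j
      using that
    proof (induction j)
      case (Suc j)
      obtain i where i: "i < d" "(\<lambda>k. xs (Suc j) k - xs j k) = unit_vec i" and \<omega>: "\<omega> {xs j, xs (Suc j)}"
        using xs(4)[rule_format, of "Suc j"] Suc.prems by auto
      have "xs (Suc j) = tgt (xs j, i)" using i(2) unit_diff_iff by simp
      hence "open_step d {e. \<omega> e} (xs j) (xs (Suc j))"
        using i \<omega> by (auto simp: open_step_def arc_edge_def)
      thus ?case using Suc by (auto intro: rtranclp.rtrancl_into_rtrancl)
    qed (simp add: xs)
    from this[of n] xs show "x \<in> Zd d \<and> (open_step d {e. \<omega> e})\<^sup>*\<^sup>* x y" by auto
  qed
next
  assume A: "x \<in> Zd d \<and> (open_step d {e. \<omega> e})\<^sup>*\<^sup>* x y"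
  hence "(open_step d {e. \<omega> e})\<^sup>*\<^sup>* x y" "x \<in> Zd d" by auto
  thus "oriented_connected d \<omega> x y"
  proof (induction rule: rtranclp_induct)
    case base
    thus ?case unfolding oriented_connected_def by (intro exI[of _ 0] exI[of _ "\<lambda>_. x"]) auto
  next
    case (step y z)
    then have "oriented_connected d \<omega> x y" by blast
    then show ?case
      unfolding oriented_connected_def[of d \<omega> x y]
    proof (elim exE conjE)
      fix n :: nat and xs :: "nat \<Rightarrow> vertex"
      assume xs: "xs 0 = x" "xs n = y" "\<forall>j\<le>n. xs j \<in> Zd d"
        "\<forall>j\<in>{1..n}. (\<lambda>k. xs j k - xs (j - 1) k) \<in> unit_vec ` {..<d} \<and> \<omega> {xs (j - 1), xs j}"
      obtain i where i: "i < d" "z = tgt (y, i)" "\<omega> {y, z}"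
        using step(2) by (auto simp: open_step_def arc_edge_def)
      have "(\<lambda>k. z k - y k) \<in> unit_vec ` {..<d}" using unit_diff_iff[of z y i] i by auto
      moreover have "z \<in> Zd d" using xs i tgt_Zd by auto
      ultimately show "oriented_connected d \<omega> x z" unfolding oriented_connected_def using xs i(3)
        by (intro exI[of _ "Suc n"] exI[of _ "xs(Suc n := z)"]) (auto simp: le_Suc_eq)
    qed
  qed
qed

lemma open_step_Zd: "(open_step d S)\<^sup>*\<^sup>* x y \<Longrightarrow> x \<in> Zd d \<Longrightarrow> y \<in> Zd d"
  by (induction rule: rtranclp_induct) (auto simp: open_step_def tgt_Zd)

lemma oriented_cluster_eq: "oriented_cluster d \<omega> = {x. (open_step d {e. \<omega> e})\<^sup>*\<^sup>* origin x}"
  unfolding oriented_cluster_def oriented_connected_iff using open_step_Zd by auto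

definition out_edges :: "nat \<Rightarrow> vertex \<Rightarrow> edge set" where
  "out_edges d v = arc_edge ` Pair v ` {..<d}"

definition out_open :: "nat \<Rightarrow> vertex \<Rightarrow> edge set \<Rightarrow> vertex set" where
  "out_open d v S = {tgt (v, i) | i. i < d \<and> arc_edge (v, i) \<in> S}"

lemma finite_out_open [simp]: "finite (out_open d v S)"
proof -
  have "out_open d v S \<subseteq> (\<lambda>i. tgt (v, i)) ` {..<d}" by (auto simp: out_open_def)
  thus ?thesis by (rule finite_subset) simp
qed

interpretation direct: exploration "out_edges d" "out_open d" "\<lambda>v. v" "Zd d" d for d
proof
  fix u v S u'
  show "finite (out_edges d u)" "finite (out_open d u S)" by (simp_all add: out_edges_def)
  show "out_open d u S \<subseteq> Zd d" if "u \<in> Zd d" using that by (auto simp: out_open_def tgt_Zd)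
  show "\<exists>i<d. u' = tgt (u, i)" if "u' \<in> out_open d u S" using that by (auto simp: out_open_def)
  show "out_edges d u \<inter> out_edges d v = {}" if "u \<noteq> v"
    using that by (auto simp: out_edges_def dest!: injD[OF inj_arc_edge])
qed

lemma direct_succs: "direct.succs d S A = {y. \<exists>x\<in>A. open_step d S x y}"
  by (auto simp: direct.succs_def out_open_def out_edges_def open_step_def)

lemma direct_run_cluster: "direct.run d n {x} S \<subseteq> {y. (open_step d S)\<^sup>*\<^sup>* x y}"
  by (induction n) (auto simp: direct.run_Suc' direct_succs intro: rtranclp.rtrancl_into_rtrancl)

lemma cluster_direct_run: "(open_step d S)\<^sup>*\<^sup>* x y \<Longrightarrow> \<exists>n. y \<in> direct.run d n {x} S"
proof (induction rule: rtranclp_induct)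
  case base
  have "x \<in> direct.run d 0 {x} S" by simp
  thus ?case by blast
next
  case (step y z)
  then obtain n where "y \<in> direct.run d n {x} S" by blast
  hence "z \<in> direct.run d (Suc n) {x} S" using step(2) by (auto simp: direct.run_Suc' direct_succs)
  thus ?case by blast
qed

lemma infinite_by_levels:
  assumes "\<And>n. \<exists>y\<in>X. f y = int n"
  shows "infinite X"
proof
  assume "finite X"
  moreover have "range int \<subseteq> f ` X" using assms by (metis image_iff image_subsetI)
  ultimately have "finite (range int)" using finite_subset by blast
  thus False using finite_imageD[of int UNIV] by (simp add: inj_on_def)
qed

lemma level_origin [simp]: "level d origin = 0"
  by (simp add: level_def origin_def)

text \<open>Every generation is finite and an empty one stays empty, so a finite number of nonempty
  generations means a finite cluster. Conversely, generation \<open>n\<close> lies in level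
  \<open>n\<close>, and infinitely many levels need infinitely many vertices.\<close>

lemma infinite_cluster_iff:
  "infinite (oriented_cluster d \<omega>) \<longleftrightarrow> (\<forall>n. direct.run d n {origin} {e. \<omega> e} \<noteq> {})"
proof
  assume inf: "infinite (oriented_cluster d \<omega>)"
  show "\<forall>n. direct.run d n {origin} {e. \<omega> e} \<noteq> {}"
  proof (rule ccontr)
    assume "\<not> ?thesis"
    then obtain n where n: "direct.run d n {origin} {e. \<omega> e} = {}" by blast
    hence "m < n" if "y \<in> direct.run d m {origin} {e. \<omega> e}" for m y
      using direct.run_decreasing[of n m d "{origin}" "{e. \<omega> e}"] that by (cases "m < n") auto
    hence "oriented_cluster d \<omega> \<subseteq> (\<Union>m<n. direct.run d m {origin} {e. \<omega> e})"
      unfolding oriented_cluster_eq using cluster_direct_run by fastforce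
    moreover have "finite (\<Union>m<n. direct.run d m {origin} {e. \<omega> e})"
      by (auto intro!: direct.finite_run)
    ultimately show False using inf finite_subset by blast
  qed
next
  assume A: "\<forall>n. direct.run d n {origin} {e. \<omega> e} \<noteq> {}"
  show "infinite (oriented_cluster d \<omega>)"
  proof (rule infinite_by_levels[where f = "level d"])
    fix n
    obtain y where y: "y \<in> direct.run d n {origin} {e. \<omega> e}" using A by blast
    thus "\<exists>y\<in>oriented_cluster d \<omega>. level d y = int n"
      using direct_run_cluster[of d n origin "{e. \<omega> e}"]
        direct.run_level[of "{origin}" d 0 y n "{e. \<omega> e}"]
      by (intro bexI[of _ y]) (auto simp: oriented_cluster_eq)
  qed
qed

lemma explored_edges:
  assumes "exploration E Sc \<pi> V k" "\<And>u. u \<in> V \<Longrightarrow> E u \<subseteq> X" "A \<subseteq> V"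
  shows "exploration.explored E Sc n A \<subseteq> X"
  using assms(3)
proof (induction n arbitrary: A)
  case 0
  show ?case using exploration.explored.simps(1)[OF assms(1)] by simp
next
  case (Suc n)
  show ?case
    unfolding exploration.explored.simps(2)[OF assms(1)]
    using Suc.IH[OF exploration.all_succs(1)[OF assms(1) Suc.prems]] assms(2) Suc.prems by blast
qed

lemma out_edges_subset: "u \<in> Zd d \<Longrightarrow> out_edges d u \<subseteq> edges d"
  by (auto simp: out_edges_def arc_edge_in_edges)

lemma run_event:
  fixes n :: nat
  assumes X: "exploration E Sc \<pi> V k" "\<And>u. u \<in> V \<Longrightarrow> E u \<subseteq> edges d" "a \<in> V" and p: "0 \<le> p" "p \<le> 1"
  defines "Ev \<equiv> {\<omega> \<in> space (percolation d p). exploration.run E Sc n {a} {e. \<omega> e} \<noteq> {}}"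
  shows "Ev \<in> sets (percolation d p)"
    and "measure (percolation d p) Ev =
      bernoulli_exp p (exploration.explored E Sc n {a}) (\<lambda>S. of_bool (exploration.run E Sc n {a} S \<noteq> {}))"
proof -
  interpret exploration E Sc \<pi> V k by (rule X)
  let ?J = "explored n {a}"
  have J: "finite ?J" "?J \<subseteq> edges d"
    using X(3) finite_explored[of "{a}" n] explored_edges[OF X(1,2), of "{a}"] by auto
  have *: "run n {a} {e. \<omega> e} = run n {a} {e\<in>?J. \<omega> e}" for \<omega>
  proof -
    have "{e\<in>?J. \<omega> e} = {e. \<omega> e} \<inter> ?J" by auto
    thus ?thesis using run_restrict[of "{a}" n ?J "{e. \<omega> e}"] X(3) by simp
  qed
  have Ev: "Ev = {\<omega> \<in> space (percolation d p). (\<lambda>S. run n {a} S \<noteq> {}) {e\<in>?J. \<omega> e}}"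
    unfolding Ev_def
  proof (rule Collect_cong)
    fix \<omega>
    show "(\<omega> \<in> space (percolation d p) \<and> run n {a} {e. \<omega> e} \<noteq> {}) =
        (\<omega> \<in> space (percolation d p) \<and> (\<lambda>S. run n {a} S \<noteq> {}) {e\<in>?J. \<omega> e})"
      using *[of \<omega>] by argo
  qed
  show "Ev \<in> sets (percolation d p)" unfolding Ev by (rule percolation_finite_event(1)[OF p J])
  show "measure (percolation d p) Ev = bernoulli_exp p ?J (\<lambda>S. of_bool (run n {a} S \<noteq> {}))"
    unfolding Ev by (rule percolation_finite_event(2)[OF p J])
qed

lemma infinite_cluster_event:
  assumes p: "0 \<le> p" "p \<le> 1"
  shows "{\<omega> \<in> space (percolation d p). infinite (oriented_cluster d \<omega>)} \<in> sets (percolation d p)"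
proof -
  have "{\<omega> \<in> space (percolation d p). infinite (oriented_cluster d \<omega>)} =
    (\<Inter>n. {\<omega> \<in> space (percolation d p). direct.run d n {origin} {e. \<omega> e} \<noteq> {}})"
    unfolding infinite_cluster_iff by auto
  also have "\<dots> \<in> sets (percolation d p)"
    using run_event(1)[OF direct.exploration_axioms out_edges_subset origin_Zd p]
    by (intro sets.countable_INT') auto
  finally show ?thesis .
qed

text \<open>Since \<open>A\<close> lies in one level, successive generations examine disjoint edges;
  sampling arcs anew at each step, as \<open>surv\<close> does, is then the same as using one
  configuration.\<close>

lemma direct_run_eq_surv:
  assumes p: "0 \<le> p" "p \<le> 1"
  shows "A \<subseteq> Zd d \<Longrightarrow> finite A \<Longrightarrow> (\<And>u. u \<in> A \<Longrightarrow> level d u = m) \<Longrightarrow> finite J \<Longrightarrow> direct.explored d n A \<subseteq> J \<Longrightarrow>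
    bernoulli_exp p J (\<lambda>S. of_bool (direct.run d n A S \<noteq> {})) = surv p d n A"
proof (induction n arbitrary: A m J)
  case 0
  thus ?case by (simp add: bernoulli_exp_const)
next
  case (Suc n)
  define J0 where "J0 = (\<Union>u\<in>A. out_edges d u)"
  have J0: "J0 = arc_edge ` (A \<times> {..<d})" by (auto simp: J0_def out_edges_def)
  have "bernoulli_exp p J (\<lambda>S. of_bool (direct.run d (Suc n) A S \<noteq> {})) =
     bernoulli_exp p J0 (\<lambda>S. bernoulli_exp p (J - J0) (\<lambda>T. of_bool (direct.run d n (direct.succs d S A) T \<noteq> {})))"
    unfolding J0_def using Suc.prems by (intro direct.run_first_step(1)) auto
  also have "\<dots> = bernoulli_exp p J0 (\<lambda>S. surv p d n (direct.succs d S A))"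
  proof (rule bernoulli_exp_cong)
    fix S
    have "level d u = m + 1" if "u \<in> direct.succs d S A" for u
      using direct.run_level[of A d m u 1 S] Suc.prems that by (simp add: direct.run_Suc)
    thus "bernoulli_exp p (J - J0) (\<lambda>T. of_bool (direct.run d n (direct.succs d S A) T \<noteq> {})) =
        surv p d n (direct.succs d S A)"
      using Suc.prems direct.run_first_step(2)[of A d m J n S]
      by (intro Suc.IH[of _ "m + 1"] direct.succs_V direct.finite_succs) (auto simp: J0_def)
  qed
  also have "\<dots> = bernoulli_exp p (A \<times> {..<d}) (\<lambda>S. surv p d n (direct.succs d (arc_edge ` S) A))"
    unfolding J0 using Suc.prems inj_arc_edge by (intro bernoulli_exp_image) (auto intro: inj_on_subset)
  also have "\<dots> = bernoulli_exp p (A \<times> {..<d}) (\<lambda>S. surv p d n (tgt ` S))"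
  proof (intro bernoulli_exp_cong arg_cong[of _ _ "surv p d n"])
    fix S assume S: "S \<subseteq> A \<times> {..<d}"
    have "arc_edge a \<in> arc_edge ` S \<longleftrightarrow> a \<in> S" for a using inj_arc_edge by (rule inj_image_mem_iff)
    thus "direct.succs d (arc_edge ` S) A = tgt ` S"
      unfolding direct_succs open_step_def using S by force
  qed
  finally show ?case by simp
qed

lemma theta_le_surv:
  assumes p: "0 \<le> p" "p \<le> 1"
  shows "oriented_theta d p \<le> surv p d n {origin}"
proof -
  interpret prob_space "percolation d p" by (rule prob_space_percolation)
  have "oriented_theta d p \<le>
      measure (percolation d p) {\<omega> \<in> space (percolation d p). direct.run d n {origin} {e. \<omega> e} \<noteq> {}}"
    unfolding oriented_theta_def infinite_cluster_iff
    by (intro finite_measure_mono run_event(1)[OF direct.exploration_axioms out_edges_subset _ p]) auto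
  also have "\<dots> = bernoulli_exp p (direct.explored d n {origin}) (\<lambda>S. of_bool (direct.run d n {origin} S \<noteq> {}))"
    by (intro run_event(2)[OF direct.exploration_axioms out_edges_subset _ p]) auto
  also have "\<dots> = surv p d n {origin}"
    by (intro direct_run_eq_surv[where m = 0] p direct.finite_explored) auto
  finally show ?thesis .
qed

text \<open>Survival for \<open>n\<close> generations is a decreasing sequence of events, so the
  uniform bound \<open>c\<close> passes to their intersection. There the cluster contains, for every
  \<open>n\<close>, a vertex of projected level \<open>n\<close>, and is infinite.\<close>

lemma theta_ge_run:
  assumes X: "exploration E Sc \<pi> V k" "\<And>u. u \<in> V \<Longrightarrow> E u \<subseteq> edges d" "origin \<in> V" and p: "0 \<le> p" "p \<le> 1"
    and \<pi>: "level k (\<pi> origin) = 0"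
    and reach: "\<And>u S u'. u \<in> V \<Longrightarrow> u' \<in> Sc u (S \<inter> E u) \<Longrightarrow> (open_step d S)\<^sup>*\<^sup>* u u'"
    and c: "\<And>n. c \<le> bernoulli_exp p (exploration.explored E Sc n {origin})
                     (\<lambda>S. of_bool (exploration.run E Sc n {origin} S \<noteq> {}))"
  shows "c \<le> oriented_theta d p"
proof -
  interpret exploration E Sc \<pi> V k by (rule X)
  interpret P: prob_space "percolation d p" by (rule prob_space_percolation)
  define B where "B n = {\<omega> \<in> space (percolation d p). run n {origin} {e. \<omega> e} \<noteq> {}}" for n
  have B: "range B \<subseteq> sets (percolation d p)"
    unfolding B_def using run_event(1)[OF X p] by auto
  have "decseq B" unfolding decseq_def B_def using run_decreasing by fast
  hence lim: "(\<lambda>n. measure (percolation d p) (B n)) \<longlonglongrightarrow> measure (percolation d p) (\<Inter>n. B n)"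
    by (intro P.finite_Lim_measure_decseq B)
  have "c \<le> measure (percolation d p) (B n)" for n
    unfolding B_def using run_event(2)[OF X p, of n] c[of n] by simp
  hence "c \<le> measure (percolation d p) (\<Inter>n. B n)"
    by (intro tendsto_lowerbound[OF lim]) auto
  also have "\<dots> \<le> oriented_theta d p"
    unfolding oriented_theta_def
  proof (intro P.finite_measure_mono infinite_cluster_event p subsetI)
    fix \<omega> assume \<omega>: "\<omega> \<in> (\<Inter>n. B n)"
    have sub: "run n {origin} S \<subseteq> {y. (open_step d S)\<^sup>*\<^sup>* origin y}" for n S
    proof (induction n)
      case (Suc n)
      show ?case
      proof
        fix z assume "z \<in> run (Suc n) {origin} S"
        then obtain y where y: "y \<in> run n {origin} S" "z \<in> Sc y (S \<inter> E y)"
          by (auto simp: run_Suc' succs_def)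
        moreover have "y \<in> V" using y run_V[of "{origin}"] X(3) by auto
        ultimately have "(open_step d S)\<^sup>*\<^sup>* origin y" "(open_step d S)\<^sup>*\<^sup>* y z" using Suc reach by auto
        thus "z \<in> {y. (open_step d S)\<^sup>*\<^sup>* origin y}" by simp
      qed
    qed simp
    have "infinite (oriented_cluster d \<omega>)"
    proof (rule infinite_by_levels[where f = "\<lambda>u. level k (\<pi> u)"])
      fix n
      obtain y where y: "y \<in> run n {origin} {e. \<omega> e}" using \<omega> by (auto simp: B_def)
      hence "y \<in> oriented_cluster d \<omega>" using sub by (auto simp: oriented_cluster_eq)
      moreover have "level k (\<pi> y) = int n" using run_level[of "{origin}" 0 y n "{e. \<omega> e}"] y \<pi> X(3) by simp
      ultimately show "\<exists>y\<in>oriented_cluster d \<omega>. level k (\<pi> y) = int n" by blast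
    qed
    moreover have "\<omega> \<in> space (percolation d p)" using \<omega> by (auto simp: B_def)
    ultimately show "\<omega> \<in> {\<omega> \<in> space (percolation d p). infinite (oriented_cluster d \<omega>)}" by simp
  qed
  finally show ?thesis .
qed

lemma oriented_pc_le:
  assumes "\<And>p. 0 \<le> p \<Longrightarrow> p \<le> 1 \<Longrightarrow> b < p \<Longrightarrow> 0 < oriented_theta d p"
  shows "oriented_pc d \<le> b"
proof -
  \<comment> \<open>The supremum has to be taken over a nonempty set; p = 0 belongs to it.\<close>
  have "oriented_theta d 0 \<le> surv 0 d 1 {origin}" by (rule theta_le_surv) auto
  also have "\<dots> \<le> 0" using surv_union_bound[of 0 "{origin}" d 1] by simp
  finally have "oriented_theta d 0 = 0" unfolding oriented_theta_def by (simp add: measure_le_0_iff)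
  hence "0 \<in> {p \<in> {0..1}. oriented_theta d p = 0}" by simp
  hence "{p \<in> {0..1}. oriented_theta d p = 0} \<noteq> {}" by blast
  moreover have "p \<le> b" if "p \<in> {p \<in> {0..1}. oriented_theta d p = 0}" for p
    using assms[of p] that by force
  ultimately show ?thesis unfolding oriented_pc_def by (intro cSup_least)
qed

lemma oriented_pc_ge: "0 \<le> p \<Longrightarrow> p \<le> 1 \<Longrightarrow> oriented_theta d p = 0 \<Longrightarrow> p \<le> oriented_pc d"
  unfolding oriented_pc_def by (rule cSup_upper) (auto intro!: bdd_aboveI[of _ 1])

text \<open>At p = 1/(2d) the first-moment bound is (1/2)^n. Positivity makes the critical point an
  admissible first argument of \<open>Sol\<close>.\<close>

lemma oriented_pc_pos:
  assumes "d \<ge> 1"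
  shows "0 < oriented_pc d"
proof -
  define p where "p = 1 / (2 * real d)"
  have p: "0 \<le> p" "p \<le> 1" "0 < p" "real d * p = 1/2" using assms by (auto simp: p_def field_simps)
  have "oriented_theta d p \<le> (1/2) ^ n" for n
    using theta_le_surv[OF p(1,2), of d n] surv_union_bound[OF p(1,2), of "{origin}" d n] p(4) by simp
  moreover have "(\<lambda>n. (1/2::real) ^ n) \<longlonglongrightarrow> 0" by (rule LIMSEQ_realpow_zero) auto
  ultimately have "oriented_theta d p \<le> 0" by (intro tendsto_lowerbound[of _ 0 sequentially]) auto
  hence "oriented_theta d p = 0" unfolding oriented_theta_def by (simp add: measure_le_0_iff)
  from oriented_pc_ge[OF p(1,2) this] p(3) show ?thesis by simp
qed

section \<open>The renewal process of Holley and Liggett\<close>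

text \<open>The generating function \<open>y\<close> of \<open>gap_tail\<close>, the Catalan numbers over powers of 4, solves
  \<open>y = 1 + z y\<^sup>2 / 4\<close>; \<open>stat_tail n\<close> is the sum of \<open>gap_tail k\<close> over \<open>k \<ge> n\<close>; \<open>hyb_tail\<close> has the
  generating function \<open>3 y / (y + 2)\<close>.\<close>

fun gap_tail :: "nat \<Rightarrow> real" where
  "gap_tail 0 = 1"
| "gap_tail (Suc n) = gap_tail n * (2 * real n + 1) / (2 * real n + 4)"

definition stat_tail :: "nat \<Rightarrow> real" where
  "stat_tail n = 2 * (real n + 1) * gap_tail n"

fun hyb_tail :: "nat \<Rightarrow> real" where
  "hyb_tail 0 = 1"
| "hyb_tail (Suc n) = gap_tail n / 2 - hyb_tail n / 3"

lemma gap_tail_pos: "gap_tail n > 0"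
  by (induction n) auto

lemma stat_tail_diff: "stat_tail n - stat_tail (Suc n) = gap_tail n"
  by (simp add: stat_tail_def field_simps)

text \<open>With z for \<open>fps_X\<close>, the series is y = 2 (1 - sqrt (1 - z)) / z. By
  \<open>gb\<close>, u = 1 - z y / 2 has the binomial coefficients of exponent 1/2 up to signs;
  Vandermonde's identity then gives u^2 = 1 - z, and expanding the square yields the claim.\<close>

lemma gap_tail_fps:
  defines "y \<equiv> Abs_fps gap_tail"
  shows "fps_X * y\<^sup>2 = 4 * (y - 1)"
proof -
  define u where "u = 1 - fps_X * (fps_const (1/2) * y)"
  have gb: "(1/2 gchoose Suc n) = - ((-1) ^ Suc n) * gap_tail n / 2" for n
  proof (induction n)
    case (Suc n)
    have "(1/2 gchoose Suc (Suc n)) * (real n + 2) = (1/2 gchoose Suc n) * (1/2 - (real n + 1))"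
      using gbinomial_absorb_comp[of "1/2::real" "Suc n"] gbinomial_mult_1[of "1/2::real" "Suc n"]
      by (simp add: algebra_simps)
    thus ?case using Suc by (simp add: field_simps)
  qed simp
  have u_nth: "fps_nth u n = (-1) ^ n * (1/2 gchoose n)" for n
    by (cases n) (simp_all add: u_def gb y_def)
  have "u\<^sup>2 = 1 - fps_X"
  proof (rule fps_ext)
    fix n
    have "fps_nth (u\<^sup>2) n = (\<Sum>i=0..n. ((-1)^i * (1/2 gchoose i)) * ((-1)^(n-i) * (1/2 gchoose (n-i))))"
      by (simp add: power2_eq_square fps_mult_nth u_nth)
    also have "\<dots> = (\<Sum>i=0..n. (-1)^n * ((1/2 gchoose i) * (1/2 gchoose (n-i))))"
    proof (rule sum.cong[OF refl])
      fix i assume "i \<in> {0..n}"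
      hence "(-1::real)^i * (-1)^(n-i) = (-1)^n" by (simp flip: power_add)
      moreover have "x * a * (y * b) = (x * y) * (a * b)" for x y a b :: real by simp
      ultimately show "(- 1) ^ i * (1 / 2 gchoose i) * ((- 1) ^ (n - i) * (1 / 2 gchoose (n - i))) =
          (- 1) ^ n * ((1 / 2 gchoose i) * (1 / 2 gchoose (n - i)) :: real)" by metis
    qed
    also have "\<dots> = (-1)^n * ((1/2 + 1/2 :: real) gchoose n)"
      by (subst gbinomial_Vandermonde[symmetric]) (simp add: sum_distrib_left atLeast0AtMost)
    also have "\<dots> = fps_nth (1 - fps_X :: real fps) n"
    proof -
      have "((1::real) gchoose n) = of_nat (1 choose n)" 
        using binomial_gbinomial[of 1 n, where 'a=real] by simp
      thus ?thesis by (cases n; cases "n - 1") auto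
    qed
    finally show "fps_nth (u\<^sup>2) n = fps_nth (1 - fps_X) n" .
  qed
  define h where "h = (fps_const (1/2) :: real fps)"
  have h: "h + h = 1" by (simp add: h_def flip: fps_const_add)
  have "u\<^sup>2 = 1 - (h + h) * (fps_X * y) + fps_X * (h\<^sup>2 * (fps_X * y\<^sup>2))"
    unfolding u_def h_def[symmetric] by (simp add: power2_eq_square algebra_simps)
  with \<open>u\<^sup>2 = 1 - fps_X\<close> h have "fps_X * (h\<^sup>2 * (fps_X * y\<^sup>2)) = fps_X * (y - 1)"
    by (simp add: algebra_simps)
  hence "h\<^sup>2 * (fps_X * y\<^sup>2) = y - 1" by simp
  moreover have "4 * h\<^sup>2 = (h + h)\<^sup>2" by (simp add: power2_eq_square algebra_simps)
  ultimately have "4 * (y - 1) = (h + h)\<^sup>2 * (fps_X * y\<^sup>2)" by (simp add: mult.assoc)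
  thus ?thesis by (simp add: h)
qed

text \<open>Coefficients of v (2 + y) = 3 y. The recursion of \<open>hyb_tail\<close> says v (6 + 2
  z) = 6 + 3 z y; multiplied by 2 + y, the right side becomes 3 y (6 + 2 z) through the quadratic
  equation for y.\<close>

lemma hyb_conv: "2 * hyb_tail n + (\<Sum>k\<le>n. hyb_tail k * gap_tail (n - k)) = 3 * gap_tail n"
proof -
  define y where "y = Abs_fps gap_tail"
  define v where "v = Abs_fps hyb_tail"
  have y: "fps_X * y\<^sup>2 = 4 * (y - 1)" unfolding y_def by (rule gap_tail_fps)
  have v: "v * (6 + 2 * fps_X) = 6 + 3 * fps_X * y"
  proof (rule fps_ext)
    fix n show "fps_nth (v * (6 + 2 * fps_X)) n = fps_nth (6 + 3 * fps_X * y) n"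
      by (cases n) (simp_all add: v_def y_def algebra_simps numeral_fps_const)
  qed
  have "(v * (2 + y)) * (6 + 2 * fps_X) = (3 * y) * (6 + 2 * fps_X)"
  proof -
    have "(v * (2 + y)) * (6 + 2 * fps_X) = (6 + 3 * fps_X * y) * (2 + y)"
      using v by (simp add: mult_ac)
    also have "\<dots> = 12 + 6 * y + 6 * (fps_X * y) + 3 * (fps_X * y\<^sup>2)"
      by (simp add: algebra_simps power2_eq_square)
    also have "\<dots> = (3 * y) * (6 + 2 * fps_X)" unfolding y by (simp add: algebra_simps)
    finally show ?thesis .
  qed
  moreover have "(6 + 2 * fps_X :: real fps) \<noteq> 0"
  proof
    assume "(6 + 2 * fps_X :: real fps) = 0"
    hence "fps_nth (6 + 2 * fps_X :: real fps) 0 = 0" by simp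
    thus False by (simp add: numeral_fps_const)
  qed
  ultimately have "v * (2 + y) = 3 * y" by simp
  hence "fps_nth (v * (2 + y)) n = fps_nth (3 * y) n" by simp
  moreover have "fps_nth (v * y) n = (\<Sum>k\<le>n. hyb_tail k * gap_tail (n - k))"
    by (simp add: fps_mult_nth v_def y_def atLeast0AtMost)
  ultimately show ?thesis
    by (simp add: distrib_left numeral_fps_const mult.commute[of _ "fps_const 2"]) (simp add: v_def y_def)
qed

text \<open>The limit 3/8 of \<open>hyb_tail n / gap_tail n\<close> is the fixed point of r = 1/2 -
  r/3, and 9/(8 n) is its first-order relative correction. The recursion reverses inequalities, so
  each bound needs the other one. The factor 6 x - 18 in the first difference explains the start at
  3.\<close>

lemma hyb_tail_bounds:
  assumes "n \<ge> 3"
  shows "3 / 8 * (1 + 9 / (8 * real n + 4)) * gap_tail n \<le> hyb_tail n \<and>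
         hyb_tail n \<le> 3 / 8 * (1 + 9 / (8 * real n)) * gap_tail n"
  using assms
proof (induction n rule: dec_induct)
  case base
  show ?case by (simp add: eval_nat_numeral)
next
  case (step n)
  define x where "x = real n"
  define g where "g = gap_tail n"
  have x: "x \<ge> 3" using step by (simp add: x_def)
  have g: "g > 0" by (simp add: g_def gap_tail_pos)
  have lo: "3 / 8 * (1 + 9 / (8 * x + 4)) * g \<le> hyb_tail n"
   and hi: "hyb_tail n \<le> 3 / 8 * (1 + 9 / (8 * x)) * g"
    using step by (auto simp: x_def g_def)
  have "3 / 8 * (1 + 9 / (8 * (x+1) + 4)) * ((2*x+1) / (2*x+4)) \<le> 1/2 - (1/8) * (1 + 9 / (8 * x))"
  proof -
    have "1/2 - (1/8) * (1 + 9 / (8 * x)) - 3 / 8 * (1 + 9 / (8 * (x+1) + 4)) * ((2*x+1) / (2*x+4))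
       = 3 * (6 * x - 18) / (64 * x * (2*x+3) * (x+2))"
      using x by (simp add: divide_simps) (simp add: algebra_simps power2_eq_square power3_eq_cube power4_eq_xxxx)
    also have "\<dots> \<ge> 0" using x by simp
    finally show ?thesis by simp
  qed
  from mult_right_mono[OF this, of g] 
  have 1: "3 / 8 * (1 + 9 / (8 * (x+1) + 4)) * (g * (2*x+1) / (2*x+4)) \<le> g/2 - (1/8) * (1 + 9 / (8 * x)) * g"
    using g by (simp add: algebra_simps)
  have "1/2 - (1/8) * (1 + 9 / (8 * x + 4)) \<le> 3 / 8 * (1 + 9 / (8 * (x+1))) * ((2*x+1) / (2*x+4))"
  proof -
    have "3 / 8 * (1 + 9 / (8 * (x+1))) * ((2*x+1) / (2*x+4)) - (1/2 - (1/8) * (1 + 9 / (8 * x + 4)))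
      = 27 / (128 * (x+1) * (x+2) * (2*x+1))"
      using x by (simp add: divide_simps) (simp add: algebra_simps power2_eq_square power3_eq_cube power4_eq_xxxx)
    also have "\<dots> \<ge> 0" using x by simp
    finally show ?thesis by simp
  qed
  from mult_right_mono[OF this, of g] 
  have 2: "g/2 - (1/8) * (1 + 9 / (8 * x + 4)) * g \<le> 3 / 8 * (1 + 9 / (8 * (x+1))) * (g * (2*x+1) / (2*x+4))"
    using g by (simp add: algebra_simps)
  have H: "hyb_tail (Suc n) = g / 2 - hyb_tail n / 3" by (simp add: g_def)
  have G: "gap_tail (Suc n) = g * (2*x+1) / (2*x+4)" by (simp add: g_def x_def)
  have X: "real (Suc n) = x + 1" by (simp add: x_def)
  show ?case unfolding H G X
  proof
    show "3 / 8 * (1 + 9 / (8 * (x + 1) + 4)) * (g * (2 * x + 1) / (2 * x + 4)) \<le> g / 2 - hyb_tail n / 3"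
    proof (rule order_trans[OF 1])
      have "3 * ((1 + 9 / (8 * x)) * g) \<ge> 8 * hyb_tail n"
        using hi by (simp only: mult.assoc)
      thus "g / 2 - 1 / 8 * (1 + 9 / (8 * x)) * g \<le> g / 2 - hyb_tail n / 3"
        by (simp only: mult.assoc)
    qed
    show "g / 2 - hyb_tail n / 3 \<le> 3 / 8 * (1 + 9 / (8 * (x + 1))) * (g * (2 * x + 1) / (2 * x + 4))"
    proof (rule order_trans[OF _ 2])
      have "3 * ((1 + 9 / (8 * x + 4)) * g) \<le> 8 * hyb_tail n"
        using lo by (simp only: mult.assoc)
      thus "g / 2 - hyb_tail n / 3 \<le> g / 2 - 1 / 8 * (1 + 9 / (8 * x + 4)) * g"
        by (simp only: mult.assoc)
    qed
  qed
qed

text \<open>After inserting both recursions the ratio inequality becomes \<open>lo\<close>, a lower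
  bound for \<open>hyb_tail n\<close>. It states that \<open>hyb_tail\<close> has the larger hazard
  rate.\<close>

lemma hyb_tail_ratio:
  "hyb_tail n > 0 \<and> hyb_tail (Suc n) * gap_tail n \<le> gap_tail (Suc n) * hyb_tail n"
proof -
  define g where "g = gap_tail n"
  define x where "x = real n"
  have g: "g > 0" by (simp add: g_def gap_tail_pos)
  have lo: "3 * (x + 2) / (8 * x + 7) * g \<le> hyb_tail n"
  proof (cases "n \<ge> 3")
    case True
    have "3 * (x + 2) / (8 * x + 7) \<le> 3 / 8 * (1 + 9 / (8 * x + 4))"
    proof -
      have "x \<ge> 0" by (simp add: x_def)
      thus ?thesis by (simp add: divide_simps) (simp add: algebra_simps)
    qed
    hence "3 * (x + 2) / (8 * x + 7) * g \<le> 3 / 8 * (1 + 9 / (8 * x + 4)) * g"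
      using g by (intro mult_right_mono) auto
    also have "\<dots> \<le> hyb_tail n" using hyb_tail_bounds[OF True] unfolding x_def g_def by blast
    finally show ?thesis .
  next
    case False
    hence "n = 0 \<or> n = 1 \<or> n = 2" by auto
    thus ?thesis by (auto simp: x_def g_def eval_nat_numeral)
  qed
  have x: "x \<ge> 0" by (simp add: x_def)
  have pos: "hyb_tail n > 0" using lo g x by (intro less_le_trans[OF _ lo]) simp
  have "3 * (x + 2) * g \<le> hyb_tail n * (8 * x + 7)" using lo x by (simp add: pos_divide_le_eq)
  hence "(g / 2 - hyb_tail n / 3) * (2*x+4) \<le> (2*x+1) * hyb_tail n"
    by (simp add: algebra_simps)
  hence "(g / 2 - hyb_tail n / 3) \<le> (2*x+1) * hyb_tail n / (2*x+4)"
    using x by (simp add: pos_le_divide_eq)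
  hence "(g / 2 - hyb_tail n / 3) * g \<le> (2*x+1) * hyb_tail n / (2*x+4) * g"
    using g by (intro mult_right_mono) auto
  thus ?thesis using pos by (simp add: g_def x_def mult_ac)
qed

section \<open>Products of weights along a renewal process\<close>

text \<open>\<open>val L ws\<close>: mean of the product of the weights \<open>ws\<close> at the renewal epochs met on successive
  sites, if the next renewal is at distance \<open>> t\<close> with (unnormalised) probability \<open>L t\<close>.\<close>

definition step :: "real \<Rightarrow> (nat \<Rightarrow> real) \<Rightarrow> nat \<Rightarrow> real" where
  "step w L t = L (Suc t) + w * (L 0 - L 1) * gap_tail t"

fun val :: "(nat \<Rightarrow> real) \<Rightarrow> real list \<Rightarrow> real" where
  "val L [] = L 0"
| "val L (w # ws) = val (step w L) ws"

lemma val_linear: "val (\<lambda>t. a * L t + b * M t) ws = a * val L ws + b * val M ws"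
proof (induction ws arbitrary: L M)
  case (Cons w ws)
  have "step w (\<lambda>t. a * L t + b * M t) = (\<lambda>t. a * step w L t + b * step w M t)"
    by (auto simp: step_def algebra_simps)
  thus ?case using Cons by simp
qed simp

lemma gap_ratio_mono: "gap_tail (Suc n) * gap_tail n' \<le> gap_tail (Suc n') * gap_tail n" if "n \<le> n'"
proof -
  have "(2 * real n + 1) / (2 * real n + 4) \<le> (2 * real n' + 1) / (2 * real n' + 4)"
    using that by (simp add: field_simps)
  from mult_right_mono[OF this, of "gap_tail n * gap_tail n'"] gap_tail_pos[of n] gap_tail_pos[of n']
  show ?thesis by (simp add: mult_ac)
qed

abbreviation gap_ratio :: "nat \<Rightarrow> real" where "gap_ratio n \<equiv> (2 * real n + 1) / (2 * real n + 4)"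

text \<open>Decreasing hazard rate: the older the current gap, the fewer renewals are met later.\<close>

lemma val_age_mono:
  assumes "\<forall>w\<in>set ws. 0 \<le> w \<and> w \<le> 1" "a \<le> b"
  shows "0 \<le> val (\<lambda>t. gap_tail (a + t) / gap_tail a) ws \<and>
     val (\<lambda>t. gap_tail (a + t) / gap_tail a) ws \<le> val (\<lambda>t. gap_tail (b + t) / gap_tail b) ws"
  using assms
proof (induction ws arbitrary: a b)
  case Nil
  thus ?case using gap_tail_pos by (simp add: less_imp_neq[THEN not_sym])
next
  case (Cons w ws)
  define r where "r a = val (\<lambda>t. gap_tail (a + t) / gap_tail a) ws" for a
  have rec: "val (\<lambda>t. gap_tail (a + t) / gap_tail a) (w # ws)
      = gap_ratio a * r (Suc a) + w * (1 - gap_ratio a) * r 0" for a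
  proof -
    have k: "gap_tail (Suc a) / gap_tail a = gap_ratio a" using gap_tail_pos[of a] by simp
    have "step w (\<lambda>t. gap_tail (a + t) / gap_tail a) =
      (\<lambda>t. gap_ratio a * (gap_tail (Suc a + t) / gap_tail (Suc a)) + (w * (1 - gap_ratio a)) * (gap_tail (0 + t) / gap_tail 0))"
    proof
      fix t
      have "gap_tail (Suc (a + t)) / gap_tail a = gap_ratio a * (gap_tail (Suc a + t) / gap_tail (Suc a))"
        using gap_tail_pos[of a] gap_tail_pos[of "Suc a"]
        by (simp add: k[symmetric] del: gap_tail.simps)
      moreover have "gap_tail (a + 1) / gap_tail a = gap_ratio a" "gap_tail a / gap_tail a = 1" using k gap_tail_pos[of a] by simp_all
      ultimately show "step w (\<lambda>t. gap_tail (a + t) / gap_tail a) t = gap_ratio a * (gap_tail (Suc a + t) / gap_tail (Suc a)) + (w * (1 - gap_ratio a)) * (gap_tail (0 + t) / gap_tail 0)"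
        unfolding step_def by simp
    qed
    thus ?thesis by (simp only: val.simps val_linear r_def)
  qed
  have w: "0 \<le> w" "w \<le> 1" and ws: "\<forall>w\<in>set ws. 0 \<le> w \<and> w \<le> 1" using Cons by auto
  have r0: "0 \<le> r a" for a unfolding r_def using Cons.IH[OF ws order.refl] by blast
  have rm: "r a \<le> r b" if "a \<le> b" for a b unfolding r_def using Cons.IH[OF ws that] by blast
  have k: "0 \<le> gap_ratio a" "gap_ratio a \<le> 1" "gap_ratio a \<le> gap_ratio b" using Cons.prems(2) by (auto simp: field_simps)
  have "gap_ratio a * r (Suc a) + w * (1 - gap_ratio a) * r 0 \<le> gap_ratio a * r (Suc b) + w * (1 - gap_ratio a) * r 0"
    using k rm[of "Suc a" "Suc b"] Cons.prems(2) by (intro add_right_mono mult_left_mono) auto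
  also have "\<dots> \<le> gap_ratio b * r (Suc b) + w * (1 - gap_ratio b) * r 0"
  proof -
    \<comment> \<open>Renewing now costs the factor \<open>w\<close> and restarts at age 0, the age
      with the smallest value; hence a larger chance of not renewing is favourable.\<close>
    have "w * r 0 \<le> r (Suc b)" using mult_right_mono[OF w(2) r0[of 0]] rm[of 0 "Suc b"] by simp
    hence "0 \<le> (gap_ratio b - gap_ratio a) * (r (Suc b) - w * r 0)" using k by simp
    thus ?thesis by (simp add: algebra_simps del: times_divide_eq_left times_divide_eq_right)
  qed
  finally have le: "gap_ratio a * r (Suc a) + w * (1 - gap_ratio a) * r 0 \<le> gap_ratio b * r (Suc b) + w * (1 - gap_ratio b) * r 0" .
  moreover have "0 \<le> gap_ratio a * r (Suc a) + w * (1 - gap_ratio a) * r 0"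
    by (intro add_nonneg_nonneg mult_nonneg_nonneg r0 k w diff_ge_0_iff_ge[THEN iffD2])
  ultimately show ?case unfolding rec by (rule conjI[rotated])
qed

text \<open>The point mass renews at the next site for certain, \<open>gap_tail\<close> only with
  probability 3/4. A renewal there yields \<open>w * r 0\<close>, which is at most the value
  \<open>r 1\<close> of waiting.\<close>

lemma val_point_le_gap:
  assumes "\<forall>w\<in>set ws. 0 \<le> w \<and> w \<le> 1"
  shows "val (\<lambda>t. if t = 0 then 1 else 0) ws \<le> val gap_tail ws"
proof (cases ws)
  case (Cons w ws')
  define r where "r a = val (\<lambda>t. gap_tail (a + t) / gap_tail a) ws'" for a
  have ws: "\<forall>w\<in>set ws'. 0 \<le> w \<and> w \<le> 1" and w: "0 \<le> w" "w \<le> 1" using assms Cons by auto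
  have r0: "0 \<le> r 0" "r 0 \<le> r 1" using val_age_mono[OF ws, of 0 1] by (auto simp: r_def)
  have g1: "gap_tail (Suc 0) = 1/4" by simp
  have 1: "step w (\<lambda>t. if t = 0 then 1 else 0) = (\<lambda>t. w * (gap_tail (0 + t) / gap_tail 0) + 0 * 0)"
    by (auto simp: step_def)
  have 2: "step w gap_tail = (\<lambda>t. (1/4) * (gap_tail (1 + t) / gap_tail 1) + (w * (3/4)) * (gap_tail (0 + t) / gap_tail 0))"
    by (rule ext) (simp add: step_def g1 del: gap_tail.simps(2))
  have "w * r 0 \<le> r 1" using mult_right_mono[OF w(2) r0(1)] r0 by simp
  moreover have "val (\<lambda>t. if t = 0 then 1 else 0) ws = w * r 0"
    unfolding Cons val.simps 1 val_linear r_def by simp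
  moreover have "val gap_tail ws = 1/4 * r 1 + w * (3/4) * r 0"
    unfolding Cons val.simps 2 val_linear r_def by simp
  ultimately show ?thesis by simp
qed simp

section \<open>Scanning a level site by site\<close>

declare gap_tail.simps(2) [simp del] hyb_tail.simps(2) [simp del]

text \<open>The mass \<open>L 0 - L 1\<close> of a renewal at the next site is multiplied by 1/3
  while later renewals keep theirs: a factor 1/3 that is already due at the next site.\<close>

definition damp :: "(nat \<Rightarrow> real) \<Rightarrow> nat \<Rightarrow> real" where
  "damp L t = (if t = 0 then L 1 + (L 0 - L 1) / 3 else L t)"

text \<open>Scanning an occupied site. Its two arcs end at adjacent sites of the next level:
  \<open>step (1/3)\<close> pays the factor at the first of them, \<open>damp\<close> leaves the
  factor for the second.\<close>

definition sweep :: "(nat \<Rightarrow> real) \<Rightarrow> nat \<Rightarrow> real" where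
  "sweep L = damp (step (1/3) L)"

lemma step_damp: "step (w / 3) L = step w (damp L)"
  by (rule ext) (simp add: step_def damp_def)

lemma sweep_linear: "sweep (\<lambda>t. a * L t + b * M t) = (\<lambda>t. a * sweep L t + b * sweep M t)"
  by (rule ext) (simp add: sweep_def damp_def step_def field_simps)

lemma sweep_pow_linear:
  "(sweep ^^ n) (\<lambda>t. a * L t + b * M t) = (\<lambda>t. a * (sweep ^^ n) L t + b * (sweep ^^ n) M t)"
  by (induction n) (simp_all add: sweep_linear)

text \<open>The first equation is the equality on intervals: \<open>stat_tail a\<close> is the mass
  of avoiding \<open>a\<close> consecutive sites. The induction carries the whole swept tail along;
  its values at 0 and 1 come from \<open>hyb_conv\<close> at \<open>a\<close> and
  \<open>Suc a\<close>, used in \<open>c1\<close> and \<open>c2\<close>.\<close>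

lemma sweep_stat_tail:
  "(sweep ^^ a) stat_tail 0 = stat_tail a \<and>
   (sweep ^^ a) stat_tail 0 - (sweep ^^ a) stat_tail 1 = hyb_tail a \<and>
   (\<forall>t\<ge>1. (sweep ^^ a) stat_tail t =
      stat_tail (a + t) + (\<Sum>j<a. hyb_tail j * gap_tail (a - 1 - j + t)) / 3)"
proof (induction a)
  case 0
  show ?case using stat_tail_diff[of 0] by simp
next
  case (Suc a)
  define Z where "Z = (sweep ^^ a) stat_tail"
  define U where "U = step (1/3) Z"
  have Z': "(sweep ^^ Suc a) stat_tail = damp U" by (simp add: sweep_def U_def Z_def)
  have U: "U t = stat_tail (Suc a + t) + (\<Sum>j<Suc a. hyb_tail j * gap_tail (a - j + t)) / 3" for t
  proof -
    have Z0: "Z 0 - Z (Suc 0) = hyb_tail a" using Suc unfolding Z_def One_nat_def by blast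
    have "Z (Suc t) = stat_tail (a + Suc t) + (\<Sum>j<a. hyb_tail j * gap_tail (a - 1 - j + Suc t)) / 3"
      unfolding Z_def by (rule Suc[THEN conjunct2, THEN conjunct2, rule_format]) simp
    also have "(\<Sum>j<a. hyb_tail j * gap_tail (a - 1 - j + Suc t)) = (\<Sum>j<a. hyb_tail j * gap_tail (a - j + t))"
      by (intro sum.cong refl arg_cong2[of _ _ _ _ "(*)"] arg_cong[of _ _ gap_tail]) auto
    finally show ?thesis by (simp add: U_def step_def Z0 add_divide_distrib)
  qed
  have c1: "(\<Sum>j<Suc a. hyb_tail j * gap_tail (a - j)) = 3 * gap_tail a - 2 * hyb_tail a"
    using hyb_conv[of a] by (simp add: lessThan_Suc_atMost)
  have c2: "(\<Sum>j<Suc a. hyb_tail j * gap_tail (a - j + 1)) = 3 * gap_tail (Suc a) - 3 * hyb_tail (Suc a)"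
  proof -
    have "(\<Sum>j<Suc a. hyb_tail j * gap_tail (a - j + 1)) = (\<Sum>j<Suc a. hyb_tail j * gap_tail (Suc a - j))"
      by (intro sum.cong refl arg_cong2[of _ _ _ _ "(*)"] arg_cong[of _ _ gap_tail]) auto
    also have "\<dots> = (\<Sum>j\<le>Suc a. hyb_tail j * gap_tail (Suc a - j)) - hyb_tail (Suc a)"
      by (simp add: lessThan_Suc_atMost)
    finally show ?thesis using hyb_conv[of "Suc a"] by (simp)
  qed
  have U0: "U 0 = stat_tail (Suc a) + gap_tail a - 2 / 3 * hyb_tail a"
    unfolding U using c1 by (simp add: diff_divide_distrib)
  have U1: "U 1 = stat_tail (Suc (Suc a)) + gap_tail (Suc a) - hyb_tail (Suc a)"
    unfolding U c2 by (simp add: diff_divide_distrib)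
  have sd: "stat_tail (Suc (Suc a)) + gap_tail (Suc a) = stat_tail (Suc a)"
    using stat_tail_diff[of "Suc a"] by linarith
  have d: "(U 0 - U 1) / 3 = hyb_tail (Suc a)"
    unfolding U0 U1 sd by (simp add: hyb_tail.simps(2))
  have m: "U 1 + (U 0 - U 1) / 3 = stat_tail (Suc a)"
    unfolding d unfolding U1 sd by simp
  have D: "damp U 0 = U 1 + (U 0 - U 1) / 3" "damp U 1 = U 1" "\<And>t. t \<ge> 1 \<Longrightarrow> damp U t = U t"
    by (simp_all add: damp_def)
  show ?case unfolding Z'
  proof (intro conjI allI impI)
    show "damp U 0 = stat_tail (Suc a)" using D(1) m by (rule trans)
    show "damp U 0 - damp U 1 = hyb_tail (Suc a)" using D(1,2) d by linarith
    show "damp U t = stat_tail (Suc a + t) + (\<Sum>j<Suc a. hyb_tail j * gap_tail (Suc a - 1 - j + t)) / 3"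
      if "1 \<le> t" for t
      unfolding D(3)[OF that] U by simp
  qed
qed

text \<open>\<open>H\<close> is the tail sequence of the residual life in the renewal process scanned so far. \<open>L\<close> is that
  of the hybrid process, whose scanned sites are already updated while the others are not.\<close>

definition sweep_inv :: "(nat \<Rightarrow> real) \<Rightarrow> (nat \<Rightarrow> real) \<Rightarrow> bool" where
  "sweep_inv L H \<longleftrightarrow>
     (\<forall>a. (sweep ^^ a) L 0 = H a) \<and>
     (\<forall>a. H (Suc a) \<le> H a) \<and>
     (\<forall>a. (H a - H (Suc a)) / gap_tail a \<le> (H (Suc a) - H (Suc (Suc a))) / gap_tail (Suc a)) \<and>
     (\<forall>a. ((sweep ^^ a) L 0 - (sweep ^^ a) L 1) / hyb_tail a \<le> (H a - H (Suc a)) / gap_tail a)"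

lemma gap_tail_Suc_le: "gap_tail (Suc a) \<le> gap_tail a"
  using gap_tail_pos[of a] mult_left_mono[of "(2 * real a + 1) / (2 * real a + 4)" 1 "gap_tail a"]
  by (simp add: gap_tail.simps(2))

lemma sweep_inv_stat: "sweep_inv stat_tail stat_tail"
proof -
  have "gap_tail a \<noteq> 0" "gap_tail a \<ge> 0" "hyb_tail a \<noteq> 0" for a
    using gap_tail_pos[of a] hyb_tail_ratio[of a] by auto
  moreover have "stat_tail (Suc a) \<le> stat_tail a" for a
    using stat_tail_diff[of a] calculation by (metis diff_ge_0_iff_ge)
  ultimately show ?thesis
    unfolding sweep_inv_def stat_tail_diff sweep_stat_tail[THEN conjunct2, THEN conjunct1]
    using sweep_stat_tail[THEN conjunct1] by simp
qed

text \<open>Tails of the waiting time for the next point of the hybrid process, given a point at the last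
  updated site.\<close>

definition fresh :: "nat \<Rightarrow> real" where
  "fresh t = (if t = 0 then 1 else 2 / 3 * gap_tail t)"

text \<open>As a difference of two consecutive sweeps of \<open>stat_tail\<close>,
  \<open>fresh\<close> can be swept further by \<open>sweep_stat_tail\<close>. Its
  \<open>a\<close>-fold sweep has the value \<open>gap_tail a\<close> at 0, so it matches a fresh
  gap on intervals.\<close>

lemma fresh_eq: "fresh = (\<lambda>t. 1 * stat_tail t + (-1) * sweep stat_tail t)"
proof
  fix t
  show "fresh t = 1 * stat_tail t + (-1) * sweep stat_tail t"
  proof (cases t)
    case 0
    thus ?thesis using sweep_stat_tail[of 1] stat_tail_diff[of 0] by (simp add: fresh_def)
  next
    case (Suc n)
    thus ?thesis using stat_tail_diff[of t] stat_tail_diff[of 0]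
      by (simp add: fresh_def sweep_def damp_def step_def)
  qed
qed

lemma sweep_fresh: "(sweep ^^ a) fresh = (\<lambda>t. (sweep ^^ a) stat_tail t - (sweep ^^ Suc a) stat_tail t)"
  unfolding fresh_eq sweep_pow_linear by (simp only: funpow_Suc_right o_apply mult_1 mult_minus1 diff_conv_add_uminus)

text \<open>\<open>e\<close> is the weight of the scanned site in the original process, 0 if
  occupied and 1 if vacant. The hybrid is swept as over an occupied site, and for a vacant one the
  mass \<open>H 0 - H 1\<close> of renewals at that site is restored in the form
  \<open>fresh\<close>.\<close>

definition update :: "real \<Rightarrow> (nat \<Rightarrow> real) \<Rightarrow> (nat \<Rightarrow> real) \<Rightarrow> nat \<Rightarrow> real" where
  "update e L H t = sweep L t + e * (H 0 - H 1) * fresh t"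

text \<open>The first condition of \<open>sweep_inv\<close>, agreement when the next
  \<open>a\<close> sites are occupied, holds since \<open>fresh\<close> matches
  \<open>gap_tail\<close> on intervals. The last one at \<open>a = 0\<close> reads
  \<open>L 0 - L 1 \<le> H 0 - H 1\<close>, the inequality wanted at vacant sites. For the
  inequalities, each new ratio is a convex combination of an old one and \<open>e * h\<close>, where
  \<open>e * h\<close> is at most every \<open>R a\<close>. The weights \<open>\<kappa>\<close> on
  the old ratios of \<open>H\<close> increase, and the weights \<open>\<omega>\<close> on those of
  the hybrid satisfy \<open>\<omega> \<le> \<kappa>\<close>.\<close>

lemma sweep_inv_update:
  assumes A: "sweep_inv L H" and e: "0 \<le> e" "e \<le> 1"
  shows "sweep_inv (update e L H) (step e H)"
proof -
  define h where "h = H 0 - H 1"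
  define K where "K a = (sweep ^^ a) L" for a
  define R where "R a = (H a - H (Suc a)) / gap_tail a" for a
  have Fpos: "gap_tail a > 0" "gap_tail a \<noteq> 0" for a using gap_tail_pos[of a] by auto
  have Wpos: "hyb_tail a > 0" "hyb_tail a \<noteq> 0" for a using hyb_tail_ratio[of a] by auto
  have K0: "K a 0 = H a" and Hd: "H (Suc a) \<le> H a" and RS: "R a \<le> R (Suc a)"
    and P: "(K a 0 - K a 1) / hyb_tail a \<le> R a" for a
    using A by (auto simp: sweep_inv_def K_def R_def)
  have Rmono: "R a \<le> R b" if "a \<le> b" for a b using RS that by (rule lift_Suc_mono_le)
  have R0: "R 0 = h" by (simp add: R_def h_def)
  have h0: "h \<ge> 0" using Hd[of 0] by (simp add: h_def)
  have eh: "e * h \<le> h" "e * h \<ge> 0" using e h0 mult_right_mono[of e 1 h] by auto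
  have vac: "update e L H = (\<lambda>t. 1 * sweep L t + (e * h) * fresh t)" by (rule ext) (simp add: update_def h_def)
  have pow: "(sweep ^^ a) (update e L H) t =
      K (Suc a) t + e * h * ((sweep ^^ a) stat_tail t - (sweep ^^ Suc a) stat_tail t)" for a t
    unfolding vac sweep_pow_linear sweep_fresh K_def by (simp only: funpow_Suc_right o_apply mult_1)
  have st: "step e H a = H (Suc a) + e * h * gap_tail a" for a by (simp add: step_def h_def)
  have M: "(sweep ^^ a) stat_tail 0 = stat_tail a"
    "(sweep ^^ a) stat_tail 1 = stat_tail a - hyb_tail a" for a
    using sweep_stat_tail[of a] by linarith+
  have pow0: "(sweep ^^ a) (update e L H) 0 = step e H a" for a
    unfolding pow st K0 M stat_tail_diff ..
  have pow01: "(sweep ^^ a) (update e L H) 0 - (sweep ^^ a) (update e L H) 1 =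
      (K (Suc a) 0 - K (Suc a) 1) + e * h * (hyb_tail a - hyb_tail (Suc a))" for a
    unfolding pow M by (simp add: right_diff_distrib)
  define \<kappa> where "\<kappa> a = gap_tail (Suc a) / gap_tail a" for a
  define \<omega> where "\<omega> a = hyb_tail (Suc a) / hyb_tail a" for a
  have ratio: "(step e H a - step e H (Suc a)) / gap_tail a = \<kappa> a * R (Suc a) + e * h * (1 - \<kappa> a)" for a
    using Fpos[of a] Fpos[of "Suc a"] unfolding st R_def \<kappa>_def
    by (simp add: diff_divide_distrib add_divide_distrib right_diff_distrib)
  have \<kappa>1: "\<kappa> a \<le> 1" for a unfolding \<kappa>_def using Fpos[of a] gap_tail_Suc_le[of a] by simp
  have \<kappa>0: "\<kappa> a \<ge> 0" for a unfolding \<kappa>_def using Fpos[of a] Fpos[of "Suc a"] by (auto intro!: divide_nonneg_nonneg)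
  have \<kappa>m: "\<kappa> a \<le> \<kappa> (Suc a)" for a
    unfolding \<kappa>_def using gap_ratio_mono[of a "Suc a"] Fpos[of a] Fpos[of "Suc a"]
    by (simp add: divide_simps mult_ac)
  have \<omega>\<kappa>: "\<omega> a \<le> \<kappa> a" "\<omega> a \<ge> 0" for a
    using hyb_tail_ratio[of a] hyb_tail_ratio[of "Suc a"] Fpos[of a] unfolding \<omega>_def \<kappa>_def
    by (auto simp: frac_le_eq divide_simps)
  have c1: "step e H (Suc a) \<le> step e H a" for a
  proof -
    have "0 \<le> (step e H a - step e H (Suc a)) / gap_tail a"
      unfolding ratio using \<kappa>0[of a] \<kappa>1[of a] eh Rmono[of 0 "Suc a"] R0 eh by (intro add_nonneg_nonneg mult_nonneg_nonneg e) auto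
    thus ?thesis using Fpos[of a] by (simp add: zero_le_divide_iff)
  qed
  have c2: "(step e H a - step e H (Suc a)) / gap_tail a
      \<le> (step e H (Suc a) - step e H (Suc (Suc a))) / gap_tail (Suc a)" for a
  proof -
    have "0 \<le> (\<kappa> (Suc a) - \<kappa> a) * (R (Suc a) - e * h)"
      using \<kappa>m[of a] Rmono[of 0 "Suc a"] R0 eh by (intro mult_nonneg_nonneg) auto
    moreover have "\<kappa> (Suc a) * R (Suc a) \<le> \<kappa> (Suc a) * R (Suc (Suc a))" using RS \<kappa>0 by (intro mult_left_mono)
    ultimately show ?thesis unfolding ratio by (simp add: algebra_simps)
  qed
  have c3: "((sweep ^^ a) (update e L H) 0 - (sweep ^^ a) (update e L H) 1) / hyb_tail a
      \<le> (step e H a - step e H (Suc a)) / gap_tail a" for a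
  proof -
    have "((sweep ^^ a) (update e L H) 0 - (sweep ^^ a) (update e L H) 1) / hyb_tail a
      = \<omega> a * ((K (Suc a) 0 - K (Suc a) 1) / hyb_tail (Suc a)) + e * h * (1 - \<omega> a)"
      unfolding pow01 \<omega>_def using Wpos[of a] Wpos[of "Suc a"]
      by (simp add: add_divide_distrib right_diff_distrib diff_divide_distrib)
    also have "\<dots> \<le> \<omega> a * R (Suc a) + e * h * (1 - \<omega> a)"
      using P[of "Suc a"] \<omega>\<kappa>[of a] by (intro add_right_mono mult_left_mono) auto
    also have "\<dots> \<le> \<kappa> a * R (Suc a) + e * h * (1 - \<kappa> a)"
    proof -
      have "0 \<le> (\<kappa> a - \<omega> a) * (R (Suc a) - e * h)"
        using \<omega>\<kappa>[of a] Rmono[of 0 "Suc a"] R0 eh by (intro mult_nonneg_nonneg) auto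
      thus ?thesis by (simp add: algebra_simps)
    qed
    finally show ?thesis unfolding ratio .
  qed
  show ?thesis unfolding sweep_inv_def using pow0 c1 c2 c3 by blast
qed

text \<open>\<open>b\<close> tells whether the left neighbour is occupied. An occupied site puts a
  factor 1/3 on its own position and on the one to its right, so the next level is longer by one
  site.\<close>

fun edge_weights :: "bool \<Rightarrow> bool list \<Rightarrow> real list" where
  "edge_weights b [] = [if b then 1/3 else 1]"
| "edge_weights b (a # as) = (if b then 1/3 else 1) * (if a then 1/3 else 1) # edge_weights a as"

lemma edge_weights_range: "w \<in> set (edge_weights b as) \<Longrightarrow> 0 \<le> w \<and> w \<le> 1"
  by (induction b as rule: edge_weights.induct) (auto split: if_splits)

lemma val_edge_weights_True: "val L (edge_weights True as) = val (damp L) (edge_weights False as)"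
proof (cases as)
  case (Cons a as')
  have "step (1/3 * (if a then 1/3 else 1)) L = step (1 * (if a then 1/3 else 1)) (damp L)"
    using step_damp[of "if a then 1/3 else 1" L] by (auto simp: field_simps)
  thus ?thesis by (simp add: Cons)
qed (use step_damp[of 1 L] in simp)

lemma val_sweep:
  assumes "sweep_inv L H"
  shows "val L (edge_weights False as) \<le> val H (map (\<lambda>a. if a then 0 else 1) as)"
  using assms
proof (induction as arbitrary: L H)
  case Nil
  thus ?case by (auto simp: step_def sweep_inv_def dest: spec[of _ 0])
next
  case (Cons a as)
  show ?case
  proof (cases a)
    case True
    have "val L (edge_weights False (a # as)) = val (update 0 L H) (edge_weights False as)"
      using True by (simp add: val_edge_weights_True sweep_def update_def[abs_def] fun_eq_iff)
    also have "\<dots> \<le> val (step 0 H) (map (\<lambda>a. if a then 0 else 1) as)"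
      by (intro Cons.IH sweep_inv_update Cons.prems) auto
    finally show ?thesis using True by simp
  next
    case False
    define d where "d = (H 0 - H 1) - (L 0 - L 1)"
    have I: "(sweep ^^ a) L 0 = H a" for a using Cons.prems by (simp add: sweep_inv_def)
    have "d \<ge> 0"
    proof -
      have "((sweep ^^ 0) L 0 - (sweep ^^ 0) L 1) / hyb_tail 0 \<le> (H 0 - H (Suc 0)) / gap_tail 0"
        using Cons.prems unfolding sweep_inv_def by blast
      thus ?thesis by (simp add: d_def)
    qed
    \<comment> \<open>At a vacant site the actual hybrid is \<open>step 1 L\<close>. Passing to
      \<open>update 1 L H\<close> exchanges mass \<open>2/3 * d\<close> from a certain renewal at
      the next site to a fresh gap, which does not lower \<open>val\<close>.\<close>
    have "update 1 L H = (\<lambda>t. 1 * step 1 L t + (2 / 3 * d) * (1 * gap_tail t + (-1) * (if t = 0 then 1 else 0)))"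
    proof
      fix t
      show "update 1 L H t = 1 * step 1 L t + (2 / 3 * d) * (1 * gap_tail t + (-1) * (if t = 0 then 1 else 0))"
      proof (cases t)
        case 0
        have "sweep L 0 = H 1" "L 0 = H 0" using I[of 1] I[of 0] by simp_all
        thus ?thesis unfolding 0 update_def fresh_def step_def d_def by simp
      next
        case (Suc n)
        have "sweep L t = L (Suc t) + (L 0 - L 1) / 3 * gap_tail t"
          using Suc by (simp add: sweep_def damp_def step_def)
        thus ?thesis unfolding update_def fresh_def step_def d_def
          using Suc by (simp add: field_simps)
      qed
    qed
    hence "val (update 1 L H) (edge_weights False as) = val (step 1 L) (edge_weights False as)
       + 2 / 3 * d * (val gap_tail (edge_weights False as) - val (\<lambda>t. if t = 0 then 1 else 0) (edge_weights False as))"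
      by (simp only: val_linear) simp
    moreover have "2 / 3 * d * (val gap_tail (edge_weights False as) - val (\<lambda>t. if t = 0 then 1 else 0) (edge_weights False as)) \<ge> 0"
      using \<open>d \<ge> 0\<close> val_point_le_gap[of "edge_weights False as"] edge_weights_range
      by (intro mult_nonneg_nonneg) auto
    ultimately have "val (step 1 L) (edge_weights False as) \<le> val (update 1 L H) (edge_weights False as)" by simp
    also have "\<dots> \<le> val (step 1 H) (map (\<lambda>a. if a then 0 else 1) as)"
      by (intro Cons.IH sweep_inv_update Cons.prems) auto
    finally show ?thesis using False by simp
  qed
qed

theorem renewal_superharmonic:
  "val stat_tail (edge_weights False as) \<le> val stat_tail (map (\<lambda>a. if a then 0 else 1) as)"
  by (rule val_sweep[OF sweep_inv_stat])

section \<open>Even dimensions\<close>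

lemma val_affine:
  "distinct xs \<Longrightarrow> val L (map (u(y := c * u y)) xs) =
     c * val L (map u xs) + (1 - c) * val L (map (u(y := 0)) xs)"
proof (induction xs arbitrary: L)
  case (Cons x xs)
  show ?case
  proof (cases "x = y")
    case True
    hence "map (u(y := b)) (x # xs) = b # map u xs" for b using Cons.prems by auto
    moreover have "step (c * u y) L = (\<lambda>t. c * step (u y) L t + (1 - c) * step 0 L t)"
      by (rule ext) (simp add: step_def algebra_simps)
    moreover have "map u (x # xs) = u y # map u xs" using True by simp
    ultimately show ?thesis by (simp only: val.simps val_linear)
  qed (use Cons in simp)
qed (simp add: algebra_simps)

text \<open>The sites being distinct, \<open>val\<close> is affine in the weight of each one.
  Averaging over one arc therefore multiplies the weight at its endpoint by \<open>1 - s\<close>,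
  and the arcs can be treated one after the other.\<close>

lemma bernoulli_exp_val:
  assumes "finite J" "distinct xs"
  shows "bernoulli_exp s J (\<lambda>S. val L (map (\<lambda>x. u x * of_bool (x \<notin> \<tau> ` S)) xs)) =
    val L (map (\<lambda>x. u x * (1 - s) ^ card {e\<in>J. \<tau> e = x}) xs)"
  using assms(1)
proof (induction J arbitrary: u rule: finite_induct)
  case (insert e J)
  define g where "g x = u x * (1 - s) ^ card {e\<in>J. \<tau> e = x}" for x
  have c: "card {e'\<in>insert e J. \<tau> e' = x} = card {e'\<in>J. \<tau> e' = x} + of_bool (x = \<tau> e)" for x
  proof (cases "x = \<tau> e")
    case True
    hence "{e'\<in>insert e J. \<tau> e' = x} = insert e {e'\<in>J. \<tau> e' = x}" by auto
    thus ?thesis using True insert by simp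
  next
    case False
    hence "{e'\<in>insert e J. \<tau> e' = x} = {e'\<in>J. \<tau> e' = x}" by auto
    thus ?thesis using False by simp
  qed
  have a: "bernoulli_exp s J (\<lambda>S. val L (map (\<lambda>x. u x * of_bool (x \<notin> \<tau> ` insert e S)) xs)) =
      bernoulli_exp s J (\<lambda>S. val L (map (\<lambda>x. (u(\<tau> e := 0)) x * of_bool (x \<notin> \<tau> ` S)) xs))"
    by (intro bernoulli_exp_cong arg_cong[of _ _ "val L"] map_cong) auto
  have "bernoulli_exp s (insert e J) (\<lambda>S. val L (map (\<lambda>x. u x * of_bool (x \<notin> \<tau> ` S)) xs)) =
    s * val L (map (\<lambda>x. (u(\<tau> e := 0)) x * (1 - s) ^ card {e\<in>J. \<tau> e = x}) xs) + (1 - s) * val L (map g xs)"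
    unfolding bernoulli_exp_insert[OF insert.hyps] a insert.IH g_def ..
  also have "(\<lambda>x. (u(\<tau> e := 0)) x * (1 - s) ^ card {e\<in>J. \<tau> e = x}) = g(\<tau> e := 0)"
    by (auto simp: g_def fun_eq_iff)
  also have "s * val L (map (g(\<tau> e := 0)) xs) + (1 - s) * val L (map g xs) =
     val L (map (g(\<tau> e := (1 - s) * g (\<tau> e))) xs)"
    by (subst val_affine[OF assms(2)]) simp
  also have "g(\<tau> e := (1 - s) * g (\<tau> e)) = (\<lambda>x. u x * (1 - s) ^ card {e'\<in>insert e J. \<tau> e' = x})"
    by (rule ext) (simp only: c, simp add: g_def)
  finally show ?case .
qed simp

definition decreasing_tail :: "(nat \<Rightarrow> real) \<Rightarrow> bool" where
  "decreasing_tail L \<longleftrightarrow> (\<forall>t. 0 \<le> L t \<and> L (Suc t) \<le> L t)"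

lemma decreasing_gap_tail: "decreasing_tail gap_tail"
  using gap_tail_pos gap_tail_Suc_le by (auto simp: decreasing_tail_def intro: less_imp_le)

lemma decreasing_stat_tail: "decreasing_tail stat_tail"
proof -
  have "stat_tail t \<ge> 0" for t using gap_tail_pos[of t] by (simp add: stat_tail_def)
  moreover have "stat_tail (Suc t) \<le> stat_tail t" for t
    using stat_tail_diff[of t] gap_tail_pos[of t] by linarith
  ultimately show ?thesis by (simp add: decreasing_tail_def)
qed

lemma decreasing_step: "decreasing_tail L \<Longrightarrow> 0 \<le> w \<Longrightarrow> decreasing_tail (step w L)"
  unfolding decreasing_tail_def step_def using gap_tail_pos gap_tail_Suc_le
  by (auto intro!: add_nonneg_nonneg mult_nonneg_nonneg add_mono mult_left_mono intro: less_imp_le)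

lemma val_nonneg: "decreasing_tail L \<Longrightarrow> \<forall>w\<in>set ws. 0 \<le> w \<Longrightarrow> 0 \<le> val L ws"
proof (induction ws arbitrary: L)
  case (Cons w ws)
  thus ?case using decreasing_step[of L w] by simp
qed (simp add: decreasing_tail_def)

lemma val_mono:
  "decreasing_tail L \<Longrightarrow> (\<And>x. x \<in> set xs \<Longrightarrow> 0 \<le> u x \<and> u x \<le> u' x) \<Longrightarrow> val L (map u xs) \<le> val L (map u' xs)"
proof (induction xs arbitrary: L)
  case (Cons x xs)
  have u: "0 \<le> u x" "u x \<le> u' x" "0 \<le> u' x" using Cons.prems(2)[of x] by auto
  have "step (u' x) L = (\<lambda>t. 1 * step (u x) L t + (u' x - u x) * (L 0 - L 1) * gap_tail t)"
    by (rule ext) (simp add: step_def algebra_simps)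
  hence "val (step (u' x) L) (map u xs) =
      val (step (u x) L) (map u xs) + (u' x - u x) * (L 0 - L 1) * val gap_tail (map u xs)"
    using val_linear[of 1 "step (u x) L" "(u' x - u x) * (L 0 - L 1)" gap_tail] by simp
  moreover have "(u' x - u x) * (L 0 - L 1) * val gap_tail (map u xs) \<ge> 0"
    using u Cons.prems by (intro mult_nonneg_nonneg val_nonneg decreasing_gap_tail) (auto simp: decreasing_tail_def)
  ultimately have "val (step (u x) L) (map u xs) \<le> val (step (u' x) L) (map u xs)" by simp
  also have "\<dots> \<le> val (step (u' x) L) (map u' xs)"
    using Cons.prems u by (intro Cons.IH decreasing_step) auto
  finally show ?case by simp
qed simp

lemma edge_weights_nth:
  "x \<le> length as \<Longrightarrow> edge_weights b as ! x =
     (if (if x = 0 then b else as ! (x - 1)) then 1/3 else 1) * (if x < length as \<and> as ! x then 1/3 else 1)"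
proof (induction b as arbitrary: x rule: edge_weights.induct)
  case (2 b a as)
  thus ?case by (cases x) (simp_all add: nth_Cons')
qed auto

lemma length_edge_weights: "length (edge_weights b as) = Suc (length as)"
  by (induction b as rule: edge_weights.induct) auto

text \<open>\<open>stat_tail\<close> is invariant under \<open>step 1\<close>, that is, stationary.
  Its total mass 2 is the mean gap; this is the divisor that turns \<open>val stat_tail\<close> into
  a probability.\<close>

lemma val_stat_ones: "val stat_tail (map (\<lambda>_. 1) xs) = 2"
proof -
  have "step 1 stat_tail = stat_tail"
  proof
    fix t show "step 1 stat_tail t = stat_tail t"
      unfolding step_def using stat_tail_diff[of 0] stat_tail_diff[of t] by simp
  qed
  hence "val stat_tail (map (\<lambda>_. 1) xs) = stat_tail 0" by (induction xs) auto
  thus ?thesis by (simp add: stat_tail_def)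
qed

text \<open>The set reached from \<open>A\<close> misses each site independently, so that averaging turns the indicator
  weights into products over incoming edges, to which \<open>renewal_superharmonic\<close> applies.\<close>

lemma surv_two_dim:
  assumes s: "2/3 \<le> s" "s \<le> 1"
  shows "finite A \<Longrightarrow> (\<And>v. v \<in> A \<Longrightarrow> 0 \<le> v 0 \<and> v 0 < int N) \<Longrightarrow>
    1 - val stat_tail (map (\<lambda>x. of_bool (x \<notin> (\<lambda>v. nat (v 0)) ` A)) [0..<N]) / 2 \<le> surv s 2 n A"
proof (induction n arbitrary: A N)
  case 0
  show ?case
  proof (cases "A = {}")
    case True
    thus ?thesis using val_stat_ones[of "[0..<N]"] by simp
  next
    case False
    have "0 \<le> val stat_tail (map (\<lambda>x. of_bool (x \<notin> (\<lambda>v. nat (v 0)) ` A)) [0..<N])"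
      by (intro val_nonneg decreasing_stat_tail) auto
    thus ?thesis using False by simp
  qed
next
  case (Suc n)
  define X where "X = (\<lambda>v. nat (v 0)) ` A"
  define J where "J = A \<times> {..<2::nat}"
  define \<tau> where "\<tau> e = nat (tgt e 0)" for e
  have fJ: "finite J" using Suc.prems by (simp add: J_def)
  have XN: "x < N" if "x \<in> X" for x using Suc.prems(2) that by (force simp: X_def)
  have tg: "nat (tgt (v, i) 0) = nat (v 0) + of_bool (i = 0)" "0 \<le> tgt (v, i) 0" "tgt (v, i) 0 < int (Suc N)"
    if "v \<in> A" for v i using Suc.prems(2)[OF that] by (auto simp: tgt_def unit_vec_def)
  define as where "as = map (\<lambda>x. x \<in> X) [0..<N]"
  have "val stat_tail (map (\<lambda>x. 1 * (1 - s) ^ card {e\<in>J. \<tau> e = x}) [0..<Suc N])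
      \<le> val stat_tail (map (\<lambda>x. edge_weights False as ! x) [0..<Suc N])"
  proof (intro val_mono decreasing_stat_tail conjI)
    fix x assume "x \<in> set [0..<Suc N]"
    hence x: "x \<le> N" by auto
    define a where "a = (x \<in> X)"
    define b where "b = (x > 0 \<and> x - 1 \<in> X)"
    \<comment> \<open>An arc enters \<open>x\<close> from \<open>x\<close> in direction 1 and from
      \<open>x - 1\<close> in direction 0. Several vertices of \<open>A\<close> may share a first
      coordinate, so the number of arcs is bounded from below only.\<close>
    have "of_bool a + of_bool b \<le> card {e\<in>J. \<tau> e = x}"
    proof -
      have 1: "\<exists>v\<in>A. (v, 1) \<in> {e\<in>J. \<tau> e = x}" if a
        using that tg by (auto simp: a_def X_def J_def \<tau>_def)
      have 2: "\<exists>v\<in>A. (v, 0) \<in> {e\<in>J. \<tau> e = x}" if b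
      proof -
        from that obtain v where "v \<in> A" "x - 1 = nat (v 0)" "x > 0" by (auto simp: b_def X_def)
        thus ?thesis using tg[of v 0] by (intro bexI[of _ v]) (auto simp: J_def \<tau>_def)
      qed
      have f: "finite {e\<in>J. \<tau> e = x}" using fJ by simp
      show ?thesis
      proof (cases a; cases b)
        assume "a" "b"
        with 1 2 obtain v w where "{(v, 1), (w, 0)} \<subseteq> {e\<in>J. \<tau> e = x}" by auto
        from card_mono[OF f this] \<open>a\<close> \<open>b\<close> show ?thesis by simp
      next
        assume "a" "\<not> b"
        with 1 have "{e\<in>J. \<tau> e = x} \<noteq> {}" by auto
        thus ?thesis using f \<open>a\<close> \<open>\<not> b\<close> by (simp add: Suc_le_eq card_gt_0_iff)
      next
        assume "\<not> a" "b"
        with 2 have "{e\<in>J. \<tau> e = x} \<noteq> {}" by auto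
        thus ?thesis using f \<open>\<not> a\<close> \<open>b\<close> by (simp add: Suc_le_eq card_gt_0_iff)
      qed simp
    qed
    hence "(1 - s) ^ card {e\<in>J. \<tau> e = x} \<le> (1 - s) ^ (of_bool a + of_bool b)"
      using s by (intro power_decreasing) auto
    also have "\<dots> \<le> (1/3) ^ (of_bool a + of_bool b)" using s by (intro power_mono) auto
    also have "\<dots> = edge_weights False as ! x"
      using x XN[of x] by (subst edge_weights_nth) (auto simp: as_def a_def b_def power2_eq_square)
    finally show "1 * (1 - s) ^ card {e\<in>J. \<tau> e = x} \<le> edge_weights False as ! x" by simp
    show "0 \<le> 1 * (1 - s) ^ card {e\<in>J. \<tau> e = x}" using s by simp
  qed
  also have "map (\<lambda>x. edge_weights False as ! x) [0..<Suc N] = edge_weights False as"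
    using map_nth[of "edge_weights False as"] by (simp add: length_edge_weights as_def)
  also have "val stat_tail (edge_weights False as) \<le> val stat_tail (map (\<lambda>a. if a then 0 else 1) as)"
    by (rule renewal_superharmonic)
  also have "map (\<lambda>a. if a then 0 else 1) as = map (\<lambda>x. of_bool (x \<notin> X)) [0..<N]"
    by (simp add: as_def)
  finally have main: "val stat_tail (map (\<lambda>x. 1 * (1 - s) ^ card {e\<in>J. \<tau> e = x}) [0..<Suc N])
     \<le> val stat_tail (map (\<lambda>x. of_bool (x \<notin> X)) [0..<N])" .
  have "1 - val stat_tail (map (\<lambda>x. of_bool (x \<notin> X)) [0..<N]) / 2 \<le>
     1 - val stat_tail (map (\<lambda>x. 1 * (1 - s) ^ card {e\<in>J. \<tau> e = x}) [0..<Suc N]) / 2"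
    using main by simp
  also have "\<dots> = 1 - bernoulli_exp s J (\<lambda>S. val stat_tail (map (\<lambda>x. 1 * of_bool (x \<notin> \<tau> ` S)) [0..<Suc N])) / 2"
    by (subst bernoulli_exp_val[OF fJ]) auto
  also have "\<dots> = bernoulli_exp s J (\<lambda>S. 1 + (- 1/2) * val stat_tail (map (\<lambda>x. 1 * of_bool (x \<notin> \<tau> ` S)) [0..<Suc N]))"
    unfolding bernoulli_exp_add bernoulli_exp_cmult using fJ by (simp add: bernoulli_exp_const)
  also have "\<dots> \<le> bernoulli_exp s J (\<lambda>S. surv s 2 n (tgt ` S))"
  proof (intro bernoulli_exp_mono)
    fix S assume S: "S \<subseteq> J"
    have "(\<lambda>v. nat (v 0)) ` tgt ` S = \<tau> ` S" by (simp add: image_image \<tau>_def)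
    moreover have "1 - val stat_tail (map (\<lambda>x. of_bool (x \<notin> (\<lambda>v. nat (v 0)) ` tgt ` S)) [0..<Suc N]) / 2
        \<le> surv s 2 n (tgt ` S)"
      using S fJ tg(2,3) by (intro Suc.IH) (auto simp: J_def dest: finite_subset)
    ultimately show "1 + (- 1/2) * val stat_tail (map (\<lambda>x. 1 * of_bool (x \<notin> \<tau> ` S)) [0..<Suc N]) \<le> surv s 2 n (tgt ` S)"
      by simp
  qed (use s in auto)
  finally show ?case by (simp add: J_def X_def)
qed

text \<open>The stationary process avoids a single site with probability
  \<open>stat_tail 1 / stat_tail 0 = 1/2\<close>.\<close>

lemma surv_two_dim_origin:
  assumes s: "2/3 \<le> s" "s \<le> 1"
  shows "1/2 \<le> surv s 2 n {origin}"
proof -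
  have "val stat_tail (map (\<lambda>x. of_bool (x \<notin> (\<lambda>v. nat (v 0)) ` {origin})) [0..<1]) = 1"
    using stat_tail_diff[of 0] gap_tail.simps(2)[of 0]
    by (simp add: origin_def step_def stat_tail_def)
  thus ?thesis using surv_two_dim[OF s, of "{origin}" 1 n] by (simp add: origin_def)
qed

section \<open>Folding an even dimension onto the square lattice\<close>

lemma bernoulli_exp_nonempty:
  "finite J \<Longrightarrow> bernoulli_exp p J (\<lambda>S. g (S \<noteq> {})) = (1 - p) ^ card J * g False + (1 - (1 - p) ^ card J) * g True"
proof (induction J rule: finite_induct)
  case (insert e J)
  thus ?case by (simp add: bernoulli_exp_insert bernoulli_exp_const) (simp add: algebra_simps)
qed simp

lemma bernoulli_exp_out_edges:
  "bernoulli_exp p (out_edges d u) (\<lambda>S. \<phi> (out_open d u S)) = bernoulli_exp p {..<d} (\<lambda>S. \<phi> ((\<lambda>i. tgt (u, i)) ` S))"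
proof -
  have inj: "inj_on (\<lambda>i. arc_edge (u, i)) {..<d}"
    using inj_arc_edge by (auto simp: inj_on_def dest: injD)
  have "bernoulli_exp p (out_edges d u) (\<lambda>S. \<phi> (out_open d u S)) =
    bernoulli_exp p {..<d} (\<lambda>S. \<phi> (out_open d u ((\<lambda>i. arc_edge (u, i)) ` S)))"
    unfolding out_edges_def image_image by (rule bernoulli_exp_image[OF _ inj]) simp
  also have "\<dots> = bernoulli_exp p {..<d} (\<lambda>S. \<phi> ((\<lambda>i. tgt (u, i)) ` S))"
  proof (intro bernoulli_exp_cong arg_cong[of _ _ \<phi>])
    fix S assume "S \<subseteq> {..<d}"
    moreover from this have "arc_edge (u, i) \<in> (\<lambda>i. arc_edge (u, i)) ` S \<longleftrightarrow> i \<in> S" for i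
      by (auto dest: injD[OF inj_arc_edge])
    ultimately show "out_open d u ((\<lambda>i. arc_edge (u, i)) ` S) = (\<lambda>i. tgt (u, i)) ` S"
      by (auto simp: out_open_def)
  qed
  finally show ?thesis .
qed

definition fold_half :: "nat \<Rightarrow> vertex \<Rightarrow> vertex" where
  "fold_half m v = (\<lambda>k. if k = 0 then \<Sum>j<m. v j else if k = 1 then \<Sum>j=m..<2*m. v j else 0)"

lemma fold_half_tgt: "j < 2 * m \<Longrightarrow> fold_half m (tgt (v, j)) = tgt (fold_half m v, if j < m then 0 else 1)"
  by (rule ext) (auto simp: fold_half_def tgt_def unit_vec_def sum.distrib)

lemma fold_half_exploration: "exploration (out_edges (2*m)) (out_open (2*m)) (fold_half m) (Zd (2*m)) 2"
proof
  fix u v S u'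
  assume u: "u \<in> Zd (2*m)"
  show "finite (out_edges (2*m) u)" "finite (out_open (2*m) u S)" using u direct.finite_E by auto
  show "out_open (2*m) u S \<subseteq> Zd (2*m)" if "S \<subseteq> out_edges (2*m) u" using u that by (rule direct.Sc_V)
  show "\<exists>i<2. fold_half m u' = tgt (fold_half m u, i)" if "u' \<in> out_open (2*m) u S"
  proof -
    from that obtain j where "j < 2 * m" "u' = tgt (u, j)" by (auto simp: out_open_def)
    thus ?thesis using fold_half_tgt[of j m u] by (intro exI[of _ "if j < m then 0 else 1"]) simp
  qed
  show "out_edges (2*m) u \<inter> out_edges (2*m) v = {}" if "v \<in> Zd (2*m)" "fold_half m u \<noteq> fold_half m v"
    using that u by (intro direct.disj) auto
qed

text \<open>The \<open>m\<close> arcs of one half all project to the same arc of the square lattice,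
  and at least one is open with probability \<open>1 - (1 - p) ^ m\<close>. The halves use disjoint
  arcs, so even equality holds.\<close>

lemma fold_half_dominates:
  assumes p: "0 \<le> p" "p \<le> 1"
  shows "dominating_exploration (out_edges (2*m)) (out_open (2*m)) (fold_half m) (Zd (2*m)) 2 p (1 - (1 - p) ^ m)"
proof -
  define s where "s = 1 - (1 - p) ^ m"
  have s: "0 \<le> s" "s \<le> 1" using p by (auto simp: s_def power_le_one)
  show ?thesis unfolding s_def[symmetric]
  proof (intro dominating_exploration.intro fold_half_exploration dominating_exploration_axioms.intro p s)
    fix u :: vertex and \<phi> :: "nat set \<Rightarrow> real"
    define g where "g a b = \<phi> ((if a then {0} else {}) \<union> (if b then {1::nat} else {}))" for a b
    define h where "h = (\<lambda>j. if j < m then 0 else 1::nat)"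
    have "bernoulli_exp p (out_edges (2*m) u) (\<lambda>S. \<phi> {i. i < 2 \<and> tgt (fold_half m u, i) \<in> fold_half m ` out_open (2*m) u S})
      = bernoulli_exp p {..<2*m} (\<lambda>S. \<phi> {i. i < 2 \<and> tgt (fold_half m u, i) \<in> fold_half m ` (\<lambda>j. tgt (u, j)) ` S})"
      by (rule bernoulli_exp_out_edges)
    also have "\<dots> = bernoulli_exp p ({..<m} \<union> {m..<2*m}) (\<lambda>S. \<phi> (h ` S))"
    proof -
      have "{i. i < 2 \<and> tgt (fold_half m u, i) \<in> fold_half m ` (\<lambda>j. tgt (u, j)) ` S} = h ` S"
        if "S \<subseteq> {..<2*m}" for S
      proof -
        have "fold_half m ` (\<lambda>j. tgt (u, j)) ` S = (\<lambda>j. tgt (fold_half m u, h j)) ` S"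
          unfolding image_image using that fold_half_tgt by (intro image_cong) (auto simp: h_def)
        thus ?thesis using tgt_eq_iff by (auto simp: h_def)
      qed
      moreover have "{..<2*m} = {..<m} \<union> {m..<2*m}" by auto
      ultimately show ?thesis by (simp only:, intro bernoulli_exp_cong arg_cong[of _ _ \<phi>]) (simp only:)
    qed
    also have "\<dots> = bernoulli_exp p {..<m} (\<lambda>S. bernoulli_exp p {m..<2*m} (\<lambda>T. \<phi> (h ` (S \<union> T))))"
      by (intro bernoulli_exp_Un) auto
    also have "\<dots> = bernoulli_exp p {..<m} (\<lambda>S. bernoulli_exp p {m..<2*m} (\<lambda>T. g (S \<noteq> {}) (T \<noteq> {})))"
    proof (intro bernoulli_exp_cong)
      fix S T assume "S \<subseteq> {..<m}" "T \<subseteq> {m..<2*m}"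
      hence "h ` S = (\<lambda>_. 0) ` S" "h ` T = (\<lambda>_. 1) ` T"
        by (intro image_cong refl; force simp: h_def)+
      hence "h ` S = (if S \<noteq> {} then {0} else {})" "h ` T = (if T \<noteq> {} then {1} else {})"
        by (simp_all add: image_constant_conv)
      thus "\<phi> (h ` (S \<union> T)) = g (S \<noteq> {}) (T \<noteq> {})" by (simp add: g_def image_Un)
    qed
    also have "\<dots> = (1 - s) * ((1 - s) * g False False + s * g False True)
       + s * ((1 - s) * g True False + s * g True True)"
      using bernoulli_exp_nonempty[of "{m..<2*m}" p "g b" for b]
        bernoulli_exp_nonempty[of "{..<m}" p "\<lambda>b. bernoulli_exp p {m..<2*m} (\<lambda>T. g b (T \<noteq> {}))"]
      by (simp add: s_def)
    also have "\<dots> = bernoulli_exp s {..<2} \<phi>"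
    proof -
      have "{..<2::nat} = insert 0 (insert 1 {})" by auto
      thus ?thesis by (simp add: bernoulli_exp_insert g_def algebra_simps insert_commute)
    qed
    finally show "bernoulli_exp s {..<2} \<phi> \<le> bernoulli_exp p (out_edges (2*m) u)
        (\<lambda>S. \<phi> {i. i < 2 \<and> tgt (fold_half m u, i) \<in> fold_half m ` out_open (2*m) u S})" by simp
  qed
qed

lemma out_open_step: "u' \<in> out_open d u (S \<inter> X) \<Longrightarrow> (open_step d S)\<^sup>*\<^sup>* u u'"
  by (auto simp: out_open_def open_step_def intro!: r_into_rtranclp)

theorem oriented_pc_even:
  assumes "m \<ge> 1"
  shows "oriented_pc (2 * m) \<le> 1 - (1 / 3) powr (1 / real m)"
proof (rule oriented_pc_le)
  fix p :: real assume pp: "0 \<le> p" "p \<le> 1" "1 - (1 / 3) powr (1 / real m) < p"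
  define s where "s = 1 - (1 - p) ^ m"
  interpret dominating_exploration "out_edges (2*m)" "out_open (2*m)" "fold_half m" "Zd (2*m)" 2 p s
    unfolding s_def by (rule fold_half_dominates[OF pp(1,2)])
  define r :: real where "r = (1 / 3) powr (1 / real m)"
  have "1 - p \<le> r" "0 \<le> 1 - p" using pp unfolding r_def by linarith+
  hence "(1 - p) ^ m \<le> ((1 / 3) powr (1 / real m)) ^ m" unfolding r_def by (rule power_mono)
  also have "\<dots> = 1 / 3" using assms by (simp add: powr_realpow[symmetric] powr_powr)
  finally have s23: "2/3 \<le> s" by (simp add: s_def)
  have o: "fold_half m origin = origin" by (rule ext) (simp add: fold_half_def origin_def)
  have "1/2 \<le> oriented_theta (2*m) p"
  proof (rule theta_ge_run[OF exploration_axioms out_edges_subset origin_Zd p(1,2) _ out_open_step])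
    show "level 2 (fold_half m origin) = 0" by (simp add: o)
    fix n
    have "1/2 \<le> surv s 2 n {origin}" by (rule surv_two_dim_origin[OF s23 s(2)])
    also have "\<dots> = surv s 2 n (fold_half m ` {origin})" by (simp add: o)
    also have "\<dots> \<le> bernoulli_exp p (explored n {origin}) (\<lambda>S. of_bool (run n {origin} S \<noteq> {}))"
      by (intro surv_le_run[where m = 0] finite_explored) (auto simp: o)
    finally show "1/2 \<le> bernoulli_exp p (explored n {origin}) (\<lambda>S. of_bool (run n {origin} S \<noteq> {}))" .
  qed
  thus "0 < oriented_theta (2*m) p" by simp
qed

section \<open>Adding one dimension\<close>

lemma bernoulli_exp_Int:
  "finite K \<Longrightarrow> bernoulli_exp r K (\<lambda>R. bernoulli_exp s K (\<lambda>X. f (R \<inter> X))) = bernoulli_exp (r * s) K f"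
proof (induction K arbitrary: f rule: finite_induct)
  case (insert e K)
  have 1: "bernoulli_exp s (insert e K) (\<lambda>X. f (insert e R \<inter> X)) =
      s * bernoulli_exp s K (\<lambda>X. f (insert e (R \<inter> X))) + (1 - s) * bernoulli_exp s K (\<lambda>X. f (R \<inter> X))" for R
  proof -
    have "bernoulli_exp s K (\<lambda>X. f (insert e R \<inter> X)) = bernoulli_exp s K (\<lambda>X. f (R \<inter> X))"
      using insert.hyps by (intro bernoulli_exp_cong arg_cong[of _ _ f]) auto
    thus ?thesis using insert.hyps by (simp add: bernoulli_exp_insert)
  qed
  have 2: "bernoulli_exp s (insert e K) (\<lambda>X. f (R \<inter> X)) = bernoulli_exp s K (\<lambda>X. f (R \<inter> X))" if "R \<subseteq> K" for R
  proof -
    have "bernoulli_exp s K (\<lambda>X. f (R \<inter> insert e X)) = bernoulli_exp s K (\<lambda>X. f (R \<inter> X))"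
      using insert.hyps that by (intro bernoulli_exp_cong arg_cong[of _ _ f]) auto
    thus ?thesis using insert.hyps by (simp add: bernoulli_exp_insert algebra_simps)
  qed
  have "bernoulli_exp r (insert e K) (\<lambda>R. bernoulli_exp s (insert e K) (\<lambda>X. f (R \<inter> X)))
    = r * bernoulli_exp r K (\<lambda>R. s * bernoulli_exp s K (\<lambda>X. f (insert e (R \<inter> X))) + (1 - s) * bernoulli_exp s K (\<lambda>X. f (R \<inter> X)))
      + (1 - r) * bernoulli_exp r K (\<lambda>R. bernoulli_exp s (insert e K) (\<lambda>X. f (R \<inter> X)))"
    unfolding bernoulli_exp_insert[OF insert.hyps, of r] 1 ..
  also have "bernoulli_exp r K (\<lambda>R. bernoulli_exp s (insert e K) (\<lambda>X. f (R \<inter> X))) = bernoulli_exp (r * s) K f"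
    using 2 insert.IH by (simp cong: bernoulli_exp_cong)
  also have "bernoulli_exp r K (\<lambda>R. s * bernoulli_exp s K (\<lambda>X. f (insert e (R \<inter> X))) + (1 - s) * bernoulli_exp s K (\<lambda>X. f (R \<inter> X)))
    = s * bernoulli_exp (r * s) K (\<lambda>S. f (insert e S)) + (1 - s) * bernoulli_exp (r * s) K f"
    unfolding bernoulli_exp_add bernoulli_exp_cmult insert.IH[of f] insert.IH[of "\<lambda>S. f (insert e S)"] ..
  finally show ?case unfolding bernoulli_exp_insert[OF insert.hyps, of "r * s"] by (simp add: algebra_simps)
qed simp

lemma bernoulli_exp_union:
  "finite K \<Longrightarrow> bernoulli_exp r K (\<lambda>R. bernoulli_exp s K (\<lambda>X. f (R \<union> X))) = bernoulli_exp (1 - (1 - r) * (1 - s)) K f"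
proof (induction K arbitrary: f rule: finite_induct)
  case (insert e K)
  have 1: "bernoulli_exp s (insert e K) (\<lambda>X. f (insert e R \<union> X)) = bernoulli_exp s K (\<lambda>X. f (insert e (R \<union> X)))" for R
    using insert.hyps by (simp add: bernoulli_exp_insert algebra_simps)
  have 2: "bernoulli_exp s (insert e K) (\<lambda>X. f (R \<union> X)) =
      s * bernoulli_exp s K (\<lambda>X. f (insert e (R \<union> X))) + (1 - s) * bernoulli_exp s K (\<lambda>X. f (R \<union> X))" for R
    using insert.hyps by (simp add: bernoulli_exp_insert)
  have 3: "bernoulli_exp r K (\<lambda>R. bernoulli_exp s K (\<lambda>X. f (insert e (R \<union> X)))) =
      bernoulli_exp (1 - (1 - r) * (1 - s)) K (\<lambda>S. f (insert e S))" by (rule insert.IH)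
  show ?case
    unfolding bernoulli_exp_insert[OF insert.hyps, of r] 1
    unfolding 2 bernoulli_exp_add bernoulli_exp_cmult
      insert.IH[of f] 3 bernoulli_exp_insert[OF insert.hyps, of "1 - (1 - r) * (1 - s)"]
    by (simp add: algebra_simps)
qed simp

section \<open>Exploration of a column\<close>

definition drop_top :: "nat \<Rightarrow> vertex \<Rightarrow> vertex" where
  "drop_top d u = u(d := 0)"

lemma drop_top_tgt: "i < d \<Longrightarrow> drop_top d (tgt (u, i)) = tgt (drop_top d u, i)"
  by (rule ext) (auto simp: drop_top_def tgt_def unit_vec_def)

lemma drop_top_up: "drop_top d (tgt (u, d)) = drop_top d u"
  by (rule ext) (auto simp: drop_top_def tgt_def unit_vec_def)

lemma tgt_top: "tgt (u, i) d = u d + of_bool (i = d)"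
  by (auto simp: tgt_def unit_vec_def)

text \<open>From \<open>u\<close> we climb in direction \<open>d\<close> through at most \<open>H\<close> open edges and leave in the directions
  below \<open>d\<close>.\<close>

primrec col_edges :: "nat \<Rightarrow> nat \<Rightarrow> vertex \<Rightarrow> edge set" where
  "col_edges d 0 u = out_edges d u"
| "col_edges d (Suc H) u = out_edges d u \<union> (insert (arc_edge (u, d)) (col_edges d H (tgt (u, d))))"

primrec col_open :: "nat \<Rightarrow> nat \<Rightarrow> vertex \<Rightarrow> edge set \<Rightarrow> vertex set" where
  "col_open d 0 u S = out_open d u S"
| "col_open d (Suc H) u S = out_open d u S \<union> (if arc_edge (u, d) \<in> S then col_open d H (tgt (u, d)) S else {})"

text \<open>The projection of \<open>w\<close> separates different columns. The height bound
  \<open>u d \<le> w d\<close> separates the edges leaving \<open>u\<close> from those examined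
  after climbing.\<close>

lemma col_edges_arc:
  "e \<in> col_edges d H u \<Longrightarrow> \<exists>w i. e = arc_edge (w, i) \<and> i \<le> d \<and> drop_top d w = drop_top d u \<and> u d \<le> w d"
proof (induction H arbitrary: u)
  case 0
  thus ?case by (force simp: out_edges_def)
next
  case (Suc H)
  consider i where "i \<le> d" "e = arc_edge (u, i)" | "e \<in> col_edges d H (tgt (u, d))"
  proof -
    from Suc.prems consider "e \<in> out_edges d u" | "e = arc_edge (u, d)" | "e \<in> col_edges d H (tgt (u, d))" by auto
    thus ?thesis
    proof cases
      case 1
      then obtain i where "i < d" "e = arc_edge (u, i)" by (auto simp: out_edges_def)
      thus ?thesis using that(1)[of i] by simp
    qed (use that in auto)
  qed
  thus ?case
  proof cases
    case 2
    from Suc.IH[OF this] obtain w i where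
      w: "e = arc_edge (w, i)" "i \<le> d" "drop_top d w = drop_top d (tgt (u, d))" "tgt (u, d) d \<le> w d"
      by blast
    have "drop_top d w = drop_top d u" "u d \<le> w d" using w(3,4) drop_top_up[of d u] tgt_top[of u d d] by simp_all
    with w(1,2) have "e = arc_edge (w, i)" "i \<le> d" "drop_top d w = drop_top d u" "u d \<le> w d" by simp_all
    thus ?thesis by blast
  qed blast
qed

lemma col_open_tgt: "u' \<in> col_open d H u S \<Longrightarrow> \<exists>w i. i < d \<and> u' = tgt (w, i) \<and> drop_top d w = drop_top d u"
proof (induction H arbitrary: u)
  case (Suc H)
  show ?case
  proof (cases "u' \<in> out_open d u S")
    case False
    hence "u' \<in> col_open d H (tgt (u, d)) S" using Suc.prems by (auto split: if_splits)
    from Suc.IH[OF this] show ?thesis by (simp add: drop_top_up)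
  qed (auto simp: out_open_def)
qed (auto simp: out_open_def)

lemma finite_col_edges: "finite (col_edges d H u)"
  by (induction H arbitrary: u) (auto simp: out_edges_def)

lemma finite_col_open: "finite (col_open d H u S)"
  by (induction H arbitrary: u) auto

lemma out_open_Zd: "u \<in> Zd (Suc d) \<Longrightarrow> out_open d u S \<subseteq> Zd (Suc d)"
  by (auto simp: out_open_def intro!: tgt_Zd)

lemma col_open_Zd: "u \<in> Zd (Suc d) \<Longrightarrow> col_open d H u S \<subseteq> Zd (Suc d)"
proof (induction H arbitrary: u)
  case (Suc H)
  from Suc.IH[OF tgt_Zd[OF Suc.prems]] out_open_Zd[OF Suc.prems] show ?case by simp
qed (simp add: out_open_Zd)

lemma col_edges_subset: "u \<in> Zd (Suc d) \<Longrightarrow> col_edges d H u \<subseteq> edges (Suc d)"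
proof (induction H arbitrary: u)
  case (Suc H)
  from Suc.IH[OF tgt_Zd[OF Suc.prems]] Suc.prems show ?case by (auto simp: out_edges_def intro!: arc_edge_in_edges)
qed (auto simp: out_edges_def intro!: arc_edge_in_edges)

lemma open_step_out: "u' \<in> out_open d u S \<Longrightarrow> d \<le> d' \<Longrightarrow> S \<subseteq> S' \<Longrightarrow> open_step d' S' u u'"
  unfolding out_open_def open_step_def by (blast intro: less_le_trans)

lemma col_open_reach: "u' \<in> col_open d H u S \<Longrightarrow> S \<subseteq> S' \<Longrightarrow> (open_step (Suc d) S')\<^sup>*\<^sup>* u u'"
proof (induction H arbitrary: u)
  case (Suc H)
  show ?case
  proof (cases "u' \<in> out_open d u S")
    case True
    thus ?thesis using open_step_out[OF True, of "Suc d" S'] Suc.prems by auto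
  next
    case False
    hence u': "u' \<in> col_open d H (tgt (u, d)) S" and "arc_edge (u, d) \<in> S" using Suc.prems by (auto split: if_splits)
    hence "open_step (Suc d) S' u (tgt (u, d))" using Suc.prems(2) by (auto simp: open_step_def)
    thus ?thesis using Suc.IH[OF u' Suc.prems(2)] by (rule converse_rtranclp_into_rtranclp)
  qed
next
  case 0
  thus ?case using open_step_out[of u' d u S "Suc d" S'] by auto
qed

lemma col_exploration: "exploration (col_edges d H) (col_open d H) (drop_top d) (Zd (Suc d)) d"
proof
  fix u v S u'
  assume u: "u \<in> Zd (Suc d)"
  show "finite (col_edges d H u)" "finite (col_open d H u S)" by (rule finite_col_edges finite_col_open)+
  show "col_open d H u S \<subseteq> Zd (Suc d)" by (rule col_open_Zd[OF u])
  show "\<exists>i<d. drop_top d u' = tgt (drop_top d u, i)" if "u' \<in> col_open d H u S"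
  proof -
    from col_open_tgt[OF that] obtain w i where "i < d" "u' = tgt (w, i)" "drop_top d w = drop_top d u" by auto
    thus ?thesis by (intro exI[of _ i]) (simp add: drop_top_tgt)
  qed
  show "col_edges d H u \<inter> col_edges d H v = {}" if "drop_top d u \<noteq> drop_top d v"
  proof (rule ccontr)
    assume "col_edges d H u \<inter> col_edges d H v \<noteq> {}"
    then obtain e where e: "e \<in> col_edges d H u" "e \<in> col_edges d H v" by auto
    from col_edges_arc[OF e(1)] col_edges_arc[OF e(2)] obtain w i w' i' where
      "arc_edge (w, i) = arc_edge (w', i')" "drop_top d w = drop_top d u" "drop_top d w' = drop_top d v" by metis
    thus False using that by (auto dest: injD[OF inj_arc_edge])
  qed
qed

definition col_dirs :: "nat \<Rightarrow> nat \<Rightarrow> vertex \<Rightarrow> edge set \<Rightarrow> nat set" where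
  "col_dirs d H u S = {i. i < d \<and> tgt (drop_top d u, i) \<in> drop_top d ` col_open d H u S}"

lemma out_open_dirs: "{i. i < d \<and> tgt (drop_top d u, i) \<in> drop_top d ` out_open d u S} = {i. i < d \<and> arc_edge (u, i) \<in> S}"
  by (force simp: out_open_def drop_top_tgt tgt_eq_iff)

lemma col_dirs_0: "col_dirs d 0 u S = {i. i < d \<and> arc_edge (u, i) \<in> S}"
  by (simp add: col_dirs_def out_open_dirs)

lemma col_dirs_Suc: "col_dirs d (Suc H) u S =
    {i. i < d \<and> arc_edge (u, i) \<in> S} \<union> (if arc_edge (u, d) \<in> S then col_dirs d H (tgt (u, d)) S else {})"
  unfolding out_open_dirs[symmetric] by (auto simp: col_dirs_def drop_top_up)

lemma col_dirs_Int: "col_edges d H u \<subseteq> K \<Longrightarrow> col_dirs d H u (S \<inter> K) = col_dirs d H u S"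
proof (induction H arbitrary: u)
  case 0
  thus ?case by (auto simp: col_dirs_0 out_edges_def)
next
  case (Suc H)
  have "{i. i < d \<and> arc_edge (u, i) \<in> S \<inter> K} = {i. i < d \<and> arc_edge (u, i) \<in> S}"
    using Suc.prems by (auto simp: out_edges_def)
  moreover have "arc_edge (u, d) \<in> K" using Suc.prems by auto
  moreover have "col_dirs d H (tgt (u, d)) (S \<inter> K) = col_dirs d H (tgt (u, d)) S"
    using Suc.prems by (intro Suc.IH) auto
  ultimately show ?case by (simp add: col_dirs_Suc)
qed

text \<open>A direction is missed if its arc at the current vertex is closed and, moreover, its copy
  of the climbing edge is closed or the direction is missed from above.\<close>

primrec col_prob :: "real \<Rightarrow> real \<Rightarrow> nat \<Rightarrow> real" where
  "col_prob p r 0 = p"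
| "col_prob p r (Suc H) = 1 - (1 - p) * (1 - r * col_prob p r H)"

lemma bernoulli_exp_out_dirs:
  "bernoulli_exp p (out_edges d u) (\<lambda>S. \<phi> {i. i < d \<and> arc_edge (u, i) \<in> S}) = bernoulli_exp p {..<d} \<phi>"
proof -
  have inj: "inj_on (\<lambda>i. arc_edge (u, i)) {..<d}"
    using inj_arc_edge by (auto simp: inj_on_def dest: injD)
  have "bernoulli_exp p (out_edges d u) (\<lambda>S. \<phi> {i. i < d \<and> arc_edge (u, i) \<in> S}) =
    bernoulli_exp p {..<d} (\<lambda>S. \<phi> {i. i < d \<and> arc_edge (u, i) \<in> (\<lambda>i. arc_edge (u, i)) ` S})"
    unfolding out_edges_def image_image by (rule bernoulli_exp_image[OF _ inj]) simp
  also have "\<dots> = bernoulli_exp p {..<d} \<phi>"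
    by (intro bernoulli_exp_cong arg_cong[of _ _ \<phi>]) (auto dest!: injD[OF inj_arc_edge])
  finally show ?thesis .
qed

text \<open>The climbing edge is open iff at least one of \<open>d\<close> independent copies, one for each direction of
  escape and each open with probability \<open>r\<close>, is open. Letting each direction use its own copy only
  decreases the set of successful directions and makes them independent.\<close>

lemma col_dirs_dominate:
  assumes p: "0 \<le> p" "p \<le> 1" and r: "0 \<le> r" "r \<le> 1" "(1 - r) ^ d = 1 - p"
  shows "(\<And>I I'. I \<subseteq> I' \<Longrightarrow> I' \<subseteq> {..<d} \<Longrightarrow> \<phi> I \<le> \<phi> I') \<Longrightarrow>
    0 \<le> col_prob p r H \<and> col_prob p r H \<le> 1 \<and>
    bernoulli_exp (col_prob p r H) {..<d} \<phi> \<le> bernoulli_exp p (col_edges d H u) (\<lambda>S. \<phi> (col_dirs d H u S))"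
proof (induction H arbitrary: u \<phi>)
  case 0
  show ?case using p by (simp add: col_dirs_0 bernoulli_exp_out_dirs)
next
  case (Suc H)
  define s where "s = col_prob p r H"
  define v where "v = arc_edge (u, d)"
  define U where "U = tgt (u, d)"
  define EH where "EH = col_edges d H U"
  note mono = Suc.prems
  have s: "0 \<le> s" "s \<le> 1" using Suc.IH[of "\<lambda>_. 0"] by (auto simp: s_def)
  have q: "0 \<le> 1 - (1 - p) * (1 - r * s)" "1 - (1 - p) * (1 - r * s) \<le> 1"
    using p r s mult_mono[of r 1 s 1] mult_mono[of "1 - p" 1 "1 - r * s" 1]
    by (auto intro!: mult_nonneg_nonneg)
  have vE: "v \<notin> EH" "v \<notin> out_edges d u" "out_edges d u \<inter> EH = {}"
  proof -
    have "arc_edge (u, i) \<notin> EH" for i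
    proof
      assume "arc_edge (u, i) \<in> EH"
      from col_edges_arc[OF this[unfolded EH_def]] obtain w j where
        "arc_edge (u, i) = arc_edge (w, j)" "U d \<le> w d" by auto
      thus False by (auto simp: U_def tgt_top dest!: injD[OF inj_arc_edge])
    qed
    thus "v \<notin> EH" "out_edges d u \<inter> EH = {}" by (auto simp: v_def out_edges_def)
    show "v \<notin> out_edges d u" by (auto simp: v_def out_edges_def dest!: injD[OF inj_arc_edge])
  qed
  have fin: "finite EH" "finite (out_edges d u)" "finite (insert v EH)"
    unfolding EH_def using finite_col_edges by (auto simp: out_edges_def)
  have D: "col_dirs d (Suc H) u (B \<union> W) = {i. i < d \<and> arc_edge (u, i) \<in> B} \<union> (if v \<in> W then col_dirs d H U W else {})"
    if BW: "B \<subseteq> out_edges d u" "W \<subseteq> insert v EH" for B W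
  proof -
    have 1: "arc_edge (u, i) \<in> B \<union> W \<longleftrightarrow> arc_edge (u, i) \<in> B" if "i < d" for i
    proof -
      have "arc_edge (u, i) \<in> out_edges d u" using that by (auto simp: out_edges_def)
      thus ?thesis using BW vE by auto
    qed
    have 2: "v \<in> B \<union> W \<longleftrightarrow> v \<in> W" using BW vE by auto
    have "col_dirs d H U (B \<union> W) = col_dirs d H U ((B \<union> W) \<inter> EH)"
      by (rule col_dirs_Int[symmetric]) (simp add: EH_def)
    also have "(B \<union> W) \<inter> EH = W \<inter> EH" using BW vE by auto
    also have "col_dirs d H U \<dots> = col_dirs d H U W" by (rule col_dirs_Int) (simp add: EH_def)
    finally have 3: "col_dirs d H U (B \<union> W) = col_dirs d H U W" .
    have "{i. i < d \<and> arc_edge (u, i) \<in> B \<union> W} = {i. i < d \<and> arc_edge (u, i) \<in> B}" using 1 by auto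
    thus ?thesis using 2 3 by (simp only: col_dirs_Suc v_def U_def)
  qed
  have D': "col_dirs d H U (insert v W) = col_dirs d H U W" for W
  proof -
    have "col_dirs d H U (insert v W) = col_dirs d H U (insert v W \<inter> EH)"
      by (rule col_dirs_Int[symmetric]) (simp add: EH_def)
    also have "insert v W \<inter> EH = W \<inter> EH" using vE by auto
    also have "col_dirs d H U \<dots> = col_dirs d H U W" by (rule col_dirs_Int) (simp add: EH_def)
    finally show ?thesis .
  qed
  \<comment> \<open>Value once the directions \<open>B\<close> have been found at \<open>u\<close>:
    if the climbing edge is open, an independent \<open>s\<close>-random set from above is
    added.\<close>
  define g where "g B = p * bernoulli_exp s {..<d} (\<lambda>X. \<phi> (B \<union> X)) + (1 - p) * \<phi> B" for B
  have "bernoulli_exp (1 - (1 - p) * (1 - r * s)) {..<d} \<phi> =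
      bernoulli_exp p {..<d} (\<lambda>B. bernoulli_exp r {..<d} (\<lambda>R. bernoulli_exp s {..<d} (\<lambda>X. \<phi> (B \<union> (R \<inter> X)))))"
    by (simp add: bernoulli_exp_union[symmetric] bernoulli_exp_Int[symmetric])
  also have "\<dots> \<le> bernoulli_exp p {..<d} g"
  proof (rule bernoulli_exp_mono[OF p])
    fix B :: "nat set" assume B: "B \<subseteq> {..<d}"
    \<comment> \<open>\<open>R\<close> is the set of directions whose copy is open. By
      \<open>(1 - r) ^ d = 1 - p\<close> it is nonempty with probability \<open>p\<close>, as for
      the real climbing edge; replacing \<open>R \<inter> X\<close> by \<open>X\<close> when
      \<open>R\<close> is nonempty only enlarges the set.\<close>
    define M where "M b = (if b then bernoulli_exp s {..<d} (\<lambda>X. \<phi> (B \<union> X)) else \<phi> B)" for b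
    have "bernoulli_exp r {..<d} (\<lambda>R. bernoulli_exp s {..<d} (\<lambda>X. \<phi> (B \<union> (R \<inter> X)))) \<le> bernoulli_exp r {..<d} (\<lambda>R. M (R \<noteq> {}))"
    proof (rule bernoulli_exp_mono[OF r(1,2)])
      fix R :: "nat set" assume "R \<subseteq> {..<d}"
      show "bernoulli_exp s {..<d} (\<lambda>X. \<phi> (B \<union> (R \<inter> X))) \<le> M (R \<noteq> {})"
        unfolding M_def using B by (auto simp: bernoulli_exp_const intro!: bernoulli_exp_mono s mono)
    qed
    also have "\<dots> = g B" by (subst bernoulli_exp_nonempty) (auto simp: g_def M_def r)
    finally show "bernoulli_exp r {..<d} (\<lambda>R. bernoulli_exp s {..<d} (\<lambda>X. \<phi> (B \<union> (R \<inter> X)))) \<le> g B" .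
  qed
  also have "\<dots> = bernoulli_exp p (out_edges d u) (\<lambda>S. g {i. i < d \<and> arc_edge (u, i) \<in> S})"
    by (rule bernoulli_exp_out_dirs[symmetric])
  also have "\<dots> \<le> bernoulli_exp p (out_edges d u) (\<lambda>S. bernoulli_exp p (insert v EH)
      (\<lambda>W. \<phi> ({i. i < d \<and> arc_edge (u, i) \<in> S} \<union> (if v \<in> W then col_dirs d H U W else {}))))"
  proof (rule bernoulli_exp_mono[OF p])
    fix S
    define B where "B = {i. i < d \<and> arc_edge (u, i) \<in> S}"
    have B: "B \<subseteq> {..<d}" by (auto simp: B_def)
    have "bernoulli_exp s {..<d} (\<lambda>X. \<phi> (B \<union> X)) \<le> bernoulli_exp p EH (\<lambda>W. \<phi> (B \<union> col_dirs d H U W))"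
      unfolding s_def EH_def using B
      by (intro Suc.IH[THEN conjunct2, THEN conjunct2, of "\<lambda>X. \<phi> (B \<union> X)"] mono) auto
    hence "g B \<le> p * bernoulli_exp p EH (\<lambda>W. \<phi> (B \<union> col_dirs d H U W)) + (1 - p) * \<phi> B"
      unfolding g_def using p by (intro add_right_mono mult_left_mono)
    also have "\<phi> B = bernoulli_exp p EH (\<lambda>W. \<phi> (B \<union> (if v \<in> W then col_dirs d H U W else {})))"
    proof -
      have "bernoulli_exp p EH (\<lambda>W. \<phi> (B \<union> (if v \<in> W then col_dirs d H U W else {}))) = bernoulli_exp p EH (\<lambda>W. \<phi> B)"
        using vE by (intro bernoulli_exp_cong arg_cong[of _ _ \<phi>]) auto
      thus ?thesis using fin by (simp add: bernoulli_exp_const)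
    qed
    also have "p * bernoulli_exp p EH (\<lambda>W. \<phi> (B \<union> col_dirs d H U W)) + (1 - p) * \<dots> =
        bernoulli_exp p (insert v EH) (\<lambda>W. \<phi> (B \<union> (if v \<in> W then col_dirs d H U W else {})))"
      using bernoulli_exp_insert[OF fin(1) vE(1)] by (simp add: D')
    finally show "g {i. i < d \<and> arc_edge (u, i) \<in> S} \<le> bernoulli_exp p (insert v EH)
      (\<lambda>W. \<phi> ({i. i < d \<and> arc_edge (u, i) \<in> S} \<union> (if v \<in> W then col_dirs d H U W else {})))"
      by (simp add: B_def)
  qed
  also have "\<dots> = bernoulli_exp p (out_edges d u) (\<lambda>S. bernoulli_exp p (insert v EH) (\<lambda>W. \<phi> (col_dirs d (Suc H) u (S \<union> W))))"
    by (intro bernoulli_exp_cong) (simp only: D)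
  also have "\<dots> = bernoulli_exp p (out_edges d u \<union> insert v EH) (\<lambda>S. \<phi> (col_dirs d (Suc H) u S))"
    using fin vE by (intro bernoulli_exp_Un[symmetric]) auto
  finally show ?case using q by (simp add: s_def v_def EH_def U_def)
qed

lemma col_dominates:
  assumes p: "0 \<le> p" "p \<le> 1" and r: "0 \<le> r" "r \<le> 1" "(1 - r) ^ d = 1 - p"
  shows "dominating_exploration (col_edges d H) (col_open d H) (drop_top d) (Zd (Suc d)) d p (col_prob p r H)"
proof (intro dominating_exploration.intro col_exploration dominating_exploration_axioms.intro p)
  show "0 \<le> col_prob p r H" "col_prob p r H \<le> 1"
    using col_dirs_dominate[OF p r, of "\<lambda>_. 0"] by auto
  fix u :: vertex and \<phi> :: "nat set \<Rightarrow> real"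
  assume mono: "\<And>I I'. I \<subseteq> I' \<Longrightarrow> I' \<subseteq> {..<d} \<Longrightarrow> \<phi> I \<le> \<phi> I'"
  have "bernoulli_exp (col_prob p r H) {..<d} \<phi> \<le> bernoulli_exp p (col_edges d H u) (\<lambda>S. \<phi> (col_dirs d H u S))"
    using col_dirs_dominate[where \<phi> = \<phi> and H = H and u = u, OF p r] mono by blast
  thus "bernoulli_exp (col_prob p r H) {..<d} \<phi> \<le>
      bernoulli_exp p (col_edges d H u) (\<lambda>S. \<phi> {i. i < d \<and> tgt (drop_top d u, i) \<in> drop_top d ` col_open d H u S})"
    by (simp add: col_dirs_def)
qed

text \<open>The recursion is affine, \<open>c \<mapsto> p + q * c\<close> with
  \<open>q = (1 - p) * r < 1\<close>, and its fixed point is the limit.\<close>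

lemma col_prob_limit:
  assumes "0 < p" "p \<le> 1" "0 \<le> r" "r \<le> 1"
  shows "col_prob p r \<longlonglongrightarrow> p / (1 - (1 - p) * r)"
proof -
  define q where "q = (1 - p) * r"
  have "q \<le> (1 - p) * 1" unfolding q_def using assms by (intro mult_left_mono) auto
  hence q: "0 \<le> q" "q < 1" using assms by (auto simp: q_def)
  have eq: "col_prob p r H = p / (1 - q) + (p - p / (1 - q)) * q ^ H" for H
  proof (induction H)
    case (Suc H)
    have "col_prob p r (Suc H) = p + q * col_prob p r H" by (simp add: q_def algebra_simps)
    also have "\<dots> = (p + q * (p / (1 - q))) + (p - p / (1 - q)) * q ^ Suc H"
      unfolding Suc.IH by (simp add: algebra_simps)
    also have "p + q * (p / (1 - q)) = p / (1 - q)" using q by (simp add: field_simps)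
    finally show ?case .
  qed simp
  have "(\<lambda>H. p / (1 - q) + (p - p / (1 - q)) * q ^ H) \<longlonglongrightarrow> p / (1 - q) + (p - p / (1 - q)) * 0"
    using q by (intro tendsto_intros LIMSEQ_realpow_zero)
  hence "(\<lambda>H. col_prob p r H) \<longlonglongrightarrow> p / (1 - q)" unfolding eq by simp
  thus ?thesis by (simp add: q_def)
qed

text \<open>The climb is cut off at a height \<open>H\<close> to keep the explored edge sets finite.
  The success probability tends to the bound in \<open>gt\<close> as \<open>H\<close> grows, so by
  strictness some finite \<open>H\<close> already exceeds the critical point in dimension
  \<open>d\<close>.\<close>

lemma theta_next_dim_pos:
  assumes d: "d \<ge> 1" and p: "0 < p" "p \<le> 1"
    and gt: "oriented_pc d < p / (p + (1 - p) powr (real (d + 1) / real d))"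
  shows "0 < oriented_theta (d + 1) p"
proof -
  define r where "r = 1 - (1 - p) powr (1 / real d)"
  have "(1 - p) powr (1 / real d) \<le> 1" using p by (intro powr_le1) auto
  hence r: "0 \<le> r" "r \<le> 1" by (auto simp: r_def)
  have rd: "(1 - r) ^ d = 1 - p"
  proof (cases "p = 1")
    case False
    thus ?thesis using p d by (simp add: r_def powr_realpow[symmetric] powr_powr)
  qed (use d in \<open>simp add: r_def\<close>)
  have "1 - (1 - p) * r = p + (1 - p) * (1 - p) powr (1 / real d)" by (simp add: r_def algebra_simps)
  also have "(1 - p) * (1 - p) powr (1 / real d) = (1 - p) powr (real (d + 1) / real d)"
  proof (cases "p = 1")
    case False
    hence "(1 - p) * (1 - p) powr (1 / real d) = (1 - p) powr (1 + 1 / real d)" using p by (simp add: powr_add)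
    thus ?thesis using d by (simp add: add_divide_distrib add.commute)
  qed simp
  finally have "oriented_pc d < p / (1 - (1 - p) * r)" using gt by simp
  from order_tendstoD(1)[OF col_prob_limit[OF p r] this]
  obtain H where H: "oriented_pc d < col_prob p r H" by (auto simp: eventually_sequentially)
  define s where "s = col_prob p r H"
  have p0: "0 \<le> p" using p by simp
  interpret dominating_exploration "col_edges d H" "col_open d H" "drop_top d" "Zd (Suc d)" d p s
    unfolding s_def by (rule col_dominates[OF p0 p(2) r rd])
  have "oriented_theta d s \<noteq> 0" using oriented_pc_ge[OF s, of d] H by (auto simp: s_def)
  moreover have "oriented_theta d s \<ge> 0" by (simp add: oriented_theta_def)
  ultimately have "0 < oriented_theta d s" by simp
  also have "oriented_theta d s \<le> oriented_theta (Suc d) p"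
  proof (rule theta_ge_run[OF exploration_axioms col_edges_subset origin_Zd p0 assms(3)])
    have o: "drop_top d origin = origin" by (rule ext) (simp add: drop_top_def origin_def)
    show "level d (drop_top d origin) = 0" by (simp add: o)
    show "(open_step (Suc d) S)\<^sup>*\<^sup>* u u'" if "u' \<in> col_open d H u (S \<inter> col_edges d H u)" for u S u'
      using that by (rule col_open_reach) auto
    fix n
    have "oriented_theta d s \<le> surv s d n {origin}" by (rule theta_le_surv[OF s])
    also have "\<dots> = surv s d n (drop_top d ` {origin})" by (simp add: o)
    also have "\<dots> \<le> bernoulli_exp p (explored n {origin}) (\<lambda>S. of_bool (run n {origin} S \<noteq> {}))"
      by (intro surv_le_run[where m = 0] finite_explored) (auto simp: o)
    finally show "oriented_theta d s \<le> bernoulli_exp p (explored n {origin}) (\<lambda>S. of_bool (run n {origin} S \<noteq> {}))" .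
  qed
  finally show ?thesis by simp
qed

text \<open>The solutions are the zeros of \<open>g\<close>, which increases strictly and changes
  sign on the unit interval. The last conclusion expresses \<open>g y > 0\<close>, that is,
  \<open>y\<close> lies beyond the zero.\<close>

lemma Sol_props:
  assumes a: "0 < a" "a < 1" and b: "b > 1"
  shows "0 < Sol a b" "Sol a b < 1" "\<And>y. Sol a b < y \<Longrightarrow> y \<le> 1 \<Longrightarrow> a < y / (y + (1 - y) powr b)"
proof -
  define g where "g x = (1 - a) * x - a * (1 - x) powr b" for x
  have mono: "g x < g y" if "0 \<le> x" "x < y" "y \<le> 1" for x y
  proof -
    have "(1 - y) powr b \<le> (1 - x) powr b" using that b by (intro powr_mono2) auto
    hence "a * (1 - y) powr b \<le> a * (1 - x) powr b" using a by (intro mult_left_mono) auto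
    moreover have "(1 - a) * x < (1 - a) * y" using a that by simp
    ultimately show ?thesis by (simp add: g_def)
  qed
  have iff: "x = a * (x + (1 - x) powr b) \<longleftrightarrow> g x = 0" for x by (auto simp: g_def algebra_simps)
  have "continuous_on {0..1} g" unfolding g_def using b
    by (intro continuous_intros continuous_on_powr') auto
  moreover have "g 0 \<le> 0" "0 \<le> g 1" using a by (auto simp: g_def)
  ultimately obtain x where x: "0 \<le> x" "x \<le> 1" "g x = 0" using IVT'[of g 0 0 1] by auto
  have "g 0 < 0" "g 1 > 0" using a by (auto simp: g_def)
  hence x01: "0 < x" "x < 1" using x by (auto simp: less_le)
  have S: "Sol a b = x" unfolding Sol_def
  proof (rule the_equality)
    show "x \<in> {0<..<1} \<and> x = a * (x + (1 - x) powr b)" using x01 x iff by auto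
    fix y assume y: "y \<in> {0<..<1} \<and> y = a * (y + (1 - y) powr b)"
    hence "g y = 0" using iff by blast
    thus "y = x" using mono[of x y] mono[of y x] x x01 y by (cases x y rule: linorder_cases) auto
  qed
  show "0 < Sol a b" "Sol a b < 1" using x01 S by auto
  fix y assume y: "Sol a b < y" "y \<le> 1"
  hence "g y > 0" using mono[of x y] x S by auto
  hence "a * (y + (1 - y) powr b) < y" by (simp add: g_def algebra_simps)
  moreover have "y + (1 - y) powr b > 0" using y S x01 by (intro add_pos_nonneg) auto
  ultimately show "a < y / (y + (1 - y) powr b)" by (simp add: pos_less_divide_eq)
qed

lemma oriented_pc_Suc_le_Sol:
  assumes d: "d \<ge> 1" and lt: "oriented_pc d < 1"
  shows "oriented_pc (d + 1) \<le> Sol (oriented_pc d) (real (d + 1) / real d)"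
    and "Sol (oriented_pc d) (real (d + 1) / real d) < 1"
proof -
  have b: "real (d + 1) / real d > 1" using d by simp
  note S = Sol_props[OF oriented_pc_pos[OF d] lt b]
  show "Sol (oriented_pc d) (real (d + 1) / real d) < 1" by (rule S(2))
  show "oriented_pc (d + 1) \<le> Sol (oriented_pc d) (real (d + 1) / real d)"
  proof (rule oriented_pc_le)
    fix p :: real assume p: "0 \<le> p" "p \<le> 1" "Sol (oriented_pc d) (real (d + 1) / real d) < p"
    show "0 < oriented_theta (d + 1) p"
      using S(1) p by (intro theta_next_dim_pos d S(3)) auto
  qed
qed

text \<open>\<open>Sol\<close> characterises a point only for first arguments below 1. The value 2/3
  in dimension two starts the induction, and each further dimension stays below a \<open>Sol\<close>
  value.\<close>

lemma oriented_pc_less_1: "d \<ge> 2 \<Longrightarrow> oriented_pc d < 1"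
proof (induction d rule: dec_induct)
  case base
  have "oriented_pc (2 * 1) \<le> 1 - (1 / 3) powr (1 / real 1)" by (rule oriented_pc_even) simp
  thus ?case by simp
next
  case (step d)
  show ?case using oriented_pc_Suc_le_Sol[of d] step by simp
qed

section \<open>Second moment of the number of open paths\<close>

definition paths :: "nat \<Rightarrow> nat \<Rightarrow> nat list set" where
  "paths d n = {xs. set xs \<subseteq> {..<d} \<and> length xs = n}"

fun path_edges :: "vertex \<Rightarrow> nat list \<Rightarrow> edge set" where
  "path_edges v [] = {}"
| "path_edges v (i # is) = insert (arc_edge (v, i)) (path_edges (tgt (v, i)) is)"

fun endpoint :: "vertex \<Rightarrow> nat list \<Rightarrow> vertex" where
  "endpoint v [] = v"
| "endpoint v (i # is) = endpoint (tgt (v, i)) is"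

fun overlap :: "vertex \<Rightarrow> nat list \<Rightarrow> vertex \<Rightarrow> nat list \<Rightarrow> nat" where
  "overlap v (i # is) w (j # js) =
     of_bool (v = w \<and> i = j) + overlap (tgt (v, i)) is (tgt (w, j)) js"
| "overlap v _ w _ = 0"

lemma finite_paths [simp]: "finite (paths d n)"
  unfolding paths_def by (rule finite_lists_length_eq) simp

lemma card_paths: "card (paths d n) = d ^ n"
  unfolding paths_def by (subst card_lists_length_eq) auto

lemma paths_0 [simp]: "paths d 0 = {[]}"
  by (auto simp: paths_def)

lemma sum_paths_Suc: "(\<Sum>xs\<in>paths d (Suc n). f xs) = (\<Sum>i<d. \<Sum>is\<in>paths d n. f (i # is))"
proof -
  have "paths d (Suc n) = (\<lambda>(i, is). i # is) ` ({..<d} \<times> paths d n)"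
    by (auto simp: paths_def length_Suc_conv image_iff)
  moreover have "inj_on (\<lambda>(i, is). i # is) ({..<d} \<times> paths d n)" by (auto simp: inj_on_def)
  ultimately show ?thesis by (simp add: sum.reindex sum.cartesian_product case_prod_unfold)
qed

lemma path_edges_level:
  "set xs \<subseteq> {..<d} \<Longrightarrow> e \<in> path_edges v xs \<Longrightarrow> \<exists>w i. e = arc_edge (w, i) \<and> level d v \<le> level d w"
proof (induction xs arbitrary: v)
  case (Cons i xs)
  show ?case
  proof (cases "e = arc_edge (v, i)")
    case False
    with Cons.IH[of "tgt (v, i)"] Cons.prems obtain w j where
      w: "e = arc_edge (w, j)" "level d (tgt (v, i)) \<le> level d w" by auto
    have "level d v \<le> level d w" using w(2) level_tgt[of i d v] Cons.prems by simp
    thus ?thesis using w(1) by blast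
  qed blast
qed simp

lemma finite_path_edges [simp]: "finite (path_edges v xs)"
  by (induction xs arbitrary: v) auto

text \<open>Both paths start in the same level and climb one level per step, so an edge can be
  common to them only at the same step. Hence the stepwise \<open>overlap\<close> counts all shared
  edges.\<close>

lemma card_path_edges_Un:
  "set xs \<subseteq> {..<d} \<Longrightarrow> set ys \<subseteq> {..<d} \<Longrightarrow> length xs = length ys \<Longrightarrow> level d v = level d w \<Longrightarrow>
    card (path_edges v xs \<union> path_edges w ys) + overlap v xs w ys = 2 * length xs"
proof (induction v xs w ys rule: overlap.induct)
  case (1 v i "is" w j js)
  define U where "U = path_edges (tgt (v, i)) is \<union> path_edges (tgt (w, j)) js"
  have IH: "card U + overlap (tgt (v, i)) is (tgt (w, j)) js = 2 * length is"
    unfolding U_def using 1 by (intro "1.IH") (auto simp: level_tgt)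
  have notin: "arc_edge (x, k) \<notin> U" if "level d x = level d v" for x k
  proof
    assume "arc_edge (x, k) \<in> U"
    then consider "arc_edge (x, k) \<in> path_edges (tgt (v, i)) is" | "arc_edge (x, k) \<in> path_edges (tgt (w, j)) js"
      by (auto simp: U_def)
    then obtain y l where "arc_edge (x, k) = arc_edge (y, l)" "level d v + 1 \<le> level d y"
    proof cases
      case A: 1
      from path_edges_level[OF _ A, of d] that 1 show ?thesis using "1.prems" by (auto simp: level_tgt intro: that)
    next
      case A: 2
      from path_edges_level[OF _ A, of d] that 1 show ?thesis using "1.prems" by (auto simp: level_tgt intro: that)
    qed
    thus False using that by (auto dest: injD[OF inj_arc_edge])
  qed
  have U: "path_edges v (i # is) \<union> path_edges w (j # js) = insert (arc_edge (v, i)) (insert (arc_edge (w, j)) U)"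
    by (auto simp: U_def)
  have fin: "finite U" by (simp add: U_def)
  have n1: "arc_edge (v, i) \<notin> U" "arc_edge (w, j) \<notin> U" using notin[of v] notin[of w] 1 by auto
  show ?case
  proof (cases "v = w \<and> i = j")
    case True
    thus ?thesis unfolding U using n1 fin IH by simp
  next
    case False
    hence "arc_edge (v, i) \<noteq> arc_edge (w, j)" by (auto dest: injD[OF inj_arc_edge])
    thus ?thesis unfolding U using n1 fin IH False by auto
  qed
qed auto

lemma card_path_edges: "set xs \<subseteq> {..<d} \<Longrightarrow> card (path_edges v xs) = length xs"
proof -
  assume "set xs \<subseteq> {..<d}"
  moreover have "overlap v xs v xs = length xs" by (induction xs arbitrary: v) auto
  ultimately show ?thesis using card_path_edges_Un[of xs d xs v v] by simp
qed

lemma path_run: "set xs \<subseteq> {..<d} \<Longrightarrow> path_edges v xs \<subseteq> S \<Longrightarrow> v \<in> A \<Longrightarrow> endpoint v xs \<in> direct.run d (length xs) A S"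
proof (induction xs arbitrary: v A)
  case (Cons i xs)
  have "tgt (v, i) \<in> direct.succs d S A" using Cons.prems by (auto simp: direct_succs open_step_def)
  with Cons show ?case by (simp add: direct.run_Suc)
qed simp

text \<open>Mean of \<open>l ^ overlap\<close> for two independent uniform directed walks. For
  \<open>l = 1 / p\<close> and a common start it is the ratio of the second moment of the number of
  open paths to its squared mean.\<close>

primrec pair_moment :: "real \<Rightarrow> nat \<Rightarrow> nat \<Rightarrow> vertex \<Rightarrow> vertex \<Rightarrow> real" where
  "pair_moment l d 0 v w = 1"
| "pair_moment l d (Suc n) v w =
    (\<Sum>i<d. \<Sum>j<d. l ^ of_bool (v = w \<and> i = j) * pair_moment l d n (tgt (v, i)) (tgt (w, j))) / (real d)\<^sup>2"

primrec meet_prob :: "nat \<Rightarrow> nat \<Rightarrow> vertex \<Rightarrow> vertex \<Rightarrow> real" where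
  "meet_prob d 0 v w = of_bool (v = w)"
| "meet_prob d (Suc n) v w = (\<Sum>i<d. \<Sum>j<d. meet_prob d n (tgt (v, i)) (tgt (w, j))) / (real d)\<^sup>2"

primrec walk_prob :: "nat \<Rightarrow> nat \<Rightarrow> vertex \<Rightarrow> vertex \<Rightarrow> real" where
  "walk_prob d 0 v z = of_bool (v = z)"
| "walk_prob d (Suc n) v z = (\<Sum>i<d. walk_prob d n (tgt (v, i)) z) / real d"

lemma pair_moment_eq:
  assumes "d \<ge> 1"
  shows "(\<Sum>xs\<in>paths d n. \<Sum>ys\<in>paths d n. l ^ overlap v xs w ys) = (real d) ^ (2 * n) * pair_moment l d n v w"
proof (induction n arbitrary: v w)
  case (Suc n)
  have "(\<Sum>xs\<in>paths d (Suc n). \<Sum>ys\<in>paths d (Suc n). l ^ overlap v xs w ys) =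
    (\<Sum>i<d. \<Sum>is\<in>paths d n. \<Sum>j<d. \<Sum>js\<in>paths d n. l ^ overlap v (i # is) w (j # js))"
    unfolding sum_paths_Suc ..
  also have "\<dots> = (\<Sum>i<d. \<Sum>j<d. l ^ of_bool (v = w \<and> i = j) *
      (\<Sum>is\<in>paths d n. \<Sum>js\<in>paths d n. l ^ overlap (tgt (v, i)) is (tgt (w, j)) js))"
    by (subst (2) sum.swap) (simp add: power_add sum_distrib_left)
  also have "\<dots> = (real d) ^ (2 * n) * (\<Sum>i<d. \<Sum>j<d. l ^ of_bool (v = w \<and> i = j) * pair_moment l d n (tgt (v, i)) (tgt (w, j)))"
    unfolding Suc.IH sum_distrib_left by (intro sum.cong refl) (simp only: mult_ac)
  also have "\<dots> = (real d) ^ (2 * Suc n) * pair_moment l d (Suc n) v w"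
    using assms by (simp add: power2_eq_square)
  finally show ?case .
qed simp

lemma meet_prob_walk:
  assumes "d \<ge> 1"
  shows "meet_prob d n v w = (\<Sum>ys\<in>paths d n. walk_prob d n v (endpoint w ys)) / real d ^ n"
proof (induction n arbitrary: v w)
  case (Suc n)
  have "(\<Sum>ys\<in>paths d (Suc n). walk_prob d (Suc n) v (endpoint w ys)) / real d ^ Suc n =
    (\<Sum>j<d. \<Sum>js\<in>paths d n. \<Sum>i<d. walk_prob d n (tgt (v, i)) (endpoint (tgt (w, j)) js)) / (real d ^ n * (real d)\<^sup>2)"
    unfolding sum_paths_Suc by (simp add: sum_divide_distrib[symmetric] power2_eq_square)
  also have "(\<Sum>j<d. \<Sum>js\<in>paths d n. \<Sum>i<d. walk_prob d n (tgt (v, i)) (endpoint (tgt (w, j)) js))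
    = (\<Sum>j<d. \<Sum>i<d. \<Sum>js\<in>paths d n. walk_prob d n (tgt (v, i)) (endpoint (tgt (w, j)) js))"
    by (intro sum.cong refl sum.swap)
  also have "\<dots> = (\<Sum>i<d. \<Sum>j<d. \<Sum>js\<in>paths d n. walk_prob d n (tgt (v, i)) (endpoint (tgt (w, j)) js))"
    by (rule sum.swap)
  finally show ?case
    by (simp add: Suc.IH sum_divide_distrib[symmetric])
qed simp

lemma meet_prob_le:
  assumes "d \<ge> 1" "\<And>v z. walk_prob d n v z \<le> b"
  shows "meet_prob d n v w \<le> b"
proof -
  have "meet_prob d n v w \<le> (\<Sum>ys\<in>paths d n. b) / real d ^ n"
    unfolding meet_prob_walk[OF assms(1)] using assms by (intro divide_right_mono sum_mono) auto
  also have "\<dots> = b" using assms(1) by (simp add: card_paths)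
  finally show ?thesis .
qed

text \<open>Averaging over the first step cannot raise a uniform bound. A bound at time
  \<open>q * d\<close> thus serves for the whole block of the next \<open>d\<close> times.\<close>

lemma walk_prob_le_later:
  assumes "d \<ge> 1" "\<And>v z. walk_prob d m v z \<le> b" "m \<le> n"
  shows "walk_prob d n v z \<le> b"
  using assms(3)
proof (induction n arbitrary: v rule: dec_induct)
  case (step n)
  have "walk_prob d (Suc n) v z \<le> (\<Sum>i<d. b) / real d"
    unfolding walk_prob.simps using step by (intro divide_right_mono sum_mono) auto
  thus ?case using assms(1) by simp
qed (rule assms(2))

section \<open>Uniform bounds for the position of one walk\<close>

definition multinom_bound :: "nat \<Rightarrow> nat \<Rightarrow> vertex \<Rightarrow> vertex \<Rightarrow> real" where
  "multinom_bound d n v z = (if (\<forall>i<d. v i \<le> z i) \<and> level d z = level d v + int n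
     then fact n / (real d ^ n * (\<Prod>i<d. fact (nat (z i - v i)))) else 0)"

lemma walk_prob_multinom:
  assumes d: "d \<ge> 1"
  shows "walk_prob d n v z \<le> multinom_bound d n v z"
proof (induction n arbitrary: v)
  case 0
  show ?case by (auto simp: multinom_bound_def intro!: prod_nonneg)
next
  case (Suc n)
  have "walk_prob d (Suc n) v z \<le> (\<Sum>i<d. multinom_bound d n (tgt (v, i)) z) / real d"
    unfolding walk_prob.simps using Suc by (intro divide_right_mono sum_mono) auto
  also have "\<dots> \<le> multinom_bound d (Suc n) v z"
  proof (cases "(\<forall>i<d. v i \<le> z i) \<and> level d z = level d v + int (Suc n)")
    case False
    have "multinom_bound d n (tgt (v, i)) z = 0" if "i < d" for i
    proof -
      have "\<not> ((\<forall>k<d. tgt (v, i) k \<le> z k) \<and> level d z = level d (tgt (v, i)) + int n)"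
      proof
        assume A: "(\<forall>k<d. tgt (v, i) k \<le> z k) \<and> level d z = level d (tgt (v, i)) + int n"
        have "v k \<le> z k" if "k < d" for k
        proof -
          have "v k \<le> tgt (v, i) k" by (simp add: tgt_def unit_vec_def)
          thus ?thesis using A that by force
        qed
        thus False using A False that by (simp add: level_tgt)
      qed
      thus ?thesis unfolding multinom_bound_def by (simp only: if_False)
    qed
    hence "(\<Sum>i<d. multinom_bound d n (tgt (v, i)) z) = 0" by simp
    moreover have "multinom_bound d (Suc n) v z = 0" unfolding multinom_bound_def by (rule if_not_P[OF False])
    ultimately show ?thesis by simp
  next
    case True
    define P :: real where "P = (\<Prod>i<d. fact (nat (z i - v i)))"
    have P: "P > 0" unfolding P_def by (intro prod_pos) auto
    \<comment> \<open>Taking one step off direction \<open>i\<close> replaces a factorial of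
      \<open>z i - v i\<close> by the preceding one, which gives the factor
      \<open>z i - v i\<close>. These factors add up to the number of remaining steps,
      \<open>Suc n\<close>.\<close>
    have term_le: "multinom_bound d n (tgt (v, i)) z \<le> fact n / (real d ^ n * P) * real_of_int (z i - v i)" if i: "i < d" for i
    proof (cases "v i < z i")
      case False
      hence "\<not> (\<forall>k<d. tgt (v, i) k \<le> z k)" using i by (auto simp: tgt_def unit_vec_def intro!: exI[of _ i])
      hence "multinom_bound d n (tgt (v, i)) z = 0" unfolding multinom_bound_def by (simp only: if_False simp_thms)
      moreover have "z i = v i" using False True i by force
      ultimately show ?thesis by simp
    next
      case lt: True
      have "P = fact (nat (z i - v i)) * (\<Prod>k\<in>{..<d} - {i}. fact (nat (z k - v k)))"
        unfolding P_def using i by (subst prod.remove[of _ i]) auto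
      also have "nat (z i - v i) = Suc (nat (z i - tgt (v, i) i))" using lt by (simp add: tgt_def unit_vec_def)
      also have "fact \<dots> = (real_of_int (z i - v i) * fact (nat (z i - tgt (v, i) i)) :: real)"
        using lt by (simp add: tgt_def unit_vec_def)
      also have "(\<Prod>k\<in>{..<d} - {i}. fact (nat (z k - v k)) :: real) = (\<Prod>k\<in>{..<d} - {i}. fact (nat (z k - tgt (v, i) k)))"
        by (intro prod.cong) (auto simp: tgt_def unit_vec_def)
      also have "real_of_int (z i - v i) * fact (nat (z i - tgt (v, i) i)) * (\<Prod>k\<in>{..<d} - {i}. fact (nat (z k - tgt (v, i) k)))
        = real_of_int (z i - v i) * (\<Prod>k<d. fact (nat (z k - tgt (v, i) k)))"
        using i by (subst (2) prod.remove[of _ i]) auto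
      finally have PQ: "P = real_of_int (z i - v i) * (\<Prod>k<d. fact (nat (z k - tgt (v, i) k)))" .
      define Q :: real where "Q = (\<Prod>k<d. fact (nat (z k - tgt (v, i) k)))"
      have Q: "Q > 0" unfolding Q_def by (intro prod_pos) auto
      have "multinom_bound d n (tgt (v, i)) z \<le> fact n / (real d ^ n * Q)"
        unfolding multinom_bound_def Q_def[symmetric] using Q by auto
      also have "\<dots> = fact n / (real d ^ n * P) * real_of_int (z i - v i)"
        unfolding PQ Q_def[symmetric] using lt by simp
      finally show ?thesis .
    qed
    have "(\<Sum>i<d. multinom_bound d n (tgt (v, i)) z) / real d
      \<le> (\<Sum>i<d. fact n / (real d ^ n * P) * real_of_int (z i - v i)) / real d"
      using term_le by (intro divide_right_mono sum_mono) auto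
    also have "(\<Sum>i<d. fact n / (real d ^ n * P) * real_of_int (z i - v i)) =
        fact n / (real d ^ n * P) * real_of_int (level d z - level d v)"
      by (simp only: sum_distrib_left[symmetric] of_int_sum[symmetric] level_def sum_subtractf)
    also have "level d z - level d v = int (Suc n)" using True by simp
    also have "fact n / (real d ^ n * P) * real_of_int (int (Suc n)) / real d = fact (Suc n) / (real d ^ Suc n * P)"
      by (simp add: mult_ac)
    also have "\<dots> = multinom_bound d (Suc n) v z" using True by (simp add: multinom_bound_def P_def)
    finally show ?thesis .
  qed
  finally show ?case .
qed

lemma walk_prob_early:
  assumes d: "d \<ge> 1"
  shows "walk_prob d n v z \<le> fact n / real d ^ n"
proof -
  have "(1::real) \<le> (\<Prod>i<d. fact (nat (z i - v i)))" by (intro prod_ge_1) auto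
  hence "real d ^ n * 1 \<le> real d ^ n * (\<Prod>i<d. fact (nat (z i - v i)))" by (intro mult_left_mono) auto
  hence "multinom_bound d n v z \<le> fact n / real d ^ n"
    unfolding multinom_bound_def using d by (auto intro!: divide_left_mono mult_pos_pos prod_pos)
  with walk_prob_multinom[OF d, of n v z] show ?thesis by simp
qed

text \<open>\<open>q ^ x / fact x\<close> is largest at \<open>x = q\<close>. In the product over
  all coordinates, whose entries sum to \<open>q * d\<close>, the powers of \<open>q\<close> cancel
  and a comparison of factorials remains.\<close>

lemma fact_power_le: "fact q * real q ^ x \<le> fact x * real q ^ q"
proof (cases "q \<le> x")
  case True
  have "fact q * real q ^ (q + m) \<le> fact (q + m) * real q ^ q" for m
  proof (induction m)
    case (Suc m)
    have "fact q * real q ^ (q + Suc m) = real q * (fact q * real q ^ (q + m))" by simp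
    also have "\<dots> \<le> real (Suc (q + m)) * (fact (q + m) * real q ^ q)" by (rule mult_mono[OF _ Suc.IH]) auto
    finally show ?case by (simp add: mult_ac)
  qed simp
  from this[of "x - q"] True show ?thesis by simp
next
  case False
  have "fact (x + m) * real q ^ x \<le> fact x * real q ^ (x + m)" if "x + m \<le> q" for m
    using that
  proof (induction m)
    case (Suc m)
    have "fact (x + Suc m) * real q ^ x = real (Suc (x + m)) * (fact (x + m) * real q ^ x)" by (simp add: mult_ac)
    also have "\<dots> \<le> real q * (fact x * real q ^ (x + m))"
      using Suc.prems by (intro mult_mono[OF _ Suc.IH]) auto
    finally show ?case by (simp add: mult_ac)
  qed simp
  from this[of "q - x"] False show ?thesis by simp
qed

definition peak :: "nat \<Rightarrow> nat \<Rightarrow> real" where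
  "peak d q = fact (q * d) / (fact q ^ d * real d ^ (q * d))"

text \<open>The multinomial coefficient is largest when all its entries are equal.\<close>

lemma walk_prob_peak:
  assumes d: "d \<ge> 1" and q: "q \<ge> 1"
  shows "walk_prob d (q * d) v z \<le> peak d q"
proof -
  have "multinom_bound d (q * d) v z \<le> peak d q"
  proof (cases "(\<forall>i<d. v i \<le> z i) \<and> level d z = level d v + int (q * d)")
    case True
    define x where "x i = nat (z i - v i)" for i
    have "int (\<Sum>i<d. x i) = (\<Sum>i<d. z i - v i)" unfolding of_nat_sum using True by (intro sum.cong) (auto simp: x_def)
    also have "\<dots> = int (q * d)" using True by (simp add: sum_subtractf level_def)
    finally have sx: "(\<Sum>i<d. x i) = q * d" by (simp only: of_nat_eq_iff)
    have "fact q ^ d * real q ^ (q * d) = (\<Prod>i<d. fact q * real q ^ x i)"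
      by (simp add: prod.distrib power_sum sx[symmetric])
    also have "\<dots> \<le> (\<Prod>i<d. fact (x i) * real q ^ q)" by (intro prod_mono) (auto simp: fact_power_le)
    also have "\<dots> = (\<Prod>i<d. fact (x i)) * real q ^ (q * d)" by (simp add: prod.distrib power_mult)
    finally have le: "fact q ^ d \<le> (\<Prod>i<d. fact (x i) :: real)" using q by simp
    have "fact (q * d) / (real d ^ (q * d) * (\<Prod>i<d. fact (x i))) \<le> fact (q * d) / (real d ^ (q * d) * fact q ^ d)"
      using d le by (intro divide_left_mono mult_left_mono mult_pos_pos prod_pos) auto
    thus ?thesis using True by (simp add: multinom_bound_def peak_def x_def mult_ac)
  qed (auto simp: multinom_bound_def peak_def)
  with walk_prob_multinom[OF d, of "q * d" v z] show ?thesis by simp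
qed

lemma fact_add_prod: "fact (m + n) = fact m * (\<Prod>k<n. real (m + k + 1))"
  by (induction n) (simp_all add: algebra_simps)

text \<open>The quotient of successive peaks is a product of \<open>d\<close> factors 1 + t, each at
  most exp t. The exponents sum to -(D - 1)/(2 a), at most -2/a for D at least 5, and exp (-1/a) is
  at most a/(a + 1). The result is decay like 1/q^2.\<close>

lemma peak_Suc:
  assumes d: "d \<ge> 5"
  shows "peak d (Suc q) \<le> peak d q * ((real q + 1) / (real q + 2))\<^sup>2"
proof -
  define a where "a = real q + 1"
  define D where "D = real d"
  have a: "a \<ge> 1" and D: "D \<ge> 5" using d by (auto simp: a_def D_def)
  have "peak d (Suc q) = fact (q * d + d) / ((a * fact q) ^ d * (real d ^ (q * d) * D ^ d))"
    by (simp add: peak_def a_def D_def power_add add.commute)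
  also have "\<dots> = peak d q * ((\<Prod>k<d. real (q * d + k + 1)) / (\<Prod>k<d. a * D))"
    by (simp add: peak_def fact_add_prod power_mult_distrib)
  also have "(\<Prod>k<d. real (q * d + k + 1)) / (\<Prod>k<d. a * D) = (\<Prod>k<d. real (q * d + k + 1) / (a * D))"
    by (simp only: prod_dividef)
  also have "peak d q * \<dots> \<le> peak d q * (\<Prod>k<d. exp ((real k + 1 - D) / (a * D)))"
  proof (intro mult_left_mono prod_mono conjI)
    fix k
    have "real (q * d + k + 1) / (a * D) = 1 + (real k + 1 - D) / (a * D)"
    proof -
      have "real (q * d + k + 1) = a * D + (real k + 1 - D)" by (simp add: a_def D_def algebra_simps)
      moreover have "a * D \<noteq> 0" using a D by simp
      ultimately show ?thesis by (metis add_divide_distrib divide_self)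
    qed
    also have "\<dots> \<le> exp ((real k + 1 - D) / (a * D))" by (rule exp_ge_add_one_self)
    finally show "real (q * d + k + 1) / (a * D) \<le> exp ((real k + 1 - D) / (a * D))" .
    show "0 \<le> real (q * d + k + 1) / (a * D)" using a D by simp
  qed (simp add: peak_def)
  finally have 1: "peak d (Suc q) \<le> peak d q * (\<Prod>k<d. exp ((real k + 1 - D) / (a * D)))" .
  have "(\<Prod>k<d. exp ((real k + 1 - D) / (a * D))) = exp ((\<Sum>k<d. real k + 1 - D) / (a * D))"
    by (simp add: exp_sum sum_divide_distrib)
  also have "(\<Sum>k<d. real k + 1 - D) = - D * (D - 1) / 2"
  proof -
    have "(\<Sum>k<d. real k) = real d * (real d - 1) / 2" by (induction d) (simp_all add: field_simps)
    thus ?thesis by (simp add: sum_subtractf sum.distrib D_def field_simps)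
  qed
  also have "exp (- D * (D - 1) / 2 / (a * D)) \<le> exp (- 2 / a)"
  proof -
    have "- D * (D - 1) / 2 / (a * D) = - (D - 1) / (2 * a)" using a D by (simp add: field_simps)
    also have "\<dots> \<le> - 2 / a" using a D by (simp add: field_simps)
    finally show ?thesis by simp
  qed
  also have "exp (- 2 / a) \<le> (a / (a + 1))\<^sup>2"
  proof -
    have "(a + 1) / a \<le> exp (1 / a)" using exp_ge_add_one_self[of "1 / a"] a by (simp add: field_simps)
    hence "((a + 1) / a)\<^sup>2 \<le> (exp (1 / a))\<^sup>2" using a by (intro power_mono) auto
    also have "(exp (1 / a))\<^sup>2 = exp (2 / a)" by (simp flip: exp_double)
    finally have "1 / exp (2 / a) \<le> 1 / ((a + 1) / a)\<^sup>2" using a by (intro divide_left_mono) auto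
    thus ?thesis by (simp add: exp_minus inverse_eq_divide power_divide)
  qed
  finally have "peak d q * (\<Prod>k<d. exp ((real k + 1 - D) / (a * D))) \<le> peak d q * (a / (a + 1))\<^sup>2"
    by (rule mult_left_mono) (simp add: peak_def)
  with 1 have "peak d (Suc q) \<le> peak d q * (a / (a + 1))\<^sup>2" by (rule order_trans)
  thus ?thesis by (simp add: a_def add.assoc)
qed

text \<open>The sum covers the times below \<open>d\<close>, with \<open>walk_prob_early\<close>.
  The second term covers the blocks of \<open>d\<close> times thereafter: 4 is the constant of
  \<open>peak_bound\<close>, and 1/(q + 2)^2 is at most 1/(q + 1) - 1/(q + 2), which telescopes to
  at most 1.\<close>

definition meet_bound :: "nat \<Rightarrow> real" where
  "meet_bound d = (\<Sum>j<d. fact j / real d ^ j) + 4 * real d * (fact d / real d ^ d)"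

lemma peak_bound:
  assumes d: "d \<ge> 5"
  shows "peak d (Suc q) \<le> fact d / real d ^ d * (4 / (real q + 2)\<^sup>2)"
proof (induction q)
  case 0
  show ?case by (simp add: peak_def)
next
  case (Suc q)
  have "peak d (Suc (Suc q)) \<le> peak d (Suc q) * ((real (Suc q) + 1) / (real (Suc q) + 2))\<^sup>2"
    by (rule peak_Suc[OF d])
  also have "\<dots> \<le> fact d / real d ^ d * (4 / (real q + 2)\<^sup>2) * ((real (Suc q) + 1) / (real (Suc q) + 2))\<^sup>2"
    using Suc.IH by (intro mult_right_mono) auto
  also have "\<dots> = fact d / real d ^ d * (4 / (real (Suc q) + 2)\<^sup>2)"
    by (simp add: power_divide add.commute)
  finally show ?case .
qed

lemma meet_prob_nonneg: "meet_prob d n v w \<ge> 0"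
  by (induction n arbitrary: v w) (auto intro!: divide_nonneg_nonneg sum_nonneg)

lemma sum_meet_prob_le:
  assumes d: "d \<ge> 5"
  shows "(\<Sum>j<n. meet_prob d j v w) \<le> meet_bound d"
proof -
  have d1: "d \<ge> 1" using d by simp
  define c where "c = real d * (fact d / real d ^ d)"
  have c: "c \<ge> 0" by (simp add: c_def)
  have block: "(\<Sum>j<Suc q * d. meet_prob d j v w) \<le>
      (\<Sum>j<d. fact j / real d ^ j) + 4 * c * (1 - 1 / (real q + 1))" for q
  proof (induction q)
    case 0
    show ?case using meet_prob_le[OF d1 walk_prob_early[OF d1]] by (auto intro!: sum_mono)
  next
    case (Suc q)
    have "(\<Sum>j<Suc (Suc q) * d. meet_prob d j v w) =
      (\<Sum>j<Suc q * d. meet_prob d j v w) + (\<Sum>j=Suc q * d..<Suc (Suc q) * d. meet_prob d j v w)"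
      unfolding lessThan_atLeast0 by (rule sum.atLeastLessThan_concat[symmetric]) auto
    also have "(\<Sum>j=Suc q * d..<Suc (Suc q) * d. meet_prob d j v w)
       \<le> (\<Sum>j=Suc q * d..<Suc (Suc q) * d. peak d (Suc q))"
    proof (intro sum_mono meet_prob_le d1)
      fix j v z assume "j \<in> {Suc q * d..<Suc (Suc q) * d}"
      thus "walk_prob d j v z \<le> peak d (Suc q)"
        by (intro walk_prob_le_later[OF d1 walk_prob_peak[OF d1, of "Suc q"]]) auto
    qed
    also have "\<dots> = real d * peak d (Suc q)" by simp
    also have "\<dots> \<le> real d * (fact d / real d ^ d * (4 / (real q + 2)\<^sup>2))"
      by (intro mult_left_mono peak_bound d) auto
    also have "\<dots> = 4 * c * (1 / (real q + 2)\<^sup>2)" by (simp add: c_def)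
    also have "\<dots> \<le> 4 * c * (1 / (real q + 1) - 1 / (real (Suc q) + 1))"
    proof (intro mult_left_mono)
      have "1 / (real q + 1) - 1 / (real (Suc q) + 1) = 1 / ((real q + 1) * (real q + 2))"
        by (simp add: field_simps)
      moreover have "1 / (real q + 2)\<^sup>2 \<le> 1 / ((real q + 1) * (real q + 2))"
        by (intro divide_left_mono) (auto simp: power2_eq_square intro!: mult_right_mono)
      ultimately show "1 / (real q + 2)\<^sup>2 \<le> 1 / (real q + 1) - 1 / (real (Suc q) + 1)" by simp
    qed (use c in simp)
    finally show ?case using Suc.IH by (simp add: algebra_simps)
  qed
  have "n \<le> Suc n * d" using d by (simp add: trans_le_add2)
  hence "(\<Sum>j<n. meet_prob d j v w) \<le> (\<Sum>j<Suc n * d. meet_prob d j v w)"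
    by (intro sum_mono2) (auto simp: meet_prob_nonneg)
  also have "\<dots> \<le> (\<Sum>j<d. fact j / real d ^ j) + 4 * c * (1 - 1 / (real n + 1))" by (rule block)
  also have "\<dots> \<le> (\<Sum>j<d. fact j / real d ^ j) + 4 * c * 1"
    using c by (intro add_left_mono mult_left_mono) auto
  finally show ?thesis by (simp add: meet_bound_def c_def)
qed

text \<open>Decomposing according to the shared edges: after each of them the two walks start afresh from a
  common vertex.\<close>

lemma pair_moment_step:
  assumes d: "d \<ge> 1" and l: "l \<ge> 1" and C: "\<And>m x. m < n \<Longrightarrow> pair_moment l d m x x \<le> C"
  shows "pair_moment l d n v w \<le> 1 + (l - 1) / real d * C * (\<Sum>j<n. meet_prob d j v w)"
  using C
proof (induction n arbitrary: v w)
  case 0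
  show ?case by simp
next
  case (Suc n)
  define k where "k = (l - 1) / real d * C"
  have IH: "pair_moment l d n v w \<le> 1 + k * (\<Sum>j<n. meet_prob d j v w)" for v w
    unfolding k_def using Suc by auto
  have split: "(\<Sum>i<d. \<Sum>j<d. l ^ of_bool (v = w \<and> i = j) * pair_moment l d n (tgt (v, i)) (tgt (w, j)))
    = (\<Sum>i<d. \<Sum>j<d. pair_moment l d n (tgt (v, i)) (tgt (w, j)))
      + of_bool (v = w) * (l - 1) * (\<Sum>i<d. pair_moment l d n (tgt (v, i)) (tgt (v, i)))"
  proof (cases "v = w")
    case True
    have "l ^ of_bool (i = j) * y = y + (if i = j then (l - 1) * y else 0)" for i j :: nat and y
      by (auto simp: algebra_simps)
    thus ?thesis using True by (simp add: sum.distrib sum_distrib_left)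
  qed simp
  have "(\<Sum>i<d. \<Sum>j<d. pair_moment l d n (tgt (v, i)) (tgt (w, j))) / (real d)\<^sup>2
     \<le> (\<Sum>i<d. \<Sum>j<d. 1 + k * (\<Sum>m<n. meet_prob d m (tgt (v, i)) (tgt (w, j)))) / (real d)\<^sup>2"
    by (intro divide_right_mono sum_mono IH) auto
  also have "\<dots> = 1 + k * (\<Sum>m<n. meet_prob d (Suc m) v w)"
  proof -
    have "(\<Sum>i<d. \<Sum>j<d. \<Sum>m<n. meet_prob d m (tgt (v, i)) (tgt (w, j))) =
      (\<Sum>i<d. \<Sum>m<n. \<Sum>j<d. meet_prob d m (tgt (v, i)) (tgt (w, j)))"
      by (intro sum.cong refl sum.swap)
    also have "\<dots> = (\<Sum>m<n. \<Sum>i<d. \<Sum>j<d. meet_prob d m (tgt (v, i)) (tgt (w, j)))" by (rule sum.swap)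
    finally have sw: "(\<Sum>i<d. \<Sum>j<d. \<Sum>m<n. meet_prob d m (tgt (v, i)) (tgt (w, j))) =
      (\<Sum>m<n. \<Sum>i<d. \<Sum>j<d. meet_prob d m (tgt (v, i)) (tgt (w, j)))" .
    have "(\<Sum>i<d. \<Sum>j<d. 1 + k * (\<Sum>m<n. meet_prob d m (tgt (v, i)) (tgt (w, j)))) =
      (real d)\<^sup>2 + k * (\<Sum>m<n. \<Sum>i<d. \<Sum>j<d. meet_prob d m (tgt (v, i)) (tgt (w, j)))"
      unfolding sw[symmetric] by (simp add: sum.distrib sum_distrib_left[symmetric] power2_eq_square)
    thus ?thesis using d by (simp add: add_divide_distrib sum_divide_distrib[symmetric])
  qed
  also have "\<dots> = 1 + k * ((\<Sum>m<Suc n. meet_prob d m v w) - of_bool (v = w))"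
    by (subst sum.lessThan_Suc_shift) simp
  finally have 1: "(\<Sum>i<d. \<Sum>j<d. pair_moment l d n (tgt (v, i)) (tgt (w, j))) / (real d)\<^sup>2
     \<le> 1 + k * ((\<Sum>m<Suc n. meet_prob d m v w) - of_bool (v = w))" .
  have "of_bool (v = w) * (l - 1) * (\<Sum>i<d. pair_moment l d n (tgt (v, i)) (tgt (v, i))) / (real d)\<^sup>2
     \<le> of_bool (v = w) * (l - 1) * (\<Sum>i<d. C) / (real d)\<^sup>2"
    using l Suc.prems by (intro divide_right_mono mult_left_mono sum_mono) auto
  also have "\<dots> = k * of_bool (v = w)" using d by (simp add: k_def power2_eq_square)
  finally have 2: "of_bool (v = w) * (l - 1) * (\<Sum>i<d. pair_moment l d n (tgt (v, i)) (tgt (v, i))) / (real d)\<^sup>2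
     \<le> k * of_bool (v = w)" .
  show ?case
    unfolding pair_moment.simps split add_divide_distrib k_def[symmetric] using 1 2 by (simp add: algebra_simps)
qed

text \<open>C = 1/(1 - k) solves C = 1 + k C, so that the estimate of
  \<open>pair_moment_step\<close> reproduces the bound assumed for smaller \<open>n\<close>.\<close>

lemma pair_moment_bound:
  assumes d: "d \<ge> 5" and l: "l \<ge> 1" and lt: "(l - 1) / real d * meet_bound d < 1"
  shows "pair_moment l d n x x \<le> 1 / (1 - (l - 1) / real d * meet_bound d)"
proof (induction n arbitrary: x rule: less_induct)
  case (less n)
  define k where "k = (l - 1) / real d * meet_bound d"
  define C where "C = 1 / (1 - k)"
  have "k < 1" unfolding k_def by (rule lt)
  hence C: "C > 0" "1 + k * C = C" by (auto simp: C_def field_simps)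
  have "pair_moment l d n x x \<le> 1 + (l - 1) / real d * C * (\<Sum>j<n. meet_prob d j x x)"
    using d l less.IH by (intro pair_moment_step) (auto simp: C_def k_def)
  also have "\<dots> \<le> 1 + (l - 1) / real d * C * meet_bound d"
    using l C sum_meet_prob_le[OF d] by (intro add_left_mono mult_left_mono) auto
  also have "\<dots> = 1 + k * C" by (simp add: k_def)
  finally show ?case using C by (simp add: C_def k_def)
qed

text \<open>Hypothesis \<open>gt\<close> rearranges to
  \<open>(1/p - 1) / d * meet_bound d < 1\<close>. The second moment is then at most
  \<open>C\<close> times the squared mean, and Cauchy-Schwarz gives survival for \<open>n\<close>
  generations with probability at least \<open>1 / C\<close>, uniformly in \<open>n\<close>.\<close>

lemma theta_pos_second_moment:
  assumes d: "d \<ge> 5" and p: "0 < p" "p \<le> 1" and gt: "meet_bound d < p * (real d + meet_bound d)"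
  shows "0 < oriented_theta d p"
proof -
  define l where "l = 1 / p"
  define C where "C = 1 / (1 - (l - 1) / real d * meet_bound d)"
  have l: "l \<ge> 1" using p by (simp add: l_def)
  have lt: "(l - 1) / real d * meet_bound d < 1"
  proof -
    have "(1 - p) * meet_bound d < p * real d" using gt by (simp add: algebra_simps)
    hence "(1 - p) * meet_bound d / (p * real d) < 1" using p d by simp
    moreover have "(l - 1) / real d * meet_bound d = (1 - p) * meet_bound d / (p * real d)"
      using p by (simp add: l_def field_simps)
    ultimately show ?thesis by simp
  qed
  have C: "C > 0" using lt by (simp add: C_def)
  have p0: "0 \<le> p" using p by simp
  have "1 / C \<le> oriented_theta d p"
  proof (rule theta_ge_run[OF direct.exploration_axioms out_edges_subset origin_Zd p0 p(2) _ out_open_step])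
    show "level d origin = 0" by simp
    fix n
    define X where "X = direct.explored d n {origin}"
    \<comment> \<open>Large enough to carry both the paths counted by \<open>N\<close> and the run;
      at the end the run is restricted to \<open>X\<close>.\<close>
    define J where "J = X \<union> (\<Union>xs\<in>paths d n. path_edges origin xs)"
    define N where "N S = (\<Sum>xs\<in>paths d n. of_bool (path_edges origin xs \<subseteq> S) :: real)" for S
    have fX: "finite X" unfolding X_def by (intro direct.finite_explored) auto
    have fJ: "finite J" using fX by (simp add: J_def)
    have sub: "path_edges origin xs \<subseteq> J" if "xs \<in> paths d n" for xs using that by (auto simp: J_def)
    have EN: "bernoulli_exp p J N = (real d * p) ^ n"
    proof -
      have "bernoulli_exp p J N = (\<Sum>xs\<in>paths d n. p ^ card (path_edges origin xs))"
        unfolding N_def bernoulli_exp_sum using bernoulli_exp_all[OF fJ sub] by (intro sum.cong) auto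
      also have "\<dots> = (\<Sum>xs\<in>paths d n. p ^ n)"
        by (intro sum.cong refl) (auto simp: paths_def card_path_edges)
      finally show ?thesis by (simp add: card_paths power_mult_distrib)
    qed
    have EN2: "bernoulli_exp p J (\<lambda>S. (N S)\<^sup>2) \<le> (real d * p) ^ (2 * n) * C"
    proof -
      have "bernoulli_exp p J (\<lambda>S. (N S)\<^sup>2) = bernoulli_exp p J (\<lambda>S. \<Sum>xs\<in>paths d n. \<Sum>ys\<in>paths d n.
          of_bool (path_edges origin xs \<union> path_edges origin ys \<subseteq> S))"
        unfolding N_def power2_eq_square sum_product
        by (intro bernoulli_exp_cong sum.cong refl) auto
      also have "\<dots> = (\<Sum>xs\<in>paths d n. \<Sum>ys\<in>paths d n. p ^ card (path_edges origin xs \<union> path_edges origin ys))"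
        unfolding bernoulli_exp_sum using sub by (intro sum.cong refl bernoulli_exp_all fJ) auto
      also have "\<dots> = (\<Sum>xs\<in>paths d n. \<Sum>ys\<in>paths d n. p ^ (2 * n) * l ^ overlap origin xs origin ys)"
      proof (intro sum.cong refl)
        fix xs ys assume "xs \<in> paths d n" "ys \<in> paths d n"
        hence "card (path_edges origin xs \<union> path_edges origin ys) + overlap origin xs origin ys = 2 * n"
          using card_path_edges_Un[of xs d ys origin origin] by (auto simp: paths_def)
        hence "p ^ (2 * n) = p ^ card (path_edges origin xs \<union> path_edges origin ys) * p ^ overlap origin xs origin ys"
          by (metis power_add)
        thus "p ^ card (path_edges origin xs \<union> path_edges origin ys) = p ^ (2 * n) * l ^ overlap origin xs origin ys"
          using p by (simp add: l_def power_divide)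
      qed
      also have "\<dots> = p ^ (2 * n) * (real d ^ (2 * n) * pair_moment l d n origin origin)"
        using d by (simp add: sum_distrib_left[symmetric] pair_moment_eq)
      also have "\<dots> \<le> p ^ (2 * n) * (real d ^ (2 * n) * C)"
        unfolding C_def using p0 by (intro mult_left_mono pair_moment_bound d l lt) auto
      finally show ?thesis by (simp add: power_mult_distrib mult_ac)
    qed
    define Pr where "Pr = bernoulli_exp p J (\<lambda>S. of_bool (N S \<noteq> 0))"
    have Pr0: "Pr \<ge> 0" unfolding Pr_def bernoulli_exp_def using p by (intro sum_nonneg mult_nonneg_nonneg) auto
    have "((real d * p) ^ n)\<^sup>2 \<le> bernoulli_exp p J (\<lambda>S. (N S)\<^sup>2) * Pr"
      using bernoulli_exp_Cauchy_Schwarz[OF p0 p(2), of J N] by (simp add: EN Pr_def)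
    also have "\<dots> \<le> (real d * p) ^ (2 * n) * C * Pr" using EN2 Pr0 by (rule mult_right_mono)
    finally have "(real d * p) ^ (2 * n) * 1 \<le> (real d * p) ^ (2 * n) * (C * Pr)"
      by (simp add: power_mult[symmetric] mult_ac)
    hence "1 \<le> C * Pr" by (rule mult_left_le_imp_le) (use p d in simp)
    hence "1 / C \<le> Pr" using C by (simp add: field_simps)
    also have "Pr \<le> bernoulli_exp p J (\<lambda>S. of_bool (direct.run d n {origin} S \<noteq> {}))"
      unfolding Pr_def
    proof (intro bernoulli_exp_mono p0 p(2))
      fix S
      have "direct.run d n {origin} S \<noteq> {}" if "N S \<noteq> 0"
      proof -
        have "\<exists>xs\<in>paths d n. path_edges origin xs \<subseteq> S"
          by (rule ccontr) (use that in \<open>simp add: N_def\<close>)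
        then obtain xs where "xs \<in> paths d n" "path_edges origin xs \<subseteq> S" by blast
        thus ?thesis using path_run[of xs d origin S "{origin}"] by (auto simp: paths_def)
      qed
      thus "of_bool (N S \<noteq> 0) \<le> (of_bool (direct.run d n {origin} S \<noteq> {}) :: real)" by auto
    qed
    also have "\<dots> = bernoulli_exp p J (\<lambda>S. of_bool (direct.run d n {origin} (S \<inter> X) \<noteq> {}))"
      unfolding X_def by (subst direct.run_restrict) auto
    also have "\<dots> = bernoulli_exp p X (\<lambda>S. of_bool (direct.run d n {origin} S \<noteq> {}))"
      by (rule bernoulli_exp_restrict[OF fJ, of X p "\<lambda>S. of_bool (direct.run d n {origin} S \<noteq> {})"]) (simp add: J_def)
    finally show "1 / C \<le> bernoulli_exp p (direct.explored d n {origin}) (\<lambda>S. of_bool (direct.run d n {origin} S \<noteq> {}))"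
      by (simp add: X_def)
  qed
  moreover have "1 / C > 0" using C by simp
  ultimately show ?thesis by linarith
qed

section \<open>Numerical estimates\<close>

lemma meet_bound_le:
  assumes d: "d \<ge> 5"
  defines "x \<equiv> real d"
  shows "meet_bound d \<le> 1 + 1 / x + 2 / x\<^sup>2 + 30 / x ^ 3 + 384 / x ^ 4" and "meet_bound d > 0"
proof -
  have x: "x \<ge> 5" using d by (simp add: x_def)
  \<comment> \<open>These terms decrease up to index \<open>d\<close>. The \<open>d - 4\<close>
    terms from index 4 on are at most 24/x^4 each, together 24/x^3 - 96/x^4, and the last summand is
    at most 480/x^4; this produces the coefficients 30 and 384.\<close>
  have decr: "fact (j + m) / x ^ (j + m) \<le> fact j / x ^ j" if "j + m \<le> d" for j m
    using that
  proof (induction m)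
    case (Suc m)
    have "fact (j + Suc m) / x ^ (j + Suc m) = (real (j + Suc m) / x) * (fact (j + m) / x ^ (j + m))"
      using x by (simp add: field_simps)
    also have "\<dots> \<le> 1 * (fact (j + m) / x ^ (j + m))"
      using Suc.prems x by (intro mult_right_mono) (auto simp: x_def)
    finally show ?case using Suc by simp
  qed simp
  have split: "{..<d} = {..<4} \<union> {4..<d}" using d by auto
  have "(\<Sum>j<d. fact j / x ^ j) = (\<Sum>j<4. fact j / x ^ j) + (\<Sum>j=4..<d. fact j / x ^ j)"
    unfolding split by (rule sum.union_disjoint) auto
  also have "(\<Sum>j=4..<d. fact j / x ^ j) \<le> (\<Sum>j=4..<d. 24 / x ^ 4)"
  proof (intro sum_mono)
    fix j assume "j \<in> {4..<d}"
    thus "fact j / x ^ j \<le> 24 / x ^ 4" using decr[of 4 "j - 4"] by (simp add: fact_numeral)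
  qed
  also have "\<dots> = 24 * (x - 4) / x ^ 4" using d by (simp add: x_def)
  also have "(\<Sum>j<4. fact j / x ^ j) = 1 + 1 / x + 2 / x\<^sup>2 + 6 / x ^ 3"
    by (simp add: eval_nat_numeral)
  finally have 1: "(\<Sum>j<d. fact j / x ^ j) \<le> 1 + 1 / x + 2 / x\<^sup>2 + 6 / x ^ 3 + 24 * (x - 4) / x ^ 4" by simp
  have "fact d / x ^ d \<le> 120 / x ^ 5" using decr[of 5 "d - 5"] d by (simp add: fact_numeral)
  hence "4 * x * (fact d / x ^ d) \<le> 4 * x * (120 / x ^ 5)" using x by (intro mult_left_mono) auto
  also have "\<dots> = 480 / x ^ 4" using x by (simp add: eval_nat_numeral)
  finally have 2: "4 * x * (fact d / x ^ d) \<le> 480 / x ^ 4" .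
  have "24 * (x - 4) / x ^ 4 = 24 / x ^ 3 - 96 / x ^ 4" using x by (simp add: field_simps eval_nat_numeral)
  with 1 2 show "meet_bound d \<le> 1 + 1 / x + 2 / x\<^sup>2 + 30 / x ^ 3 + 384 / x ^ 4"
    unfolding meet_bound_def x_def[symmetric] by simp
  have "(\<Sum>j<d. fact j / x ^ j) \<ge> 0" using x by (intro sum_nonneg) auto
  moreover have "4 * x * (fact d / x ^ d) > 0" using x by simp
  ultimately show "meet_bound d > 0" unfolding meet_bound_def x_def[symmetric] by linarith
qed

lemma C_const_ge: "d \<ge> 4 \<Longrightarrow> 1 + 8 / real d \<le> C_const d"
  unfolding C_const_def by (auto intro!: mult_nonneg_nonneg divide_nonneg_nonneg)

lemma oriented_pc_second_moment:
  assumes d: "d \<ge> 5"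
  shows "oriented_pc d \<le> 1 / real d + C_const d / (real d)\<^sup>2"
proof (rule oriented_pc_le)
  fix p :: real assume p: "0 \<le> p" "p \<le> 1" "1 / real d + C_const d / (real d)\<^sup>2 < p"
  define x where "x = real d"
  define G where "G = meet_bound d"
  have x: "x \<ge> 5" using d by (simp add: x_def)
  have G: "G \<le> 1 + 1 / x + 2 / x\<^sup>2 + 30 / x ^ 3 + 384 / x ^ 4" "G > 0"
    using meet_bound_le[OF d] by (auto simp: G_def x_def)
  \<comment> \<open>The claimed bound with \<open>1 + 8 / d\<close> in place of
    \<open>C_const d\<close>, hence a lower bound for it.\<close>
  define b where "b = 1 / x + (1 + 8 / x) / x\<^sup>2"
  have "(1 + 8 / x) / x\<^sup>2 \<le> C_const d / x\<^sup>2"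
    using C_const_ge[of d] d by (intro divide_right_mono) (auto simp: x_def)
  hence b: "b < p" using p by (simp add: b_def x_def)
  have bx: "b * x ^ 3 = x\<^sup>2 + x + 8" using x by (simp add: b_def field_simps eval_nat_numeral)
  have Gx: "G * x ^ 4 \<le> x ^ 4 + x ^ 3 + 2 * x\<^sup>2 + 30 * x + 384"
  proof -
    have "G * x ^ 4 \<le> (1 + 1 / x + 2 / x\<^sup>2 + 30 / x ^ 3 + 384 / x ^ 4) * x ^ 4"
      using G x by (intro mult_right_mono) auto
    also have "\<dots> = x ^ 4 + x ^ 3 + 2 * x\<^sup>2 + 30 * x + 384" using x by (simp add: field_simps eval_nat_numeral)
    finally show ?thesis .
  qed
  have "G \<le> b * (x + G)"
  proof -
    \<comment> \<open>Multiplied by x^3, the goal is a polynomial inequality for \<open>G\<close>.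
      After the shift by 5 the polynomials involved have nonnegative coefficients in
      \<open>y\<close>.\<close>
    define y where "y = x - 5"
    have y: "y \<ge> 0" "x = y + 5" using x by (auto simp: y_def)
    have pos: "x ^ 3 - x\<^sup>2 - x - 8 \<ge> 0" unfolding y(2) using y(1) by (simp add: eval_nat_numeral algebra_simps)
    have "G * x ^ 4 * (x ^ 3 - x\<^sup>2 - x - 8) \<le> (x ^ 4 + x ^ 3 + 2 * x\<^sup>2 + 30 * x + 384) * (x ^ 3 - x\<^sup>2 - x - 8)"
      using Gx pos by (rule mult_right_mono)
    also have "\<dots> \<le> x ^ 5 * (x\<^sup>2 + x + 8)"
    proof -
      have "x ^ 5 * (x\<^sup>2 + x + 8) - (x ^ 4 + x ^ 3 + 2 * x\<^sup>2 + 30 * x + 384) * (x ^ 3 - x\<^sup>2 - x - 8) \<ge> 0"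
        unfolding y(2) using y(1) by (simp add: eval_nat_numeral algebra_simps)
      thus ?thesis by simp
    qed
    finally have "x ^ 4 * (G * (x ^ 3 - x\<^sup>2 - x - 8)) \<le> x ^ 4 * (x * (x\<^sup>2 + x + 8))"
      by (simp add: eval_nat_numeral mult_ac)
    hence "G * (x ^ 3 - x\<^sup>2 - x - 8) \<le> x * (x\<^sup>2 + x + 8)" by (rule mult_left_le_imp_le) (use x in simp)
    hence "G * x ^ 3 \<le> (b * x ^ 3) * (x + G)" unfolding bx by (simp add: algebra_simps)
    hence "x ^ 3 * G \<le> x ^ 3 * (b * (x + G))" by (simp add: mult_ac)
    thus ?thesis by (rule mult_left_le_imp_le) (use x in simp)
  qed
  also have "b * (x + G) < p * (x + G)" using b x G by (intro mult_strict_right_mono) auto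
  finally have "meet_bound d < p * (real d + meet_bound d)" by (simp add: G_def x_def)
  moreover have "0 < b" unfolding b_def using x by (intro add_pos_pos divide_pos_pos) auto
  ultimately show "0 < oriented_theta d p" using b p by (intro theta_pos_second_moment d) auto
qed

text \<open>Two dimensions times two: 1 - sqrt (1/3) is at most 7/16 = 1/4 + 3/16, and
  \<open>C_const 4\<close> is at least 3.\<close>

lemma oriented_pc_4: "oriented_pc 4 \<le> 1 / real 4 + C_const 4 / (real 4)\<^sup>2"
proof -
  have "(9/16 :: real) \<le> sqrt (1/3)" by (rule real_le_rsqrt) (simp add: power2_eq_square)
  hence "(9/16 :: real) \<le> (1/3) powr (1/2)" by (simp add: powr_half_sqrt)
  moreover have "oriented_pc (2 * 2) \<le> 1 - (1 / 3) powr (1 / real 2)" by (rule oriented_pc_even) simp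
  moreover have "C_const 4 \<ge> 3" using C_const_ge[of 4] by simp
  ultimately show ?thesis by (simp add: power2_eq_square)
qed

theorem theorem2p2:
  "(\<forall>d::nat. d \<ge> 1 \<and> even d \<longrightarrow>
      oriented_pc d \<le> 1 - (1 / 3) powr (2 / real d)) \<and>
   (\<forall>d::nat. d \<ge> 4 \<longrightarrow>
      oriented_pc d \<le> 1 / real d + C_const d / (real d)\<^sup>2) \<and>
   (\<forall>d::nat. d \<ge> 2 \<longrightarrow>
      oriented_pc (d + 1) \<le> Sol (oriented_pc d) (real (d + 1) / real d))"
proof (intro conjI allI impI)
  fix d :: nat assume "d \<ge> 1 \<and> even d"
  then obtain m where "d = 2 * m" "m \<ge> 1" by (auto elim!: evenE)
  thus "oriented_pc d \<le> 1 - (1 / 3) powr (2 / real d)" using oriented_pc_even[of m] by simp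
next
  fix d :: nat assume "d \<ge> 4"
  thus "oriented_pc d \<le> 1 / real d + C_const d / (real d)\<^sup>2"
    using oriented_pc_4 oriented_pc_second_moment[of d] by (cases "d = 4") auto
next
  fix d :: nat assume "d \<ge> 2"
  thus "oriented_pc (d + 1) \<le> Sol (oriented_pc d) (real (d + 1) / real d)"
    using oriented_pc_Suc_le_Sol(1)[of d] oriented_pc_less_1[of d] by simp
qed

end
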